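(* Let $r\ge 1$ and $s=(s_1,\dots,s_r)\in\mathbb{Z}_{>0}^r$. Let $D=\mathrm{diag}\big((T-t)^{s_1+\cdots+s_r},(T-t)^{s_2+\cdots+s_r},\dots,(T-t)^{s_r},1\big)$, let $\Lambda=\mathrm{diag}\big(\Omega^{s_1+\cdots+s_r},\Omega^{s_2+\cdots+s_r},\dots,\Omega^{s_r},1\big)$, and let $Q$ be the $(r+1)\times(r+1)$ matrix with $1$'s on the diagonal, with $Q_{i+1,i}=H_{s_i-1}(T)$ for $1\le i\le r$, and with all other entries $0$. Put $\Phi=Q^{(-1)}D$. Let $L$ be the lower triangular $(r+1)\times(r+1)$ matrix with $1$'s on the diagonal and, for $i>j$, $$L_{ij}=\sum_{d_j>d_{j+1}>\cdots>d_{i-1}\ge 0}\ \prod_{k=j}^{i-1}\big(\Omega^{s_k}H_{s_k-1}\big)^{(d_k)},$$ and put $\Psi=\Lambda L$. Then: (1) $\Phi$ has entries in $A[T]$ and defines a dual $t$-motive over $A$ of rank $r+1$. (2) $\Phi\Psi=\Psi^{(-1)}$, so that the period matrix of this dual $t$-motive is $(\Psi|_{T=t})^{-1}$. (3) The inverse of the period matrix, namely $\Psi|_{T=t}$, is lower triangular; its $(j,j)$ entry is $\tilde\pi^{-(s_j+\cdots+s_r)}$ for $1\le j\le r+1$ (the empty sum for $j=r+1$ being $0$), and for $1\le j<i\le r+1$ its $(i,j)$ entry is $$\tilde\pi^{-(s_j+\cdots+s_r)}\,\Gamma_{s_j}\Gamma_{s_{j+1}}\cdots\Gamma_{s_{i-1}}\,\zeta(s_j,s_{j+1},\dots,s_{i-1}).$$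 In particular, its $(r+1,1)$ entry is $\Gamma_{s_1}\cdots\Gamma_{s_r}\,\zeta(s_1,\dots,s_r)/\tilde\pi^{\,s_1+\cdots+s_r}$, so it contains (up to these factors) the depth $r$ multizeta value $\zeta(s_1,\dots,s_r)$.
   Context: Let $q$ be a power of a prime $p$, let $T,\tilde t$ be independent variables, and put $t=-\tilde t^{\,q-1}$. Put $A=\mathbb{F}_q[t]$, $A_+=$ the set of monic polynomials in $A$, $K=\mathbb{F}_q(t)$, $K_\infty=\mathbb{F}_q((1/t))$, $\tilde K_\infty=\mathbb{F}_q((1/\tilde t))$, and let $\mathbb{C}_\infty$ be the completion of an algebraic closure of $\tilde K_\infty$. Multizeta values: for $k\ge1$ an integer and $d\ge0$ put $S_d(k)=\sum_{a\in A_+,\ \deg a=d}a^{-k}$. For $(k_1,\dots,k_m)\in\mathbb{Z}_{>0}^m$ put $\zeta(k_1,\dots,k_m)=\sum_{d_1>\cdots>d_m\ge0}S_{d_1}(k_1)\cdots S_{d_m}(k_m)\in K_\infty$; $m$ is called the depth. Twisting: for $f=\sum_{i\ge0}f_iT^i\in\mathbb{C}_\infty[[T]]$ and $n\in\mathbb{Z}$, $f^{(n)}=\sum_i f_i^{q^n}T^i$; this is extended entrywise to matrices. The function $\Omega$: $\Omega(T)=\tilde t^{-q}\prod_{i=1}^\infty(1-T/t^{q^i})$, a power series in $T$ over $\tilde K_\infty$ with infinite radius of convergence, satisfying $\Omega^{(-1)}=(T-t)\Omega$. Put $\tilde\pi=1/\Omega(t)$. Carlitz gamma: $D_n=\prod_{i=0}^{n-1}(t^{q^n}-t^{q^i})$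 for $n\ge0$. For an integer $n\ge0$ with base $q$ expansion $n=\sum_i n_iq^i$, $0\le n_i<q$, put $\Gamma_{n+1}=\prod_iD_i^{n_i}\in A$. The polynomials $H_n=H_n(T)\in A[T]$ ($n\ge0$) are defined by the generating series identity $$\sum_{n=0}^\infty\frac{H_n(T)}{\Gamma_{n+1}|_{t=T}}x^n=\Big(1-\sum_{i=0}^\infty\ \prod_{j=1}^i\frac{T^{q^i}-t^{q^j}}{T^{q^i}-T^{q^{j-1}}}\;x^{q^i}\Big)^{-1},$$ where $\Gamma_{n+1}|_{t=T}$ is obtained from $\Gamma_{n+1}\in\mathbb{F}_q[t]$ by substituting $T$ for $t$, and an empty product is $1$. Dual $t$-motives: a matrix $\Phi\in\mathrm{Mat}_n(A[T])$ whose determinant is a unit of $\mathbb{F}_q$ times a power $(T-t)^m$, $m\ge0$, defines a dual $t$-motive over $A$ of rank $n$: over an algebraic closure $\overline K$ of $K$ in $\mathbb{C}_\infty$, it is the free $\overline K[T]$-module with basis $m_1,\dots,m_n$ together with the additive operator $\sigma$ satisfying $\sigma(fm)=f^{(-1)}\sigma(m)$ for $f\in\overline K[T]$ and $\sigma(m_1,\dots,m_n)^{\mathrm{tr}}=\Phi\,(m_1,\dots,m_n)^{\mathrm{tr}}$ (the trivial rank one object, with $\Phi=(1)$, is allowed). If $\Psi$ is an $n\times n$ matrix of everywhere convergent power series in $\mathbb{C}_\infty[[T]]$, invertible over the ring of power series converging on $|T|\le1$, with $\Phi\Psi=\Psi^{(-1)}$ (the uniformizability relation), and with $\Psi|_{T=t}$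 invertible, then the period matrix of the dual $t$-motive (relative to $\Psi$) is $(\Psi|_{T=t})^{-1}$. *)

theory Defs
  imports
    "HOL-Analysis.Infinite_Sum"
    "HOL-Library.Cardinality"
    "HOL-Computational_Algebra.Computational_Algebra"
    "Jordan_Normal_Form.Determinant"
begin

section \<open>The field \<open>\<complex>\<^sub>\<infinity>\<close>\<close>

text \<open>
  The absolute value of \<open>x\<close> is \<open>dist x 0\<close>. It is declared through \<open>dist\<close> so that limits,
  \<open>suminf\<close> and \<open>infsum\<close> refer to the valuation topology.
\<close>

class complete_ultrametric_field = field + complete_space +
  assumes dist_eq_dist_diff: "dist x y = dist (x - y) 0"
    and dist_mult_0: "dist (x * y) 0 = dist x 0 * dist y 0"
    and dist_add_0: "dist (x + y) 0 \<le> max (dist x 0) (dist y 0)"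

definition rel_alg_closure :: "'c::field set \<Rightarrow> 'c set" where
  "rel_alg_closure k = {x. \<exists>p. p \<noteq> 0 \<and> (\<forall>i. coeff p i \<in> k) \<and> poly p x = 0}"

text \<open>
  The finite field \<open>\<F>\<^sub>q\<close> is the type \<open>'f\<close>, so that \<open>q = CARD('f)\<close>, and \<open>'f fls\<close> is
  \<open>\<F>\<^sub>q((1/t_tilde))\<close>: the Laurent variable \<open>fls_X\<close> is \<open>1/t_tilde\<close>. The locale says that the type
  \<open>'c\<close> is, via \<open>emb\<close>, a completion of an algebraic closure of this field, namely of the
  algebraic closure of the image of \<open>emb\<close> inside \<open>'c\<close>. The absolute value is determined up to
  the choice of \<open>b = \<bar>t_tilde\<bar> > 1\<close>.
\<close>

locale C_infinity =
  fixes emb :: "'f::{field,finite} fls \<Rightarrow> 'c::complete_ultrametric_field"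
  assumes emb_1: "emb 1 = 1"
    and emb_add: "emb (f + g) = emb f + emb g"
    and emb_mult: "emb (f * g) = emb f * emb g"
    and emb_dist: "\<exists>b>1. \<forall>f. f \<noteq> 0 \<longrightarrow>
      dist (emb f) 0 = b powr (- real_of_int (fls_subdegree f))"
    and alg_closed: "\<lbrakk>degree p > 0; \<And>i. coeff p i \<in> rel_alg_closure (range emb)\<rbrakk> \<Longrightarrow>
      \<exists>x \<in> rel_alg_closure (range emb). poly p x = 0"
    and dense: "closure (rel_alg_closure (range emb)) = UNIV"

definition t_tilde :: "('f::{field,finite} fls \<Rightarrow> 'c::field) \<Rightarrow> 'c" where
  "t_tilde emb = emb fls_X_inv"

definition t_elt :: "('f::{field,finite} fls \<Rightarrow> 'c::field) \<Rightarrow> 'c" where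
  "t_elt emb = - (t_tilde emb ^ (CARD('f) - 1))"

text \<open>The ring \<open>A = \<F>\<^sub>q[t]\<close> is the type \<open>'f poly\<close>; \<open>A_emb\<close> is its inclusion into \<open>\<complex>\<^sub>\<infinity>\<close>.\<close>

definition A_emb :: "('f::{field,finite} fls \<Rightarrow> 'c::field) \<Rightarrow> 'f poly \<Rightarrow> 'c" where
  "A_emb emb a = poly (map_poly (\<lambda>c. emb (fls_const c)) a) (t_elt emb)"

definition K_bar :: "('f::{field,finite} fls \<Rightarrow> 'c::field) \<Rightarrow> 'c set" where
  "K_bar emb = rel_alg_closure {A_emb emb a / A_emb emb b | a b. b \<noteq> 0}"

definition polys_over :: "'c::zero set \<Rightarrow> 'c poly set" where
  "polys_over R = {f. \<forall>i. coeff f i \<in> R}"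


section \<open>Multizeta values\<close>

definition power_sum :: "('f::{field,finite} fls \<Rightarrow> 'c::field) \<Rightarrow> nat \<Rightarrow> nat \<Rightarrow> 'c" where
  "power_sum emb d k = (\<Sum>a | lead_coeff a = 1 \<and> degree a = d. inverse (A_emb emb a ^ k))"

definition decreasing_tuples :: "nat \<Rightarrow> nat list set" where
  "decreasing_tuples m = {ds. length ds = m \<and> sorted_wrt (>) ds}"

definition multizeta ::
  "('f::{field,finite} fls \<Rightarrow> 'c::complete_ultrametric_field) \<Rightarrow> nat list \<Rightarrow> 'c" where
  "multizeta emb ks =
    (\<Sum>\<^sub>\<infinity>ds\<in>decreasing_tuples (length ks). \<Prod>l<length ks. power_sum emb (ds ! l) (ks ! l))"


section \<open>Twisting\<close>

text \<open>\<open>frobenius_pow q n x\<close> is \<open>x\<^bsup>q^n\<^esup>\<close>; for negative \<open>n\<close> it is the unique root.\<close>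

definition frobenius_pow :: "nat \<Rightarrow> int \<Rightarrow> 'c::field \<Rightarrow> 'c" where
  "frobenius_pow q n x = (if n \<ge> 0 then x ^ (q ^ nat n) else (THE y. y ^ (q ^ nat (- n)) = x))"

definition fps_twist :: "nat \<Rightarrow> int \<Rightarrow> 'c::field fps \<Rightarrow> 'c fps" where
  "fps_twist q n f = Abs_fps (\<lambda>i. frobenius_pow q n (fps_nth f i))"

definition poly_twist :: "nat \<Rightarrow> int \<Rightarrow> 'c::field poly \<Rightarrow> 'c poly" where
  "poly_twist q n f = map_poly (frobenius_pow q n) f"


section \<open>Convergent power series and the function \<open>\<Omega>\<close>\<close>

text \<open>
  The library's \<open>fps_conv_radius\<close> and \<open>eval_fps\<close> are confined to normed algebras over the reals.
\<close>

definition fps_converges_at :: "'c::{field,topological_space} fps \<Rightarrow> 'c \<Rightarrow> bool" where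
  "fps_converges_at f z \<longleftrightarrow> summable (\<lambda>n. fps_nth f n * z ^ n)"

definition fps_value :: "'c::{field,t2_space} fps \<Rightarrow> 'c \<Rightarrow> 'c" where
  "fps_value f z = (\<Sum>n. fps_nth f n * z ^ n)"

text \<open>
  The infinite product is taken coefficientwise in the topology of \<open>\<complex>\<^sub>\<infinity>\<close>; it does not converge
  in the metric that the library puts on \<open>fps\<close>, which is the adic one.
\<close>

definition Omega :: "('f::{field,finite} fls \<Rightarrow> 'c::complete_ultrametric_field) \<Rightarrow> 'c fps" where
  "Omega emb = Abs_fps (\<lambda>n. lim (\<lambda>N.
     fps_nth (fps_const (inverse (t_tilde emb ^ CARD('f))) *
       (\<Prod>i=1..N. 1 - fps_const (inverse (t_elt emb ^ (CARD('f) ^ i))) * fps_X)) n))"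

definition pi_tilde :: "('f::{field,finite} fls \<Rightarrow> 'c::complete_ultrametric_field) \<Rightarrow> 'c" where
  "pi_tilde emb = 1 / fps_value (Omega emb) (t_elt emb)"


section \<open>Carlitz gamma and the polynomials \<open>H\<^sub>n\<close>\<close>

definition carlitz_D :: "nat \<Rightarrow> 'f::{field,finite} poly" where
  "carlitz_D n = (\<Prod>i<n. monom 1 (CARD('f) ^ n) - monom 1 (CARD('f) ^ i))"

text \<open>
  \<open>carlitz_gamma (n + 1)\<close> is the product of the \<open>D\<^sub>i\<close> to the \<open>i\<close>-th base \<open>q\<close> digit of \<open>n\<close>; these
  digits vanish for \<open>i > n\<close>. The value at \<open>0\<close> is irrelevant.
\<close>

definition carlitz_gamma :: "nat \<Rightarrow> 'f::{field,finite} poly" where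
  "carlitz_gamma k =
    (let n = k - 1 in \<Prod>i\<le>n. carlitz_D i ^ ((n div CARD('f) ^ i) mod CARD('f)))"

text \<open>
  \<open>A[T]\<close> is the type \<open>'f poly poly\<close>, with \<open>T\<close> the outer and \<open>t\<close> the inner variable. The generating
  identity lives in \<open>Frac(A[T])[[x]]\<close>.
\<close>

definition outer_T :: "'f::field poly poly" where
  "outer_T = [:0, 1:]"

definition inner_t :: "'f::field poly poly" where
  "inner_t = [:[:0, 1:]:]"

definition subst_T :: "'f::field poly \<Rightarrow> 'f poly poly" where
  "subst_T a = map_poly (\<lambda>c. [:c:]) a"

definition AT_series :: "'f::{field,finite} poly poly fract fps" where
  "AT_series = inverse (1 - Abs_fps (\<lambda>n. \<Sum>i | CARD('f) ^ i = n. \<Prod>j=1..i.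
     Fract (outer_T ^ (CARD('f) ^ i) - inner_t ^ (CARD('f) ^ j))
           (outer_T ^ (CARD('f) ^ i) - outer_T ^ (CARD('f) ^ (j - 1)))))"

definition AT_H :: "nat \<Rightarrow> 'f::{field,finite} poly poly" where
  "AT_H = (THE H. Abs_fps (\<lambda>n. Fract (H n) (subst_T (carlitz_gamma (n + 1)))) = AT_series)"

definition AT_H_emb ::
  "('f::{field,finite} fls \<Rightarrow> 'c::field) \<Rightarrow> nat \<Rightarrow> 'c poly" where
  "AT_H_emb emb n = map_poly (A_emb emb) (AT_H n)"


section \<open>Dual \<open>t\<close>-motives and periods\<close>

text \<open>
  The free module with basis \<open>m\<^sub>1, \<dots>, m\<^sub>n\<close> over the polynomial ring over \<open>K_bar emb\<close> is realised
  as the vectors of length \<open>n\<close>, with \<open>m\<^sub>i\<close> the \<open>i\<close>-th unit vector.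
\<close>

definition motive_module :: "('f::{field,finite} fls \<Rightarrow> 'c::field) \<Rightarrow> nat \<Rightarrow> 'c poly vec set" where
  "motive_module emb n = {v \<in> carrier_vec n. \<forall>i<n. v $ i \<in> polys_over (K_bar emb)}"

definition is_sigma ::
  "('f::{field,finite} fls \<Rightarrow> 'c::field) \<Rightarrow> nat \<Rightarrow> 'c poly mat \<Rightarrow>
    ('c poly vec \<Rightarrow> 'c poly vec) \<Rightarrow> bool" where
  "is_sigma emb n \<Phi> \<sigma> \<longleftrightarrow>
     (\<forall>v \<in> motive_module emb n. \<sigma> v \<in> motive_module emb n) \<and>
     (\<forall>v \<in> motive_module emb n. \<forall>w \<in> motive_module emb n. \<sigma> (v + w) = \<sigma> v + \<sigma> w) \<and>
     (\<forall>f \<in> polys_over (K_bar emb). \<forall>v \<in> motive_module emb n.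
        \<sigma> (f \<cdot>\<^sub>v v) = poly_twist CARD('f) (- 1) f \<cdot>\<^sub>v \<sigma> v) \<and>
     (\<forall>i<n. \<sigma> (unit_vec n i) = row \<Phi> i)"

definition defines_dual_t_motive ::
  "('f::{field,finite} fls \<Rightarrow> 'c::field) \<Rightarrow> nat \<Rightarrow> 'c poly mat \<Rightarrow> bool" where
  "defines_dual_t_motive emb n \<Phi> \<longleftrightarrow>
     \<Phi> \<in> carrier_mat n n \<and>
     elements_mat \<Phi> \<subseteq> polys_over (range (A_emb emb)) \<and>
     (\<exists>c m. c \<noteq> 0 \<and> det \<Phi> = Polynomial.smult (emb (fls_const c)) ([:- t_elt emb, 1:] ^ m)) \<and>
     (\<exists>\<sigma>. is_sigma emb n \<Phi> \<sigma>)"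

definition mat_value :: "'c::{field,t2_space} fps mat \<Rightarrow> 'c \<Rightarrow> 'c mat" where
  "mat_value \<Psi> z = map_mat (\<lambda>f. fps_value f z) \<Psi>"

definition uniformizes ::
  "('f::{field,finite} fls \<Rightarrow> 'c::complete_ultrametric_field) \<Rightarrow> nat \<Rightarrow>
    'c poly mat \<Rightarrow> 'c fps mat \<Rightarrow> bool" where
  "uniformizes emb n \<Phi> \<Psi> \<longleftrightarrow>
     \<Psi> \<in> carrier_mat n n \<and>
     (\<forall>f \<in> elements_mat \<Psi>. \<forall>z. fps_converges_at f z) \<and>
     (\<exists>\<Theta> \<in> carrier_mat n n.
        (\<forall>f \<in> elements_mat \<Theta>. \<forall>z. dist z 0 \<le> 1 \<longrightarrow> fps_converges_at f z) \<and>
        inverts_mat \<Psi> \<Theta> \<and> inverts_mat \<Theta> \<Psi>) \<and>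
     map_mat fps_of_poly \<Phi> * \<Psi> = map_mat (fps_twist CARD('f) (- 1)) \<Psi> \<and>
     invertible_mat (mat_value \<Psi> (t_elt emb))"

definition is_period_matrix ::
  "('f::{field,finite} fls \<Rightarrow> 'c::complete_ultrametric_field) \<Rightarrow> nat \<Rightarrow>
    'c poly mat \<Rightarrow> 'c fps mat \<Rightarrow> 'c mat \<Rightarrow> bool" where
  "is_period_matrix emb n \<Phi> \<Psi> P \<longleftrightarrow>
     defines_dual_t_motive emb n \<Phi> \<and> uniformizes emb n \<Phi> \<Psi> \<and>
     inverts_mat P (mat_value \<Psi> (t_elt emb)) \<and> inverts_mat (mat_value \<Psi> (t_elt emb)) P"


section \<open>The matrices attached to a tuple\<close>

text \<open>
  The tuple \<open>(s\<^sub>1, \<dots>, s\<^sub>r)\<close> is the list \<open>s\<close>, and all indices are shifted to start at \<open>0\<close>; thus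
  \<open>s\<^sub>j + \<dots> + s\<^sub>r\<close> becomes \<open>tail_sum s j\<close> and \<open>(s\<^sub>j, \<dots>, s\<^bsub>i-1\<^esub>)\<close> becomes \<open>segment s j i\<close>.
\<close>

definition tail_sum :: "nat list \<Rightarrow> nat \<Rightarrow> nat" where
  "tail_sum s j = (\<Sum>k=j..<length s. s ! k)"

definition segment :: "nat list \<Rightarrow> nat \<Rightarrow> nat \<Rightarrow> nat list" where
  "segment s j i = map (\<lambda>k. s ! k) [j..<i]"

definition D_mat :: "('f::{field,finite} fls \<Rightarrow> 'c::field) \<Rightarrow> nat list \<Rightarrow> 'c poly mat" where
  "D_mat emb s = mat_diag (length s + 1) (\<lambda>i. [:- t_elt emb, 1:] ^ tail_sum s i)"

definition Q_mat :: "('f::{field,finite} fls \<Rightarrow> 'c::field) \<Rightarrow> nat list \<Rightarrow> 'c poly mat" where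
  "Q_mat emb s = mat (length s + 1) (length s + 1) (\<lambda>(i, j).
     if i = j then 1 else if i = j + 1 then AT_H_emb emb (s ! j - 1) else 0)"

definition Phi_mat :: "('f::{field,finite} fls \<Rightarrow> 'c::field) \<Rightarrow> nat list \<Rightarrow> 'c poly mat" where
  "Phi_mat emb s = map_mat (poly_twist CARD('f) (- 1)) (Q_mat emb s) * D_mat emb s"

definition Lambda_mat ::
  "('f::{field,finite} fls \<Rightarrow> 'c::complete_ultrametric_field) \<Rightarrow> nat list \<Rightarrow> 'c fps mat" where
  "Lambda_mat emb s = mat_diag (length s + 1) (\<lambda>i. Omega emb ^ tail_sum s i)"

text \<open>The sum over the decreasing tuples is again taken coefficientwise in \<open>\<complex>\<^sub>\<infinity>\<close>.\<close>

definition L_series ::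
  "('f::{field,finite} fls \<Rightarrow> 'c::complete_ultrametric_field) \<Rightarrow> nat list \<Rightarrow> 'c fps" where
  "L_series emb ks = Abs_fps (\<lambda>n.
     \<Sum>\<^sub>\<infinity>ds\<in>decreasing_tuples (length ks).
       fps_nth (\<Prod>l<length ks. fps_twist CARD('f) (int (ds ! l))
         (Omega emb ^ (ks ! l) * fps_of_poly (AT_H_emb emb (ks ! l - 1)))) n)"

definition L_mat ::
  "('f::{field,finite} fls \<Rightarrow> 'c::complete_ultrametric_field) \<Rightarrow> nat list \<Rightarrow> 'c fps mat" where
  "L_mat emb s = mat (length s + 1) (length s + 1) (\<lambda>(i, j).
     if i = j then 1 else if j < i then L_series emb (segment s j i) else 0)"

definition Psi_mat ::
  "('f::{field,finite} fls \<Rightarrow> 'c::complete_ultrametric_field) \<Rightarrow> nat list \<Rightarrow> 'c fps mat" where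
  "Psi_mat emb s = Lambda_mat emb s * L_mat emb s"

end

theory Submission
  imports Defs "HOL-Algebra.Finite_Extensions" "Jordan_Normal_Form.Char_Poly"
begin

text \<open>
  Write \<open>q\<close> for \<open>CARD('f)\<close>, \<open>f^(n)\<close> for the \<open>n\<close>-th twist of \<open>f\<close>, and \<open>G k\<close> for the product of
  \<open>\<Omega>^k\<close> and \<open>H (k - 1)\<close>, which is \<open>L_factor k\<close> below. The series \<open>L\<close> of a tuple \<open>k 1, \<dots>, k m\<close> is
  the sum of the products of the \<open>(G (k l))^(d l)\<close> over all \<open>d 1 > \<dots> > d m \<ge> 0\<close>.

  The uniformizability relation: splitting off the tuples with \<open>d m = 0\<close> gives
  \<open>L = L^(1) + L'^(1) G (k m)\<close>, where \<open>L'\<close> is the series of \<open>k 1, \<dots>, k (m - 1)\<close>; hence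
  \<open>L^(-1) = L + L' (G (k m))^(-1)\<close>, which is \<open>untw_L_series\<close>. Together with \<open>\<Omega>^(-1) = (T - t) \<Omega>\<close>
  (\<open>untw_Omega\<close>) this is \<open>\<Phi> \<Psi> = \<Psi>^(-1)\<close>, entry by entry. Untwisting is a ring homomorphism
  because \<open>\<complex>\<^sub>\<infinity>\<close> is perfect (\<open>exists_frob_root\<close>), and it turns the \<open>H n\<close> into polynomials over \<open>A\<close>
  because their coefficients are \<open>q\<close>-th powers (\<open>coeff_H_rec_power\<close>).

  Convergence: as a polynomial in \<open>t\<close>, \<open>H (k - 1)\<close> has degree at most \<open>(k - 1) q / (q - 1)\<close>, and so
  the Gauss norm of \<open>G k\<close> is less than \<open>1\<close> on a disk of some radius greater than \<open>1\<close>
  (\<open>L_factor_small\<close>). Twisting \<open>d\<close> times raises both this norm and the radius to the power \<open>q^d\<close>.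
  The twists therefore tend to zero uniformly on every disk, and the sums over tuples converge to
  entire series. The determinant of \<open>\<Psi>\<close> is a power of \<open>\<Omega>\<close>, whose zeros \<open>t^(q^i)\<close>, \<open>i \<ge> 1\<close>, lie
  outside the unit disk and differ from \<open>t\<close>.

  The values at \<open>T = t\<close>: let \<open>\<ell> d = (t - t^q) \<dots> (t - t^(q^d))\<close>, which is \<open>ell d\<close> below. The functional
  equation of \<open>\<Omega>\<close> gives \<open>\<Omega>(t) = \<ell> d * \<Omega>^(d)(t)\<close>. The core of the theorem is the formula
  \<open>(H (k - 1))^(d)(t) = \<Gamma> k * (\<ell> d)^k * S d k\<close> (\<open>twisted_value_H\<close>). Together they show that \<open>(G k)^(d)\<close>
  has the value \<open>\<Gamma> k * S d k / pi_tilde^k\<close> at \<open>t\<close>, and summation over the tuples yields the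
  multizeta values. To prove the formula, let \<open>E d\<close> (\<open>carlitz_E d\<close>) be the \<open>\<F>\<^sub>q\<close>-linear polynomial that
  sends each element of \<open>A\<close> of degree at most \<open>d\<close> to its coefficient at \<open>t^d\<close>. The roots of
  \<open>1 - E d\<close> are the monic elements of degree \<open>d\<close>, and its derivative is constant; so its logarithmic
  derivative shows that \<open>1 / (\<ell> d * (1 - E d x))\<close> is the generating series of the power sums
  \<open>S d (n + 1)\<close>. On the other hand, twisting the generating series of the \<open>H n / \<Gamma> (n + 1)\<close> \<open>d\<close> times
  and putting \<open>T = t\<close> turns it into \<open>1 / (1 - E d (\<ell> d * x))\<close>.
\<close>

hide_const (open) Polynomials.degree Polynomials.lead_coeff up_ring.coeff up_ring.monom


section \<open>Ultrametric absolute values\<close>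

definition absv :: "'c::complete_ultrametric_field \<Rightarrow> real" where
  "absv x = dist x 0"

lemma dist_absv: "dist x y = absv (x - y)"
  for x y :: "'c::complete_ultrametric_field"
  unfolding absv_def by (rule dist_eq_dist_diff)

lemma absv_nonneg [simp]: "0 \<le> absv x"
  by (simp add: absv_def)

lemma absv_eq_0_iff [simp]: "absv x = 0 \<longleftrightarrow> x = 0"
  by (simp add: absv_def)

lemma absv_zero [simp]: "absv 0 = 0"
  by simp

lemma absv_pos_iff [simp]: "0 < absv x \<longleftrightarrow> x \<noteq> 0"
  by (simp add: absv_def)

lemma absv_mult: "absv (x * y) = absv x * absv y"
  unfolding absv_def by (rule dist_mult_0)

lemma absv_one [simp]: "absv 1 = 1"
proof -
  have "absv (1 :: 'c::complete_ultrametric_field) * absv (1 :: 'c) = absv (1 :: 'c)"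
    by (simp flip: absv_mult)
  thus ?thesis by simp
qed

lemma absv_minus [simp]: "absv (- x) = absv x" for x :: "'c::complete_ultrametric_field"
proof -
  have "(absv (- 1 :: 'c))\<^sup>2 = 1"
    by (simp add: power2_eq_square flip: absv_mult)
  hence "absv (- 1 :: 'c) = 1"
    using absv_nonneg[of "- 1 :: 'c"] by (auto simp: power2_eq_1_iff)
  thus ?thesis
    using absv_mult[of "- 1" x] by simp
qed

lemma absv_minus_commute: "absv (x - y) = absv (y - x)"
  using absv_minus[of "x - y"] by simp

lemma absv_power: "absv (x ^ n) = absv x ^ n"
  by (induction n) (simp_all add: absv_mult)

lemma absv_inverse: "absv (inverse x) = inverse (absv x)"
proof (cases "x = 0")
  case False
  hence "absv (inverse x) * absv x = 1"
    by (simp flip: absv_mult)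
  thus ?thesis
    using False by (simp add: field_simps)
qed simp

lemma absv_add_le_max: "absv (x + y) \<le> max (absv x) (absv y)"
  unfolding absv_def by (rule dist_add_0)

lemma absv_add_le: "absv x \<le> M \<Longrightarrow> absv y \<le> M \<Longrightarrow> absv (x + y) \<le> M"
  using absv_add_le_max[of x y] by linarith

lemma absv_diff_le: "absv x \<le> M \<Longrightarrow> absv y \<le> M \<Longrightarrow> absv (x - y) \<le> M"
  using absv_add_le[of x M "- y"] by simp

lemma absv_add_eq_larger:
  assumes "absv y < absv x"
  shows "absv (x + y) = absv x"
proof (rule antisym)
  show "absv (x + y) \<le> absv x"
    using assms by (intro absv_add_le) auto
  show "absv x \<le> absv (x + y)"
    using absv_add_le_max[of "x + y" "- y"] assms by (simp split: if_splits add: max_def)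
qed

lemma absv_sum_le:
  assumes "\<And>i. i \<in> A \<Longrightarrow> absv (f i) \<le> M" and "0 \<le> M"
  shows "absv (sum f A) \<le> M"
  using assms by (induction A rule: infinite_finite_induct) (auto intro: absv_add_le)

lemma tendsto_absv_iff: "(u \<longlongrightarrow> l) F \<longleftrightarrow> ((\<lambda>n. absv (u n - l)) \<longlongrightarrow> 0) F"
  unfolding tendsto_dist_iff[of u] dist_absv ..

text \<open>
  Addition and multiplication are continuous, so the limit laws of topological groups and monoids
  apply.
\<close>

instance complete_ultrametric_field \<subseteq> topological_ab_group_add
proof
  fix a b :: 'a
  have lim: "((\<lambda>x. max (absv (fst x - a)) (absv (snd x - b))) \<longlongrightarrow> max 0 0) (nhds a \<times>\<^sub>F nhds b)"
    by (intro tendsto_max) (auto simp flip: tendsto_absv_iff intro: filterlim_fst filterlim_snd)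
  show "filterlim (\<lambda>x. fst x + snd x) (nhds (a + b)) (nhds a \<times>\<^sub>F nhds b)"
    unfolding tendsto_absv_iff
  proof (rule tendsto_sandwich[OF _ _ tendsto_const lim[simplified]])
    show "\<forall>\<^sub>F x in nhds a \<times>\<^sub>F nhds b.
            absv (fst x + snd x - (a + b)) \<le> max (absv (fst x - a)) (absv (snd x - b))"
      by (intro always_eventually allI)
         (metis absv_add_le_max add_diff_add)
  qed simp
  show "(uminus \<longlongrightarrow> - a) (nhds a)"
    unfolding tendsto_absv_iff minus_diff_minus absv_minus
    by (simp flip: tendsto_absv_iff add: filterlim_ident)
qed

instance complete_ultrametric_field \<subseteq> topological_comm_monoid_mult
proof
  fix a b :: 'a
  have "((\<lambda>x. absv (fst x - a)) \<longlongrightarrow> 0) (nhds a \<times>\<^sub>F nhds b)"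
       "((\<lambda>x. absv (snd x - b)) \<longlongrightarrow> 0) (nhds a \<times>\<^sub>F nhds b)"
    by (auto simp flip: tendsto_absv_iff intro: filterlim_fst filterlim_snd)
  hence lim: "((\<lambda>x. absv (fst x - a) * absv (snd x - b) + absv (fst x - a) * absv b
                + absv a * absv (snd x - b)) \<longlongrightarrow> 0 * 0 + 0 * absv b + absv a * 0)
             (nhds a \<times>\<^sub>F nhds b)"
    by (intro tendsto_intros)
  show "filterlim (\<lambda>x. fst x * snd x) (nhds (a * b)) (nhds a \<times>\<^sub>F nhds b)"
    unfolding tendsto_absv_iff
  proof (rule tendsto_sandwich[OF _ _ tendsto_const lim[simplified]])
    have "absv (x * y - a * b) \<le>
      absv (x - a) * absv (y - b) + absv (x - a) * absv b + absv a * absv (y - b)" for x y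
    proof -
      have "x * y - a * b = (x - a) * (y - b) + ((x - a) * b + a * (y - b))"
        by (simp add: algebra_simps)
      also have "absv \<dots> \<le> max (absv (x - a) * absv (y - b))
          (max (absv (x - a) * absv b) (absv a * absv (y - b)))"
        by (metis (no_types, lifting) absv_add_le_max absv_mult max.mono order.trans order_refl)
      also have "\<dots> \<le> absv (x - a) * absv (y - b) + absv (x - a) * absv b + absv a * absv (y - b)"
        by (simp add: add_nonneg_nonneg)
      finally show ?thesis .
    qed
    thus "\<forall>\<^sub>F x in nhds a \<times>\<^sub>F nhds b. absv (fst x * snd x - a * b) \<le>
        absv (fst x - a) * absv (snd x - b) + absv (fst x - a) * absv b
                + absv a * absv (snd x - b)"
      by simp
  qed simp
qed

lemma absv_limit_le:
  assumes "u \<longlonglongrightarrow> l" and "\<forall>\<^sub>F n in sequentially. absv (u n) \<le> M"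
  shows "absv l \<le> M"
proof -
  have "(\<lambda>n. dist (u n) 0) \<longlonglongrightarrow> dist l 0"
    by (intro tendsto_intros assms)
  thus ?thesis
    using assms(2) unfolding absv_def by (rule tendsto_upperbound) simp
qed

text \<open>
  By the ultrametric inequality a sequence is Cauchy as soon as its consecutive differences tend
  to zero.
\<close>

lemma absv_diff_le_of_steps:
  assumes "\<And>n. n \<ge> N \<Longrightarrow> absv (u (Suc n) - u n) \<le> M" and "0 \<le> M" and "N \<le> m"
  shows "absv (u m - u N) \<le> M"
  using assms(3)
proof (induction m rule: dec_induct)
  case (step m)
  have "u (Suc m) - u N = (u (Suc m) - u m) + (u m - u N)"
    by simp
  thus ?case
    using step assms(1)[of m] by (metis absv_add_le)
qed (use assms in simp)

lemma convergent_if_steps_null: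
  fixes u :: "nat \<Rightarrow> 'c::complete_ultrametric_field"
  assumes "(\<lambda>n. u (Suc n) - u n) \<longlonglongrightarrow> 0"
  shows "convergent u"
proof -
  have "Cauchy u"
  proof (rule metric_CauchyI)
    fix e :: real assume "e > 0"
    hence "\<forall>\<^sub>F n in sequentially. dist (u (Suc n) - u n) 0 < e / 2"
      by (intro tendstoD[OF assms]) simp
    then obtain N where N: "\<And>n. n \<ge> N \<Longrightarrow> absv (u (Suc n) - u n) \<le> e / 2"
      by (fastforce simp: eventually_sequentially absv_def)
    have "absv (u m - u n) \<le> e / 2" if "N \<le> m" "N \<le> n" for m n
    proof -
      have "absv ((u m - u N) - (u n - u N)) \<le> e / 2"
        using that \<open>e > 0\<close> N by (intro absv_diff_le[of "u m - u N"] absv_diff_le_of_steps[of N u]) auto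
      thus ?thesis by simp
    qed
    moreover have "e / 2 < e"
      using \<open>e > 0\<close> by simp
    ultimately show "\<exists>N. \<forall>m\<ge>N. \<forall>n\<ge>N. dist (u m) (u n) < e"
      unfolding dist_absv by (meson le_less_trans)
  qed
  thus ?thesis
    by (simp add: Cauchy_convergent_iff)
qed

lemma summable_if_null:
  fixes a :: "nat \<Rightarrow> 'c::complete_ultrametric_field"
  assumes "a \<longlonglongrightarrow> 0"
  shows "summable a"
  unfolding summable_iff_convergent by (rule convergent_if_steps_null) (simp add: assms)

text \<open>
  A family indexed by a countable set whose members tend to zero is unconditionally summable, and
  its sum can be computed along any exhaustion by finite sets: beyond \<open>A N\<close>, adding further
  members moves a partial sum by at most the largest of them.
\<close>

lemma has_sum_exhaustion:
  fixes f :: "'a \<Rightarrow> 'c::complete_ultrametric_field"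
  assumes fin: "\<And>N. finite (A N)" and sub: "\<And>N. A N \<subseteq> B"
    and null: "\<And>e. e > 0 \<Longrightarrow> \<forall>\<^sub>F N in sequentially. \<forall>x\<in>B - A N. absv (f x) \<le> e"
    and lim: "(\<lambda>N. sum f (A N)) \<longlonglongrightarrow> S"
  shows "(f has_sum S) B"
  unfolding has_sum_def
proof (rule tendstoI)
  fix e :: real assume e: "e > 0"
  have "\<forall>\<^sub>F N in sequentially. absv (sum f (A N) - S) < e"
    using lim e by (simp add: tendsto_iff dist_absv)
  moreover have "\<forall>\<^sub>F N in sequentially. \<forall>x\<in>B - A N. absv (f x) \<le> e / 2"
    using e by (intro null) simp
  ultimately have "\<forall>\<^sub>F N in sequentially.
      absv (sum f (A N) - S) < e \<and> (\<forall>x\<in>B - A N. absv (f x) \<le> e / 2)"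
    by (rule eventually_conj)
  then obtain N where "absv (sum f (A N) - S) < e \<and> (\<forall>x\<in>B - A N. absv (f x) \<le> e / 2)"
    unfolding eventually_sequentially by blast
  hence N: "absv (sum f (A N) - S) < e" "\<And>x. x \<in> B - A N \<Longrightarrow> absv (f x) \<le> e / 2"
    by auto
  have "dist (sum f Y) S < e" if "finite Y" "A N \<subseteq> Y" "Y \<subseteq> B" for Y
  proof -
    have eq: "sum f Y - S = sum f (Y - A N) + (sum f (A N) - S)"
      using that by (simp add: sum_diff)
    have "absv (sum f (Y - A N)) \<le> e / 2"
      using that e by (intro absv_sum_le N) auto
    thus ?thesis
      unfolding dist_absv eq
      using N(1) absv_add_le_max[of "sum f (Y - A N)" "sum f (A N) - S"] e by linarith
  qed
  thus "\<forall>\<^sub>F Y in finite_subsets_at_top B. dist (sum f Y) S < e"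
    unfolding eventually_finite_subsets_at_top using fin[of N] sub[of N] by blast
qed


section \<open>Gauss norms and everywhere convergent power series\<close>

text \<open>
  The Gauss norm of \<open>f\<close> on the disk of radius \<open>R\<close> is the supremum of the numbers \<open>\<bar>f\<^sub>n\<bar> R^n\<close>. Only upper
  bounds for it are used, so it is not introduced as a function.
\<close>

definition gauss_le :: "real \<Rightarrow> real \<Rightarrow> 'c::complete_ultrametric_field fps \<Rightarrow> bool" where
  "gauss_le R M f \<longleftrightarrow> (\<forall>n. absv (fps_nth f n) * R ^ n \<le> M)"

lemma gauss_le_nonneg: "gauss_le R M f \<Longrightarrow> 0 \<le> M"
  unfolding gauss_le_def
proof -
  assume "\<forall>n. absv (fps_nth f n) * R ^ n \<le> M"
  hence "absv (fps_nth f 0) \<le> M"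
    by (metis mult.right_neutral power_0)
  thus "0 \<le> M"
    by (rule order_trans[OF absv_nonneg])
qed

lemma gauss_le_mono: "gauss_le R M f \<Longrightarrow> M \<le> M' \<Longrightarrow> gauss_le R M' f"
  unfolding gauss_le_def by (meson order_trans)

lemma gauss_le_radius_mono: "gauss_le R M f \<Longrightarrow> 0 \<le> R' \<Longrightarrow> R' \<le> R \<Longrightarrow> gauss_le R' M f"
  unfolding gauss_le_def by (auto intro: order_trans[OF mult_left_mono[OF power_mono]])

lemma gauss_le_absv_le: "absv x * c \<le> M \<Longrightarrow> absv y * c \<le> M \<Longrightarrow> 0 \<le> c \<Longrightarrow> absv (x + y) * c \<le> M"
  using absv_add_le_max[of x y]
  by (smt (verit) mult_right_mono max_def)

lemma gauss_le_uminus [simp]: "gauss_le R M (- f) \<longleftrightarrow> gauss_le R M f"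
  by (simp add: gauss_le_def)

lemma gauss_le_add:
  assumes "gauss_le R M f" "gauss_le R M g" "0 \<le> R"
  shows "gauss_le R M (f + g)"
  using assms unfolding gauss_le_def by (auto intro!: gauss_le_absv_le)

lemma gauss_le_diff:
  assumes "gauss_le R M f" "gauss_le R M g" "0 \<le> R"
  shows "gauss_le R M (f - g)"
  using gauss_le_add[of R M f "- g"] assms by simp

lemma gauss_le_0 [simp]: "gauss_le R M 0 \<longleftrightarrow> 0 \<le> M"
  by (simp add: gauss_le_def)

lemma gauss_le_sum:
  assumes "\<And>i. i \<in> A \<Longrightarrow> gauss_le R M (f i)" "0 \<le> M" "0 \<le> R"
  shows "gauss_le R M (sum f A)"
  using assms by (induction A rule: infinite_finite_induct) (auto intro: gauss_le_add)

lemma gauss_le_mult: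
  assumes f: "gauss_le R M f" and g: "gauss_le R N g" and R: "0 \<le> R"
  shows "gauss_le R (M * N) (f * g)"
  unfolding gauss_le_def
proof
  fix n
  have "absv (fps_nth f i * fps_nth g (n - i) * c) \<le> M * N"
    if "absv c = R ^ n" "i \<le> n" for i c
  proof -
    have "absv (fps_nth f i * fps_nth g (n - i) * c)
        = (absv (fps_nth f i) * R ^ i) * (absv (fps_nth g (n - i)) * R ^ (n - i))"
      using that by (simp add: absv_mult flip: power_add)
    also have "\<dots> \<le> M * N"
      using f g R gauss_le_nonneg[OF f] unfolding gauss_le_def by (intro mult_mono) auto
    finally show ?thesis .
  qed
  have le: "absv (fps_nth f i) * R ^ i * (absv (fps_nth g (n - i)) * R ^ (n - i)) \<le> M * N" for i
    using f g R gauss_le_nonneg[OF f] unfolding gauss_le_def by (intro mult_mono) auto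
  have "absv (\<Sum>i\<in>I. fps_nth f i * fps_nth g (n - i)) * R ^ n \<le> M * N"
    if "finite I" "I \<subseteq> {0..n}" for I
    using that
  proof (induction I)
    case (insert i I)
    have "absv (fps_nth f i * fps_nth g (n - i)) * R ^ n
        = absv (fps_nth f i) * R ^ i * (absv (fps_nth g (n - i)) * R ^ (n - i))"
      using insert.prems by (simp add: absv_mult flip: power_add)
    also have "\<dots> \<le> M * N"
      by (rule le)
    finally show ?case
      using insert R by (auto intro!: gauss_le_absv_le)
  qed (use gauss_le_nonneg[OF f] gauss_le_nonneg[OF g] in simp)
  from this[of "{0..n}"] show "absv (fps_nth (f * g) n) * R ^ n \<le> M * N"
    by (simp add: fps_mult_nth)
qed

lemma gauss_le_const: "gauss_le R (absv c) (fps_const c)"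
  unfolding gauss_le_def
proof
  show "absv (fps_nth (fps_const c) n) * R ^ n \<le> absv c" for n
    by (cases n) auto
qed

lemma gauss_le_1: "gauss_le R 1 1"
  using gauss_le_const[of R 1] by simp

lemma gauss_le_X: "0 \<le> R \<Longrightarrow> gauss_le R R fps_X"
  by (auto simp: gauss_le_def fps_X_def)

lemma gauss_le_prod:
  assumes "\<And>i. i \<in> A \<Longrightarrow> gauss_le R (M i) (f i)" "0 \<le> R"
  shows "gauss_le R (prod M A) (prod f A)"
  using assms
  by (induction A rule: infinite_finite_induct) (auto intro: gauss_le_mult gauss_le_1)

lemma gauss_le_power: "gauss_le R M f \<Longrightarrow> 0 \<le> R \<Longrightarrow> gauss_le R (M ^ n) (f ^ n)"
  by (induction n) (auto intro: gauss_le_mult gauss_le_1)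

lemma gauss_le_fps_of_poly: "\<exists>M. gauss_le R M (fps_of_poly p)"
proof
  show "gauss_le R (Max ((\<lambda>n. absv (coeff p n) * R ^ n) ` {..degree p} \<union> {0})) (fps_of_poly p)"
    unfolding gauss_le_def
  proof
    fix n
    show "absv (fps_nth (fps_of_poly p) n) * R ^ n \<le>
        Max ((\<lambda>n. absv (coeff p n) * R ^ n) ` {..degree p} \<union> {0})"
    proof (cases "n \<le> degree p")
      case True
      thus ?thesis
        unfolding fps_of_poly_nth by (intro Max_ge) auto
    next
      case False
      hence "absv (fps_nth (fps_of_poly p) n) * R ^ n = 0"
        by (simp add: coeff_eq_0)
      also have "0 \<le> Max ((\<lambda>n. absv (coeff p n) * R ^ n) ` {..degree p} \<union> {0})"
        by (intro Max_ge) auto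
      finally show ?thesis .
    qed
  qed
qed

text \<open>
  Finiteness of all Gauss norms is convergence on the whole of \<open>\<complex>\<^sub>\<infinity>\<close>. The radii are at least \<open>1\<close>
  because it is then that a bound for \<open>f\<close> passes to its twists.
\<close>

definition entire :: "'c::complete_ultrametric_field fps \<Rightarrow> bool" where
  "entire f \<longleftrightarrow> (\<forall>R\<ge>1. \<exists>M. gauss_le R M f)"

lemma entireE:
  assumes "entire f" "R \<ge> 1"
  obtains M where "M \<ge> 1" "gauss_le R M f"
proof -
  obtain M where "gauss_le R M f"
    using assms by (auto simp: entire_def)
  hence "gauss_le R (max 1 M) f"
    by (rule gauss_le_mono) simp
  thus thesis
    by (intro that[of "max 1 M"]) auto
qed

lemma entire_add: "entire f \<Longrightarrow> entire g \<Longrightarrow> entire (f + g)"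
  unfolding entire_def
proof (intro allI impI)
  fix R :: real
  assume *: "\<forall>R\<ge>1. \<exists>M. gauss_le R M f" "\<forall>R\<ge>1. \<exists>M. gauss_le R M g" and "R \<ge> 1"
  then obtain M N where "gauss_le R M f" "gauss_le R N g"
    by blast
  hence "gauss_le R (max M N) (f + g)"
    using \<open>R \<ge> 1\<close> by (intro gauss_le_add) (auto elim: gauss_le_mono)
  thus "\<exists>M. gauss_le R M (f + g)" ..
qed

lemma entire_uminus [simp]: "entire (- f) \<longleftrightarrow> entire f"
  by (simp add: entire_def)

lemma entire_diff: "entire f \<Longrightarrow> entire g \<Longrightarrow> entire (f - g)"
  using entire_add[of f "- g"] by simp

lemma entire_mult: "entire f \<Longrightarrow> entire g \<Longrightarrow> entire (f * g)"
  unfolding entire_def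
proof (intro allI impI)
  fix R :: real
  assume *: "\<forall>R\<ge>1. \<exists>M. gauss_le R M f" "\<forall>R\<ge>1. \<exists>M. gauss_le R M g" and R: "R \<ge> 1"
  then obtain M N where "gauss_le R M f" "gauss_le R N g"
    by blast
  from gauss_le_mult[OF this] R show "\<exists>M. gauss_le R M (f * g)"
    by auto
qed

lemma entire_const [simp]: "entire (fps_const c)"
  unfolding entire_def using gauss_le_const by blast

lemma entire_0 [simp]: "entire 0" and entire_1 [simp]: "entire 1"
  using entire_const[of 0] entire_const[of 1] by auto

lemma entire_fps_of_poly [simp]: "entire (fps_of_poly p)"
  unfolding entire_def using gauss_le_fps_of_poly by blast

lemma entire_sum: "(\<And>i. i \<in> A \<Longrightarrow> entire (f i)) \<Longrightarrow> entire (sum f A)"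
  by (induction A rule: infinite_finite_induct) (auto intro: entire_add)

lemma entire_prod: "(\<And>i. i \<in> A \<Longrightarrow> entire (f i)) \<Longrightarrow> entire (prod f A)"
  by (induction A rule: infinite_finite_induct) (auto intro: entire_mult)

lemma entire_power: "entire f \<Longrightarrow> entire (f ^ n)"
  by (induction n) (auto intro: entire_mult)

text \<open>Convergence in all the Gauss norms, that is, uniformly on every disk.\<close>

definition converges_to :: "(nat \<Rightarrow> 'c::complete_ultrametric_field fps) \<Rightarrow> 'c fps \<Rightarrow> bool"
  where "converges_to F f \<longleftrightarrow>
    (\<forall>R\<ge>1. \<forall>e>0. \<forall>\<^sub>F N in sequentially. gauss_le R e (F N - f))"

lemma converges_toD:
  "converges_to F f \<Longrightarrow> R \<ge> 1 \<Longrightarrow> e > 0 \<Longrightarrow> \<forall>\<^sub>F N in sequentially. gauss_le R e (F N - f)"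
  by (simp add: converges_to_def)

lemma converges_to_const: "converges_to (\<lambda>N. f) f"
  by (simp add: converges_to_def)

lemma converges_to_nth:
  assumes "converges_to F f"
  shows "(\<lambda>N. fps_nth (F N) n) \<longlonglongrightarrow> fps_nth f n"
proof (rule tendstoI)
  fix e :: real assume e: "e > 0"
  have "\<forall>\<^sub>F N in sequentially. gauss_le 1 (e / 2) (F N - f)"
    using e by (intro converges_toD[OF assms]) auto
  thus "\<forall>\<^sub>F N in sequentially. dist (fps_nth (F N) n) (fps_nth f n) < e"
  proof eventually_elim
    case (elim N)
    hence "absv (fps_nth (F N) n - fps_nth f n) \<le> e / 2"
      by (simp add: gauss_le_def)
    thus ?case
      using e by (simp add: dist_absv)
  qed
qed

lemma converges_to_unique: "converges_to F f \<Longrightarrow> converges_to F g \<Longrightarrow> f = g"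
  by (intro fps_ext) (meson LIMSEQ_unique converges_to_nth)

lemma converges_to_Suc: "converges_to F f \<Longrightarrow> converges_to (\<lambda>N. F (Suc N)) f"
  unfolding converges_to_def eventually_sequentially by (meson le_SucI)

lemma entire_limit:
  assumes "\<And>N. entire (F N)" "converges_to F f"
  shows "entire f"
  unfolding entire_def
proof (intro allI impI)
  fix R :: real assume R: "R \<ge> 1"
  obtain N where "gauss_le R 1 (F N - f)"
    using converges_toD[OF assms(2) R, of 1] by (auto simp: eventually_sequentially)
  moreover obtain M where "M \<ge> 1" "gauss_le R M (F N)"
    using entireE[OF assms(1) R] .
  ultimately have "gauss_le R M (F N)" "gauss_le R M (F N - f)"
    by (auto intro: gauss_le_mono)
  hence "gauss_le R M (F N - (F N - f))"
    by (rule gauss_le_diff) (use R in simp)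
  thus "\<exists>M. gauss_le R M f"
    by auto
qed

lemma converges_to_add:
  assumes "converges_to F f" "converges_to G g"
  shows "converges_to (\<lambda>N. F N + G N) (f + g)"
  unfolding converges_to_def
proof (intro allI impI)
  fix R e :: real assume R: "R \<ge> 1" "e > 0"
  show "\<forall>\<^sub>F N in sequentially. gauss_le R e (F N + G N - (f + g))"
    using converges_toD[OF assms(1) R] converges_toD[OF assms(2) R]
  proof eventually_elim
    case (elim N)
    thus ?case
      using gauss_le_add[OF elim] R by (simp add: algebra_simps)
  qed
qed

lemma converges_to_mult:
  assumes "converges_to F f" "converges_to G g" "entire f" "entire g"
  shows "converges_to (\<lambda>N. F N * G N) (f * g)"
  unfolding converges_to_def
proof (intro allI impI)
  fix R e :: real assume R: "R \<ge> 1" and e: "e > 0"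
  obtain A where A: "A \<ge> 1" "gauss_le R A f"
    using entireE[OF assms(3) R] .
  obtain B where B: "B \<ge> 1" "gauss_le R B g"
    using entireE[OF assms(4) R] .
  define d where "d = min 1 (e / (A * B))"
  have d: "d > 0" "d \<le> 1" "A * d \<le> e" "d * B \<le> e" "d \<le> e"
  proof -
    have pos: "A > 0" "B > 0"
      using A(1) B(1) by auto
    hence le: "d \<le> e / (A * B)" and d: "d > 0" "d \<le> 1"
      using e by (auto simp: d_def)
    have "A * d * 1 \<le> A * d * B" "1 * d * B \<le> A * d * B"
      using A(1) B(1) d by (intro mult_mono; simp)+
    moreover have "A * d * B \<le> e"
      using le pos by (simp add: field_simps)
    moreover have "d * 1 \<le> d * B"
      using d B(1) by (intro mult_left_mono) auto
    moreover have "d * B \<le> A * d * B"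
      using A(1) B(1) d by simp
    ultimately show "d > 0" "d \<le> 1" "A * d \<le> e" "d * B \<le> e" "d \<le> e"
      using d by linarith+
  qed
  show "\<forall>\<^sub>F N in sequentially. gauss_le R e (F N * G N - f * g)"
    using converges_toD[OF assms(1) R d(1)] converges_toD[OF assms(2) R d(1)]
  proof eventually_elim
    case (elim N)
    have "gauss_le R (d * d) ((F N - f) * (G N - g))"
      using elim R by (intro gauss_le_mult) auto
    moreover have "d * d \<le> e"
      using d(1,2,5) mult_left_le[of d d] by linarith
    ultimately have 1: "gauss_le R e ((F N - f) * (G N - g))"
      by (rule gauss_le_mono)
    have 2: "gauss_le R e ((F N - f) * g)"
      using gauss_le_mult[OF elim(1) B(2)] R d(4) by (auto elim: gauss_le_mono)
    have 3: "gauss_le R e (f * (G N - g))"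
      using gauss_le_mult[OF A(2) elim(2)] R d(3) by (auto elim: gauss_le_mono)
    have "F N * G N - f * g = ((F N - f) * (G N - g) + (F N - f) * g) + f * (G N - g)"
      by (simp add: algebra_simps)
    thus ?case
      using 1 2 3 R by (auto intro!: gauss_le_add)
  qed
qed

text \<open>
  Completeness, with the limit taken coefficientwise, which is the form in which infinite products
  and sums of power series are defined.
\<close>

lemma converges_to_if_steps_null:
  fixes F :: "nat \<Rightarrow> 'c::complete_ultrametric_field fps"
  assumes "\<And>R e. R \<ge> 1 \<Longrightarrow> e > 0 \<Longrightarrow> \<forall>\<^sub>F N in sequentially. gauss_le R e (F (Suc N) - F N)"
  shows "converges_to F (Abs_fps (\<lambda>n. lim (\<lambda>N. fps_nth (F N) n)))" (is "converges_to F ?f")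
proof -
  have "converges_to (\<lambda>N. F (Suc N) - F N) 0"
    using assms by (simp add: converges_to_def)
  from converges_to_nth[OF this]
  have nth: "(\<lambda>N. fps_nth (F N) n) \<longlonglongrightarrow> fps_nth ?f n" for n
    using convergent_if_steps_null[of "\<lambda>N. fps_nth (F N) n"] by (simp add: convergent_LIMSEQ_iff)
  show ?thesis
    unfolding converges_to_def
  proof (intro allI impI)
    fix R e :: real assume R: "R \<ge> 1" and e: "e > 0"
    obtain N0 where N0: "\<And>N. N \<ge> N0 \<Longrightarrow> gauss_le R e (F (Suc N) - F N)"
      using assms[OF R e] by (auto simp: eventually_sequentially)
    have "gauss_le R e (F N - ?f)" if "N \<ge> N0" for N
      unfolding gauss_le_def
    proof
      fix n
      have pos: "R ^ n > 0"
        using R by simp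
      have "absv (fps_nth (F (Suc m)) n - fps_nth (F m) n) \<le> e / R ^ n" if "m \<ge> N" for m
        using N0[of m] that \<open>N \<ge> N0\<close> pos by (simp add: gauss_le_def field_simps)
      hence "absv (fps_nth (F m) n - fps_nth (F N) n) \<le> e / R ^ n" if "m \<ge> N" for m
        using that pos e by (intro absv_diff_le_of_steps[of N "\<lambda>m. fps_nth (F m) n"]) auto
      hence "absv (fps_nth ?f n - fps_nth (F N) n) \<le> e / R ^ n"
        by (intro absv_limit_le[OF tendsto_diff[OF nth tendsto_const]])
           (auto simp: eventually_sequentially)
      thus "absv (fps_nth (F N - ?f) n) * R ^ n \<le> e"
        using pos by (simp add: field_simps absv_minus_commute)
    qed
    thus "\<forall>\<^sub>F N in sequentially. gauss_le R e (F N - ?f)"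
      unfolding eventually_sequentially by blast
  qed
qed


section \<open>Values of power series\<close>

lemma fps_converges_at_if_gauss_le:
  assumes "gauss_le R M f" "absv z < R"
  shows "fps_converges_at f z"
  unfolding fps_converges_at_def
proof (rule summable_if_null)
  have R: "R > 0"
    using assms(2) absv_nonneg[of z] by linarith
  have "(\<lambda>n. M * (absv z / R) ^ n) \<longlonglongrightarrow> M * 0"
    using assms R by (intro tendsto_intros LIMSEQ_power_zero) auto
  hence lim: "(\<lambda>n. M * (absv z / R) ^ n) \<longlonglongrightarrow> 0"
    by simp
  show "(\<lambda>n. fps_nth f n * z ^ n) \<longlonglongrightarrow> 0"
    unfolding tendsto_absv_iff
  proof (rule tendsto_sandwich[OF _ _ tendsto_const lim])
    have "absv (fps_nth f n * z ^ n - 0) \<le> M * (absv z / R) ^ n" for n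
    proof -
      have "absv (fps_nth f n * z ^ n - 0) = (absv (fps_nth f n) * R ^ n) * (absv z / R) ^ n"
        using R by (simp add: absv_mult absv_power power_divide)
      also have "\<dots> \<le> M * (absv z / R) ^ n"
        using assms(1) R by (intro mult_right_mono) (auto simp: gauss_le_def)
      finally show ?thesis .
    qed
    thus "\<forall>\<^sub>F n in sequentially. absv (fps_nth f n * z ^ n - 0) \<le> M * (absv z / R) ^ n"
      by simp
  qed simp
qed

lemma entire_converges: "entire f \<Longrightarrow> fps_converges_at f z"
  using fps_converges_at_if_gauss_le[of "absv z + 1" _ f z] by (fastforce simp: entire_def)

lemma fps_value_LIMSEQ:
  "fps_converges_at f z \<Longrightarrow> (\<lambda>N. \<Sum>n<N. fps_nth f n * z ^ n) \<longlonglongrightarrow> fps_value f z"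
  unfolding fps_converges_at_def fps_value_def by (rule summable_LIMSEQ)

lemma absv_fps_value_le:
  assumes "entire f" "gauss_le R M f" "absv z \<le> R"
  shows "absv (fps_value f z) \<le> M"
proof (rule absv_limit_le[OF fps_value_LIMSEQ[OF entire_converges]])
  show "\<forall>\<^sub>F N in sequentially. absv (\<Sum>n<N. fps_nth f n * z ^ n) \<le> M"
  proof (intro always_eventually allI absv_sum_le)
    fix n
    have "absv (fps_nth f n * z ^ n) \<le> absv (fps_nth f n) * R ^ n"
      using assms(3) by (simp add: absv_mult absv_power mult_left_mono power_mono)
    also have "\<dots> \<le> M"
      using assms(2) by (simp add: gauss_le_def)
    finally show "absv (fps_nth f n * z ^ n) \<le> M" .
  qed (rule gauss_le_nonneg[OF assms(2)])
qed (rule assms)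

lemma fps_value_diff:
  assumes "entire f" "entire g"
  shows "fps_value (f - g) z = fps_value f z - fps_value g z"
proof -
  have "(\<lambda>N. (\<Sum>n<N. fps_nth f n * z ^ n) - (\<Sum>n<N. fps_nth g n * z ^ n))
      \<longlonglongrightarrow> fps_value f z - fps_value g z"
    by (intro tendsto_diff fps_value_LIMSEQ entire_converges assms)
  moreover have "(\<lambda>N. \<Sum>n<N. fps_nth (f - g) n * z ^ n) \<longlonglongrightarrow> fps_value (f - g) z"
    by (intro fps_value_LIMSEQ entire_converges entire_diff assms)
  ultimately show ?thesis
    by (simp add: left_diff_distrib sum_subtractf) (metis LIMSEQ_unique)
qed

lemma converges_to_value:
  assumes "\<And>N. entire (F N)" "converges_to F f"
  shows "(\<lambda>N. fps_value (F N) z) \<longlonglongrightarrow> fps_value f z"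
proof (rule tendstoI)
  fix e :: real assume e: "e > 0"
  have f: "entire f"
    using entire_limit[OF assms] .
  have "\<forall>\<^sub>F N in sequentially. gauss_le (max 1 (absv z)) (e / 2) (F N - f)"
    using e by (intro converges_toD[OF assms(2)]) auto
  thus "\<forall>\<^sub>F N in sequentially. dist (fps_value (F N) z) (fps_value f z) < e"
  proof eventually_elim
    case (elim N)
    have "absv (fps_value (F N - f) z) \<le> e / 2"
      by (rule absv_fps_value_le[OF _ elim]) (auto intro: entire_diff assms f)
    thus ?case
      using e by (simp add: dist_absv fps_value_diff assms f)
  qed
qed

lemma fps_value_fps_of_poly [simp]: "fps_value (fps_of_poly p) z = poly p z"
proof -
  have "(\<lambda>n. fps_nth (fps_of_poly p) n * z ^ n) sums (\<Sum>n\<le>degree p. coeff p n * z ^ n)"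
    using sums_finite[of "{..degree p}" "\<lambda>n. fps_nth (fps_of_poly p) n * z ^ n"]
    by (simp add: coeff_eq_0)
  thus ?thesis
    by (simp add: fps_value_def poly_altdef sums_unique[symmetric])
qed

lemma fps_value_const [simp]: "fps_value (fps_const c) z = c"
  using fps_value_fps_of_poly[of "[:c:]" z] by (simp add: fps_of_poly_const)

lemma fps_value_0 [simp]: "fps_value 0 z = 0" and fps_value_1 [simp]: "fps_value 1 z = 1"
  using fps_value_const[of 0 z] fps_value_const[of 1 z] by auto

text \<open>
  A bound on the disk of twice the radius makes the terms decay geometrically on the given disk.
\<close>

lemma poly_cutoff_converges_to:
  assumes "entire f"
  shows "converges_to (\<lambda>N. fps_of_poly (Poly (map (fps_nth f) [0..<N]))) f"
  unfolding converges_to_def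
proof (intro allI impI)
  fix R e :: real assume R: "R \<ge> 1" and e: "e > 0"
  obtain M where M: "M \<ge> 1" "gauss_le (2 * R) M f"
    using entireE[OF assms, of "2 * R"] R by auto
  have "(\<lambda>N. M * (1 / 2) ^ N) \<longlonglongrightarrow> M * 0"
    by (intro tendsto_intros LIMSEQ_power_zero) auto
  hence "\<forall>\<^sub>F N in sequentially. M * (1 / 2) ^ N < e"
    using e by (intro order_tendstoD(2)) auto
  thus "\<forall>\<^sub>F N in sequentially.
      gauss_le R e (fps_of_poly (Poly (map (fps_nth f) [0..<N])) - f)"
  proof eventually_elim
    case (elim N)
    show ?case
      unfolding gauss_le_def
    proof
      fix n
      have "absv (fps_nth f n) * R ^ n \<le> e" if "n \<ge> N"
      proof -
        have "absv (fps_nth f n) * R ^ n = absv (fps_nth f n) * (2 * R) ^ n * (1 / 2) ^ n"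
          by (simp add: power_mult_distrib power_one_over)
        also have "\<dots> \<le> M * (1 / 2) ^ n"
          using M(2) by (intro mult_right_mono) (auto simp: gauss_le_def)
        also have "\<dots> \<le> M * (1 / 2) ^ N"
          using M(1) that by (intro mult_left_mono power_decreasing) auto
        finally show ?thesis
          using elim by simp
      qed
      thus "absv (fps_nth (fps_of_poly (Poly (map (fps_nth f) [0..<N])) - f) n) * R ^ n \<le> e"
        using e by (auto simp: coeff_Poly_eq nth_default_def)
    qed
  qed
qed

text \<open>
  Entire series are limits of polynomials, for which evaluation is known to be multiplicative.
\<close>

lemma fps_value_mult:
  assumes f: "entire f" and g: "entire g"
  shows "fps_value (f * g) z = fps_value f z * fps_value g z"
proof -
  define p where "p = (\<lambda>f N. Poly (map (fps_nth (f :: 'a fps)) [0..<N]))"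
  have lim: "converges_to (\<lambda>N. fps_of_poly (p h N)) h" if "entire h" for h
    unfolding p_def by (rule poly_cutoff_converges_to[OF that])
  have poly_lim: "(\<lambda>N. poly (p h N) z) \<longlonglongrightarrow> fps_value h z" if "entire h" for h
    using converges_to_value[OF entire_fps_of_poly lim[OF that]] by simp
  have "converges_to (\<lambda>N. fps_of_poly (p f N * p g N)) (f * g)"
    using converges_to_mult[OF lim[OF f] lim[OF g] f g] by (simp add: fps_of_poly_mult)
  from converges_to_value[OF entire_fps_of_poly this, of z]
  have "(\<lambda>N. poly (p f N) z * poly (p g N) z) \<longlonglongrightarrow> fps_value (f * g) z"
    by simp
  with tendsto_mult[OF poly_lim[OF f] poly_lim[OF g]] show ?thesis
    by (metis LIMSEQ_unique)
qed

lemma fps_value_prod: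
  "(\<And>i. i \<in> A \<Longrightarrow> entire (f i)) \<Longrightarrow> fps_value (prod f A) z = (\<Prod>i\<in>A. fps_value (f i) z)"
  by (induction A rule: infinite_finite_induct) (auto simp: fps_value_mult entire_prod)

lemma fps_value_power: "entire f \<Longrightarrow> fps_value (f ^ n) z = fps_value f z ^ n"
  by (induction n) (auto simp: fps_value_mult entire_power)

lemma fps_value_add:
  assumes "entire f" "entire g"
  shows "fps_value (f + g) z = fps_value f z + fps_value g z"
  using fps_value_diff[of f "- g" z] fps_value_diff[of 0 g z] assms by simp

lemma fps_value_sum:
  "(\<And>i. i \<in> A \<Longrightarrow> entire (f i)) \<Longrightarrow> fps_value (sum f A) z = (\<Sum>i\<in>A. fps_value (f i) z)"
  by (induction A rule: infinite_finite_induct) (auto simp: fps_value_add entire_sum)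


section \<open>Relative algebraic closures\<close>

definition is_subfield :: "'c::field set \<Rightarrow> bool" where
  "is_subfield K \<longleftrightarrow> 0 \<in> K \<and> 1 \<in> K \<and> (\<forall>x\<in>K. \<forall>y\<in>K. x + y \<in> K \<and> x * y \<in> K) \<and>
     (\<forall>x\<in>K. - x \<in> K \<and> inverse x \<in> K)"

text \<open>The type class field as a record, to transfer facts about algebraic elements.\<close>

definition field_ring :: "'c::field ring" where
  "field_ring = \<lparr>carrier = UNIV, monoid.mult = (*), one = 1, zero = 0, add = (+)\<rparr>"

lemma field_ring_simps [simp]:
  "carrier field_ring = UNIV" "x \<otimes>\<^bsub>field_ring\<^esub> y = x * y" "\<one>\<^bsub>field_ring\<^esub> = 1"
  "\<zero>\<^bsub>field_ring\<^esub> = 0" "x \<oplus>\<^bsub>field_ring\<^esub> y = x + y"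
  by (simp_all add: field_ring_def)

lemma field_field_ring: "field (field_ring :: 'c::field ring)"
proof -
  have "\<exists>y. x * y = 1 \<and> y * x = 1" if "x \<noteq> 0" for x :: 'c
    using that by (intro exI[of _ "inverse x"]) auto
  moreover have "\<exists>y. x + y = 0" for x :: 'c
    by (rule exI[of _ "- x"]) simp
  ultimately show ?thesis
    by unfold_locales (auto simp: Units_def algebra_simps add_eq_0_iff)
qed

lemma field_ring_uminus [simp]: "\<ominus>\<^bsub>field_ring\<^esub> x = - x" for x :: "'c::field"
proof -
  interpret field_ring: field "field_ring :: 'c ring" by (rule field_field_ring)
  show ?thesis
    by (rule field_ring.minus_equality) auto
qed

lemma field_ring_inverse: "x \<noteq> 0 \<Longrightarrow> inv\<^bsub>field_ring\<^esub> x = inverse x" for x :: "'c::field"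
proof -
  interpret field_ring: field "field_ring :: 'c ring" by (rule field_field_ring)
  show "x \<noteq> 0 \<Longrightarrow> inv\<^bsub>field_ring\<^esub> x = inverse x"
    by (rule field_ring.comm_inv_char) auto
qed

lemma field_ring_power [simp]: "x [^]\<^bsub>field_ring\<^esub> (n::nat) = x ^ n"
  by (induction n) (auto simp: mult.commute)

lemma field_ring_eval: "ring.eval field_ring p x = poly (Poly (rev p)) x" for x :: "'c::field"
proof -
  interpret field_ring: field "field_ring :: 'c ring" by (rule field_field_ring)
  show ?thesis
    by (induction p) (auto simp: Poly_snoc poly_monom)
qed

lemma algebraic_iff_rel_alg_closure:
  fixes K :: "'c::field set"
  assumes "is_subfield K"
  shows "\<not> ring.transcendental field_ring K x \<longleftrightarrow> x \<in> rel_alg_closure K"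
proof
  interpret field_ring: field "field_ring :: 'c ring" by (rule field_field_ring)
  have subring: "subring K field_ring"
    using assms by (intro field_ring.subringI) (auto simp: is_subfield_def)
  assume "field_ring.algebraic K x"
  then obtain p where p: "p \<in> carrier (K [X]\<^bsub>field_ring\<^esub>)" "p \<noteq> []" "field_ring.eval p x = 0"
    using field_ring.algebraicE[OF subring, of x] by (auto simp: over_def)
  hence "set p \<subseteq> K" "hd p \<noteq> 0"
    by (auto simp: univ_poly_def polynomial_def)
  moreover have "coeff (Poly (rev p)) (length p - 1) = hd p"
    using p(2) by (simp add: coeff_Poly_eq nth_default_def rev_nth hd_conv_nth)
  ultimately have "Poly (rev p) \<noteq> 0"
    by (metis coeff_0)
  moreover have "coeff (Poly (rev p)) i \<in> K" for i
    using \<open>set p \<subseteq> K\<close> assms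
    by (auto simp: coeff_Poly_eq nth_default_def rev_nth is_subfield_def)
  ultimately show "x \<in> rel_alg_closure K"
    unfolding rel_alg_closure_def using p(3)
    by (auto simp: field_ring_eval intro!: exI[of _ "Poly (rev p)"])
next
  interpret field_ring: field "field_ring :: 'c ring" by (rule field_field_ring)
  assume "x \<in> rel_alg_closure K"
  then obtain p where p: "p \<noteq> 0" "\<And>i. coeff p i \<in> K" "poly p x = 0"
    by (auto simp: rel_alg_closure_def)
  have "set (coeffs p) \<subseteq> K"
    using p(2) by (auto simp: coeffs_def)
  moreover have "last (coeffs p) \<noteq> 0"
    using p(1) by (simp add: last_coeffs_eq_coeff_degree)
  ultimately have "rev (coeffs p) \<in> carrier (K [X]\<^bsub>field_ring\<^esub>)" "rev (coeffs p) \<noteq> []"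
    using p(1) by (auto simp: univ_poly_def polynomial_def hd_rev)
  moreover have "field_ring.eval (rev (coeffs p)) x = 0"
    using p(3) by (simp add: field_ring_eval)
  ultimately show "field_ring.algebraic K x"
    using field_ring.algebraicI[of "rev (coeffs p)" K x] by (simp add: over_def)
qed

text \<open>
  Sums, products and inverses of algebraic elements lie in finite extensions, hence are algebraic.
\<close>

lemma is_subfield_rel_alg_closure:
  fixes K :: "'c::field set"
  assumes "is_subfield K"
  shows "is_subfield (rel_alg_closure K)"
proof -
  interpret field_ring: field "field_ring :: 'c ring" by (rule field_field_ring)
  have "subring K field_ring"
    using assms by (intro field_ring.subringI) (auto simp: is_subfield_def)
  hence "subfield K field_ring"
    using assms by (intro field_ring.subfieldI') (auto simp: is_subfield_def field_ring_inverse)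
  from field_ring.subfield_of_algebraics[OF this]
  have sub: "subfield (rel_alg_closure K) field_ring"
    by (simp add: over_def algebraic_iff_rel_alg_closure[OF assms])
  have "inverse x \<in> rel_alg_closure K" if "x \<in> rel_alg_closure K" for x
    using field_ring.subfield_m_inv(1)[OF sub, of x] that by (cases "x = 0") (auto simp: field_ring_inverse)
  moreover have "- x \<in> rel_alg_closure K" if "x \<in> rel_alg_closure K" for x
    using subringE(5)[OF subfieldE(1)[OF sub] that] by simp
  ultimately show ?thesis
    using subringE(2,3,6,7)[OF subfieldE(1)[OF sub]] by (auto simp: is_subfield_def)
qed

lemma subset_rel_alg_closure:
  assumes "is_subfield K"
  shows "K \<subseteq> rel_alg_closure K"
proof
  fix x assume "x \<in> K"
  hence "coeff [:- x, 1:] i \<in> K" for i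
    using assms by (auto simp: is_subfield_def coeff_pCons split: nat.splits)
  thus "x \<in> rel_alg_closure K"
    unfolding rel_alg_closure_def by (intro CollectI exI[of _ "[:- x, 1:]"]) auto
qed

text \<open>
  If \<open>p\<close> annihilates \<open>y^n\<close>, then \<open>p(T^n)\<close> annihilates \<open>y\<close>.
\<close>

lemma rel_alg_closure_root:
  assumes "is_subfield K" "y ^ n \<in> rel_alg_closure K" "n > 0"
  shows "y \<in> rel_alg_closure K"
proof -
  obtain p where p: "p \<noteq> 0" "\<And>i. coeff p i \<in> K" "poly p (y ^ n) = 0"
    using assms(2) by (auto simp: rel_alg_closure_def)
  have "coeff (pcompose p (monom 1 n)) i \<in> K" for i
    using assms(1) p(2)
    by (intro coeff_pcompose_semiring_closed) (auto simp: is_subfield_def coeff_monom)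
  moreover have "poly (pcompose p (monom 1 n)) y = 0"
    using p(3) by (simp add: poly_pcompose poly_monom)
  moreover have "pcompose p (monom 1 n) \<noteq> 0"
    using p(1) assms(3) by (simp add: pcompose_eq_0_iff degree_monom_eq)
  ultimately show ?thesis
    unfolding rel_alg_closure_def by blast
qed


section \<open>Finite fields\<close>

lemma CARD_ge_2: "CARD('a::{zero_neq_one,finite}) \<ge> 2"
proof -
  have "card {0 :: 'a, 1} \<le> CARD('a)"
    by (rule card_mono) auto
  thus ?thesis by simp
qed

lemma finite_field_power_CARD: "c ^ CARD('f) = c" for c :: "'f::{field,finite}"
proof (cases "c = 0")
  case False
  have "(\<Prod>y\<in>UNIV-{0}. c * y) = (\<Prod>y\<in>UNIV-{0}. y)"
    by (rule prod.reindex_bij_witness[of _ "\<lambda>y. y / c" "\<lambda>y. c * y"]) (use False in auto)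
  hence "c ^ (CARD('f) - 1) = 1"
    by (simp add: prod.distrib card_Diff_subset)
  moreover have "CARD('f) = Suc (CARD('f) - 1)"
    by simp
  ultimately show ?thesis
    by (metis mult.right_neutral power_Suc)
qed simp

text \<open>
  For \<open>q = CARD('f)\<close>, the polynomial \<open>(X + 1)^q - X^q - 1\<close> has degree less than \<open>q\<close> and vanishes
  at all \<open>q\<close> elements of the field, so it is zero.
\<close>

lemma choose_CARD_eq_0:
  assumes "0 < k" "k < CARD('f::{field,finite})"
  shows "of_nat (CARD('f) choose k) = (0 :: 'f)"
proof -
  define P :: "'f poly" where "P = (\<Sum>k\<in>{0<..<CARD('f)}. monom (of_nat (CARD('f) choose k)) k)"
  have "poly P c = 0" for c
  proof -
    have "{..CARD('f)} = insert 0 (insert CARD('f) {0<..<CARD('f)})"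
      by auto
    hence "(c + 1) ^ CARD('f) = 1 + (c ^ CARD('f) + poly P c)"
      by (simp add: binomial_ring P_def poly_sum poly_monom)
    thus ?thesis
      by (simp add: finite_field_power_CARD)
  qed
  moreover have "degree P < CARD('f)"
    unfolding P_def
  proof (rule degree_sum_less)
    show "degree (monom (of_nat (CARD('f) choose k) :: 'f) k) < CARD('f)"
      if "k \<in> {0<..<CARD('f)}" for k
      by (rule le_less_trans[OF degree_monom_le]) (use that in simp)
  qed simp
  ultimately have "P = 0"
    using card_poly_roots_bound[of P] by (cases "P = 0") simp_all
  hence "coeff P k = 0"
    by simp
  thus ?thesis
    using assms by (simp add: P_def coeff_sum)
qed


lemma frobenius_add_if_choose_eq_0:
  fixes x y :: "'a::comm_ring_1"
  assumes "\<And>k. 0 < k \<Longrightarrow> k < q \<Longrightarrow> of_nat (q choose k) = (0 :: 'a)" and "q > 0"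
  shows "(x + y) ^ q = x ^ q + y ^ q"
proof -
  have "(\<Sum>k\<in>{0<..<q}. of_nat (q choose k) * x ^ k * y ^ (q - k)) = 0"
    using assms(1) by (intro sum.neutral) auto
  moreover have "{..q} = insert 0 (insert q {0<..<q})"
    using assms(2) by auto
  ultimately show ?thesis
    using assms(2) by (simp add: binomial_ring add.commute)
qed


section \<open>The embeddings into \<open>\<complex>\<^sub>\<infinity>\<close>\<close>

context C_infinity
begin

abbreviation \<theta> :: 'c where "\<theta> \<equiv> t_elt emb"

definition const :: "'f \<Rightarrow> 'c" where "const c = emb (fls_const c)"

end

sublocale C_infinity \<subseteq> emb: field_hom emb
proof
  show "emb 0 = 0"
    using emb_add[of 0 0] by (metis add.right_neutral add_left_cancel)
qed (simp_all add: emb_1 emb_add emb_mult)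

sublocale C_infinity \<subseteq> const: field_hom const
  by standard (simp_all add: const_def emb_1 fls_plus_const [symmetric] fls_const_mult_const [symmetric]
    emb_add emb_mult del: fls_const_mult_const)

context C_infinity
begin

lemma is_subfield_range_emb: "is_subfield (range emb)"
  unfolding is_subfield_def
  by (auto simp flip: emb.hom_add emb.hom_mult emb.hom_uminus emb.hom_inverse
           intro: image_eqI[of _ _ 0] image_eqI[of _ _ 1])

lemma t_tilde_neq_0 [simp]: "t_tilde emb \<noteq> 0"
  by (simp add: t_tilde_def)

lemma absv_t_tilde: "absv (t_tilde emb) > 1"
  using emb_dist by (auto simp: absv_def t_tilde_def)

lemma absv_const: "absv (const c) = (if c = 0 then 0 else 1)"
  using emb_dist by (auto simp: absv_def const_def)

lemma absv_const_le: "absv (const c) \<le> 1"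
  by (simp add: absv_const)

lemma absv_\<theta>: "absv \<theta> = absv (t_tilde emb) ^ (CARD('f) - 1)"
  by (simp add: t_elt_def absv_power)

lemma absv_\<theta>_gt_1: "absv \<theta> > 1"
  unfolding absv_\<theta> using absv_t_tilde CARD_ge_2[where 'a = 'f] by (intro one_less_power) auto

lemma \<theta>_neq_0 [simp]: "\<theta> \<noteq> 0"
  using absv_\<theta>_gt_1 by auto

lemma A_emb_altdef: "A_emb emb a = poly (map_poly const a) \<theta>"
  unfolding A_emb_def const_def ..

lemma A_emb_pCons [simp]: "A_emb emb (pCons c a) = const c + \<theta> * A_emb emb a"
  by (simp add: A_emb_altdef const.map_poly_pCons_hom)

end

sublocale C_infinity \<subseteq> A_emb: comm_ring_hom "A_emb emb"
proof -
  interpret map_poly_comm_ring_hom const ..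
  show "comm_ring_hom (A_emb emb)"
    by standard (simp_all add: A_emb_altdef hom_add hom_mult)
qed

context C_infinity
begin

lemma A_emb_monom [simp]: "A_emb emb (monom c n) = const c * \<theta> ^ n"
  by (simp add: A_emb_altdef map_poly_monom poly_monom)

text \<open>
  Since \<open>\<bar>t\<bar> > 1\<close> and constants have absolute value at most \<open>1\<close>, the leading term dominates.
\<close>

lemma absv_A_emb: "a \<noteq> 0 \<Longrightarrow> absv (A_emb emb a) = absv \<theta> ^ degree a"
proof (induction a)
  case (pCons c a)
  show ?case
  proof (cases "a = 0")
    case False
    hence "absv (\<theta> * A_emb emb a) = absv \<theta> ^ Suc (degree a)"
      using pCons by (simp add: absv_mult)
    moreover from this have "absv (const c) < absv (\<theta> * A_emb emb a)"
      using one_less_power[OF absv_\<theta>_gt_1, of "Suc (degree a)"] absv_const_le[of c] by simp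
    ultimately show ?thesis
      using False absv_add_eq_larger[of "const c" "\<theta> * A_emb emb a"] by (simp add: add.commute)
  qed (use pCons in \<open>simp add: absv_const\<close>)
qed simp

lemma A_emb_eq_0_iff [simp]: "A_emb emb a = 0 \<longleftrightarrow> a = 0"
  using absv_A_emb[of a] absv_\<theta>_gt_1 by (cases "a = 0") force+

lemma inj_A_emb: "inj (A_emb emb)"
  by (rule injI) (metis A_emb.hom_minus A_emb_eq_0_iff right_minus_eq)

end


section \<open>The Frobenius map of \<open>\<complex>\<^sub>\<infinity>\<close>\<close>

context C_infinity
begin

lemma frob_add_1: "(x + y) ^ CARD('f) = x ^ CARD('f) + y ^ CARD('f)" for x y :: 'c
proof -
  have "of_nat (CARD('f) choose k) = (0 :: 'c)" if "0 < k" "k < CARD('f)" for k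
    using const.hom_of_nat[of "CARD('f) choose k"] choose_CARD_eq_0[OF that] by simp
  thus ?thesis
    by (rule frobenius_add_if_choose_eq_0) simp_all
qed

lemma frob_add: "(x + y) ^ (CARD('f) ^ n) = x ^ (CARD('f) ^ n) + y ^ (CARD('f) ^ n)" for x y :: 'c
  by (induction n arbitrary: x y) (simp_all add: power_mult frob_add_1)

lemma frob_0 [simp]: "(0 :: 'c) ^ (CARD('f) ^ n) = 0"
  by (simp add: power_0_left)

lemma frob_uminus: "(- x) ^ (CARD('f) ^ n) = - (x ^ (CARD('f) ^ n))" for x :: 'c
  using frob_add[of "- x" x n] by (simp add: eq_neg_iff_add_eq_0)

lemma frob_diff: "(x - y) ^ (CARD('f) ^ n) = x ^ (CARD('f) ^ n) - y ^ (CARD('f) ^ n)" for x y :: 'c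
  using frob_add[of x "- y" n] by (simp add: frob_uminus)

lemma frob_sum: "(\<Sum>i\<in>I. f i) ^ (CARD('f) ^ n) = (\<Sum>i\<in>I. f i ^ (CARD('f) ^ n))"
  for f :: "'i \<Rightarrow> 'c"
  by (induction I rule: infinite_finite_induct) (simp_all add: frob_add)

lemma frob_inj: "x ^ (CARD('f) ^ n) = y ^ (CARD('f) ^ n) \<Longrightarrow> x = y" for x y :: 'c
  using frob_diff[of x y n] by simp

lemma frob_const [simp]: "const c ^ (CARD('f) ^ n) = const c"
proof -
  have "c ^ (CARD('f) ^ n) = c"
    by (induction n) (simp_all add: power_mult finite_field_power_CARD)
  thus ?thesis
    by (simp flip: const.hom_power)
qed

text \<open>
  The elements algebraic over the Laurent series have \<open>q\<close>-th roots and are dense. As the \<open>q\<close>-th power map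
  is additive, \<open>\<bar>x - y\<bar>\<^sup>q = \<bar>x\<^sup>q - y\<^sup>q\<bar>\<close>, so the roots of a convergent sequence form a Cauchy sequence.
\<close>

lemma exists_frob_root: "\<exists>y. y ^ CARD('f) = x" for x :: 'c
proof -
  let ?q = "CARD('f)"
  let ?B = "rel_alg_closure (range emb)"
  have B: "is_subfield ?B"
    by (rule is_subfield_rel_alg_closure[OF is_subfield_range_emb])
  have root: "\<exists>y. y ^ ?q = a" if "a \<in> ?B" for a
  proof -
    have "degree (monom 1 ?q - [:a:]) = ?q"
      by (subst diff_conv_add_uminus, subst degree_add_eq_left) (auto simp: degree_monom_eq)
    moreover have "coeff (monom 1 ?q - [:a:]) i \<in> ?B" for i
      using that B by (auto simp: is_subfield_def coeff_pCons split: nat.splits)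
    ultimately obtain y where "poly (monom 1 ?q - [:a:]) y = 0"
      using alg_closed[of "monom 1 ?q - [:a:]"] by auto
    thus ?thesis
      by (auto simp: poly_monom)
  qed
  have "x \<in> Elementary_Topology.closure ?B"
    using dense by simp
  then obtain u where u: "\<And>n. u n \<in> ?B" "u \<longlonglongrightarrow> x"
    unfolding closure_sequential by blast
  obtain w where w: "\<And>n. w n ^ ?q = u n"
    using root[OF u(1)] by metis
  have "Cauchy w"
  proof (rule metric_CauchyI)
    fix e :: real assume e: "e > 0"
    have "Cauchy u"
      by (rule LIMSEQ_imp_Cauchy[OF u(2)])
    moreover have "e ^ ?q > 0"
      using e by simp
    ultimately obtain N where N: "\<And>m n. m \<ge> N \<Longrightarrow> n \<ge> N \<Longrightarrow> dist (u m) (u n) < e ^ ?q"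
      unfolding Cauchy_def by blast
    have "dist (w m) (w n) < e" if "m \<ge> N" "n \<ge> N" for m n
    proof -
      have "dist (w m) (w n) ^ ?q = dist (u m) (u n)"
        using frob_diff[of "w m" "w n" 1] by (simp add: dist_absv w flip: absv_power)
      thus ?thesis
        using N[OF that] e by (metis less_imp_le power_less_imp_less_base)
    qed
    thus "\<exists>N. \<forall>m\<ge>N. \<forall>n\<ge>N. dist (w m) (w n) < e"
      by blast
  qed
  then obtain y where "w \<longlonglongrightarrow> y"
    by (auto simp: Cauchy_convergent_iff convergent_def)
  hence "(\<lambda>n. w n ^ ?q) \<longlonglongrightarrow> y ^ ?q"
    by (rule tendsto_power_strong) (rule tendsto_const)
  hence "u \<longlonglongrightarrow> y ^ ?q"
    by (simp add: w)
  with u(2) have "y ^ ?q = x"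
    by (metis LIMSEQ_unique)
  thus ?thesis ..
qed

definition frob_root :: "'c \<Rightarrow> 'c" where
  "frob_root = frobenius_pow CARD('f) (- 1)"

lemma frob_root_pow [simp]: "frob_root x ^ CARD('f) = x"
proof -
  obtain y where y: "y ^ CARD('f) = x"
    using exists_frob_root by blast
  have "\<exists>!y. y ^ CARD('f) = x"
    using y frob_inj[of _ 1] by (intro ex1I[of _ y]) auto
  from theI'[OF this] show ?thesis
    by (simp add: frob_root_def frobenius_pow_def)
qed

lemma frob_root_eq_iff: "frob_root x = y \<longleftrightarrow> x = y ^ CARD('f)"
  using frob_inj[of "frob_root x" 1 y] by auto

lemma frob_root_of_pow [simp]: "frob_root (x ^ CARD('f)) = x"
  by (simp add: frob_root_eq_iff)

lemma frobenius_pow_of_nat: "frobenius_pow CARD('f) (int n) x = x ^ (CARD('f) ^ n)" for x :: 'c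
  by (simp add: frobenius_pow_def)

end

sublocale C_infinity \<subseteq> frob_root: field_hom frob_root
  by standard (simp_all add: frob_root_eq_iff frob_add_1 power_mult_distrib)


section \<open>Twisting\<close>

context C_infinity
begin

definition tw :: "nat \<Rightarrow> 'c fps \<Rightarrow> 'c fps" where
  "tw n = fps_twist CARD('f) (int n)"

definition untw :: "'c fps \<Rightarrow> 'c fps" where
  "untw = fps_twist CARD('f) (- 1)"

lemma tw_nth [simp]: "fps_nth (tw n f) i = fps_nth f i ^ (CARD('f) ^ n)"
  by (simp add: tw_def fps_twist_def frobenius_pow_of_nat)

lemma untw_nth [simp]: "fps_nth (untw f) i = frob_root (fps_nth f i)"
  by (simp add: untw_def fps_twist_def frob_root_def)

end

sublocale C_infinity \<subseteq> tw: comm_ring_hom "tw n" for n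
proof
  show "tw n 1 = 1" "tw n (f + g) = tw n f + tw n g" "tw n 0 = 0" for f g
    by (auto intro!: fps_ext simp: frob_add)
  show "tw n (f * g) = tw n f * tw n g" for f g
    by (rule fps_ext) (simp add: fps_mult_nth frob_sum power_mult_distrib)
qed

context C_infinity
begin

lemma tw_0 [simp]: "tw 0 f = f"
  by (rule fps_ext) simp

lemma tw_tw [simp]: "tw m (tw n f) = tw (m + n) f"
  by (rule fps_ext) (simp add: power_add mult.commute flip: power_mult)

lemma tw_untw [simp]: "tw 1 (untw f) = f"
  by (rule fps_ext) simp

lemma untw_tw [simp]: "untw (tw 1 f) = f"
  by (rule fps_ext) simp

lemma tw_const: "tw n (fps_const c) = fps_const (c ^ (CARD('f) ^ n))"
  by (rule fps_ext) simp

lemma tw_X: "tw n fps_X = fps_X"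
  by (rule fps_ext) (simp add: fps_X_def)

lemma poly_twist_root: "poly_twist CARD('f) (- 1) = map_poly frob_root"
  by (rule ext) (simp add: poly_twist_def frob_root_def)

lemma fps_of_poly_twist: "fps_of_poly (poly_twist CARD('f) (- 1) p) = untw (fps_of_poly p)"
  by (rule fps_ext) (simp add: poly_twist_root coeff_map_poly)

lemma gauss_le_tw:
  assumes "gauss_le R M f" "R \<ge> 1"
  shows "gauss_le R (M ^ (CARD('f) ^ n)) (tw n f)"
  unfolding gauss_le_def
proof
  fix i
  let ?k = "CARD('f) ^ n"
  have "R ^ i \<le> (R ^ i) ^ ?k"
    using assms(2) by (intro self_le_power) auto
  hence "absv (fps_nth (tw n f) i) * R ^ i \<le> absv (fps_nth f i) ^ ?k * (R ^ i) ^ ?k"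
    by (simp add: absv_power mult_left_mono)
  also have "\<dots> = (absv (fps_nth f i) * R ^ i) ^ ?k"
    by (simp add: power_mult_distrib)
  also have "\<dots> \<le> M ^ ?k"
    using assms by (intro power_mono) (auto simp: gauss_le_def)
  finally show "absv (fps_nth (tw n f) i) * R ^ i \<le> M ^ ?k" .
qed

lemma entire_tw: "entire f \<Longrightarrow> entire (tw n f)"
  unfolding entire_def using gauss_le_tw by blast

lemma converges_to_tw:
  assumes "converges_to F f"
  shows "converges_to (\<lambda>N. tw n (F N)) (tw n f)"
  unfolding converges_to_def
proof (intro allI impI)
  fix R e :: real assume R: "R \<ge> 1" and e: "e > 0"
  have "\<forall>\<^sub>F N in sequentially. gauss_le R (min e 1) (F N - f)"
    using e by (intro converges_toD[OF assms R]) auto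
  thus "\<forall>\<^sub>F N in sequentially. gauss_le R e (tw n (F N) - tw n f)"
  proof eventually_elim
    case (elim N)
    have "gauss_le R (min e 1 ^ (CARD('f) ^ n)) (tw n (F N - f))"
      by (rule gauss_le_tw[OF elim R])
    moreover have "min e 1 ^ (CARD('f) ^ n) \<le> min e 1"
      using e power_decreasing[of 1 "CARD('f) ^ n" "min e 1"] by auto
    ultimately show ?case
      by (simp add: tw.hom_minus) (metis gauss_le_mono min.cobounded1 order_trans)
  qed
qed

end


section \<open>Carlitz polynomials and power sums\<close>

context C_infinity
begin

lemma \<theta>_power_inj: "\<theta> ^ m = \<theta> ^ n \<longleftrightarrow> m = n"
  using absv_\<theta>_gt_1 by (metis absv_power power_inject_exp)

lemma \<theta>_frob_neq: "m \<noteq> n \<Longrightarrow> \<theta> ^ (CARD('f) ^ m) \<noteq> \<theta> ^ (CARD('f) ^ n)"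
  using CARD_ge_2[where 'a = 'f] by (simp add: \<theta>_power_inj)

abbreviation D :: "nat \<Rightarrow> 'c" where "D n \<equiv> A_emb emb (carlitz_D n)"

definition ell :: "nat \<Rightarrow> 'c" where
  "ell n = (\<Prod>k=1..n. \<theta> - \<theta> ^ (CARD('f) ^ k))"

lemma D_altdef: "D n = (\<Prod>i<n. \<theta> ^ (CARD('f) ^ n) - \<theta> ^ (CARD('f) ^ i))"
  by (simp add: carlitz_D_def A_emb.hom_prod A_emb.hom_minus)

lemma D_0 [simp]: "D 0 = 1"
  by (simp add: D_altdef)

lemma D_Suc: "D (Suc n) = (\<theta> ^ (CARD('f) ^ Suc n) - \<theta>) * D n ^ CARD('f)"
proof -
  have "\<theta> ^ (CARD('f) ^ Suc n) - \<theta> ^ (CARD('f) ^ Suc i)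
      = (\<theta> ^ (CARD('f) ^ n) - \<theta> ^ (CARD('f) ^ i)) ^ CARD('f)" for i
    using frob_diff[of "\<theta> ^ (CARD('f) ^ n)" "\<theta> ^ (CARD('f) ^ i)" 1]
    by (simp add: mult.commute flip: power_mult)
  thus ?thesis
    by (simp only: D_altdef prod.lessThan_Suc_shift prod_power_distrib) simp
qed

lemma ell_0 [simp]: "ell 0 = 1"
  by (simp add: ell_def)

lemma ell_neq_0 [simp]: "ell n \<noteq> 0"
  using \<theta>_frob_neq[of 0] by (auto simp: ell_def)

lemma ell_frob: "ell n ^ (CARD('f) ^ i)
    = (\<Prod>k=1..n. \<theta> ^ (CARD('f) ^ i) - \<theta> ^ (CARD('f) ^ (i + k)))"
  unfolding ell_def prod_power_distrib frob_diff
  by (simp add: power_add mult.commute flip: power_mult)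

lemma ell_frob_Suc: "ell (Suc n) ^ (CARD('f) ^ i)
    = ell n ^ (CARD('f) ^ i) * (\<theta> ^ (CARD('f) ^ i) - \<theta> ^ (CARD('f) ^ (i + Suc n)))"
  unfolding ell_frob by simp

text \<open>
  The expansion \<open>e\<^sub>d(x) / D\<^sub>d = \<Sum>\<^sub>i x^(q^i) / (D\<^sub>i \<ell>\<^bsub>d-i\<^esub>^(q^i))\<close> of the polynomial \<open>e\<^sub>d\<close> whose roots are the
  elements of \<open>A\<close> of degree less than \<open>d\<close>. The right-hand side serves as the definition; its values
  on \<open>A\<close> follow from the two relations between the coefficients for \<open>d + 1\<close> and \<open>d\<close> below.
\<close>

definition carlitz_coeff :: "nat \<Rightarrow> nat \<Rightarrow> 'c" where
  "carlitz_coeff d i = inverse (D i * ell (d - i) ^ (CARD('f) ^ i))"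

definition carlitz_E :: "nat \<Rightarrow> 'c \<Rightarrow> 'c" where
  "carlitz_E d x = (\<Sum>i\<le>d. carlitz_coeff d i * x ^ (CARD('f) ^ i))"

lemma carlitz_coeff_frob:
  "(\<theta> ^ (CARD('f) ^ Suc i) - \<theta>) * carlitz_coeff (Suc d) (Suc i) = carlitz_coeff d i ^ CARD('f)"
proof -
  have "ell (d - i) ^ (CARD('f) ^ Suc i) = (ell (d - i) ^ (CARD('f) ^ i)) ^ CARD('f)"
    by (simp add: mult.commute flip: power_mult)
  moreover have "\<theta> ^ (CARD('f) ^ Suc i) - \<theta> \<noteq> 0"
    using \<theta>_frob_neq[of "Suc i" 0] by simp
  ultimately show ?thesis
    unfolding carlitz_coeff_def D_Suc
    by (simp add: power_mult_distrib power_inverse del: power_Suc)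
qed

lemma carlitz_coeff_step:
  assumes "i \<le> d"
  shows "(\<theta> ^ (CARD('f) ^ i) - \<theta> ^ (CARD('f) ^ Suc d)) * carlitz_coeff (Suc d) i = carlitz_coeff d i"
proof -
  have "ell (Suc d - i) ^ (CARD('f) ^ i)
      = ell (d - i) ^ (CARD('f) ^ i) * (\<theta> ^ (CARD('f) ^ i) - \<theta> ^ (CARD('f) ^ Suc d))"
    using ell_frob_Suc[of "d - i" i] assms by (simp add: Suc_diff_le del: power_Suc)
  moreover have "\<theta> ^ (CARD('f) ^ i) - \<theta> ^ (CARD('f) ^ Suc d) \<noteq> 0"
    using \<theta>_frob_neq[of i "Suc d"] assms by (simp del: power_Suc)
  ultimately show ?thesis
    unfolding carlitz_coeff_def by (simp del: power_Suc)
qed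

lemma carlitz_E_0_left [simp]: "carlitz_E 0 x = x"
  by (simp add: carlitz_E_def carlitz_coeff_def)

lemma carlitz_E_add: "carlitz_E d (x + y) = carlitz_E d x + carlitz_E d y"
  by (simp add: carlitz_E_def frob_add ring_distribs sum.distrib)

lemma carlitz_E_0_right [simp]: "carlitz_E d 0 = 0"
  by (simp add: carlitz_E_def)

lemma carlitz_E_const: "carlitz_E d (const c * x) = const c * carlitz_E d x"
  by (simp add: carlitz_E_def power_mult_distrib sum_distrib_left mult_ac)

lemma carlitz_E_sum: "carlitz_E d (\<Sum>i\<in>I. f i) = (\<Sum>i\<in>I. carlitz_E d (f i))"
  by (induction I rule: infinite_finite_induct) (simp_all add: carlitz_E_add)

text \<open>
  By this relation the values at all powers of \<open>t\<close> follow from those at \<open>1\<close>.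
\<close>

lemma carlitz_E_mult_\<theta>:
  "carlitz_E (Suc d) (\<theta> * x) = \<theta> * carlitz_E (Suc d) x + carlitz_E d x ^ CARD('f)"
proof -
  let ?q = "CARD('f)"
  have "carlitz_E (Suc d) (\<theta> * x) - \<theta> * carlitz_E (Suc d) x
      = (\<Sum>i\<le>Suc d. (\<theta> ^ (?q ^ i) - \<theta>) * carlitz_coeff (Suc d) i * x ^ (?q ^ i))"
    unfolding carlitz_E_def sum_distrib_left sum_subtractf [symmetric]
    by (intro sum.cong refl) (simp add: power_mult_distrib algebra_simps)
  also have "\<dots> = (\<Sum>i\<le>d. (\<theta> ^ (?q ^ Suc i) - \<theta>) * carlitz_coeff (Suc d) (Suc i) * x ^ (?q ^ Suc i))"
    by (subst sum.atMost_Suc_shift) simp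
  also have "\<dots> = (\<Sum>i\<le>d. (carlitz_coeff d i * x ^ (?q ^ i)) ^ ?q)"
    unfolding carlitz_coeff_frob
    by (intro sum.cong refl) (simp add: power_mult_distrib mult.commute flip: power_mult)
  also have "\<dots> = carlitz_E d x ^ ?q"
    using frob_sum[of "\<lambda>i. carlitz_coeff d i * x ^ (?q ^ i)" "{..d}" 1] by (simp add: carlitz_E_def)
  finally show ?thesis
    by (simp add: algebra_simps)
qed

text \<open>
  Subtracting the two relations between the coefficients and summing over them gives
  \<open>(t^(q^(d+1)) - t) u\<^bsub>d+1\<^esub> = u\<^sub>d^q - u\<^sub>d\<close> for \<open>u\<^sub>d = E\<^sub>d(1)\<close>; starting from \<open>u\<^sub>0 = 1\<close> the right-hand side
  always vanishes.
\<close>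

lemma carlitz_E_one: "carlitz_E (Suc d) 1 = 0"
proof -
  let ?q = "CARD('f)"
  have step: "(\<theta> ^ (?q ^ Suc d) - \<theta>) * carlitz_E (Suc d) 1 = carlitz_E d 1 ^ ?q - carlitz_E d 1" for d
  proof -
    have "(\<theta> ^ (?q ^ Suc d) - \<theta>) * carlitz_E (Suc d) 1
        = (\<Sum>i\<le>Suc d. carlitz_coeff (Suc d) i * \<theta> ^ (?q ^ i)) - \<theta> * (\<Sum>i\<le>Suc d. carlitz_coeff (Suc d) i)
          - (\<Sum>i\<le>Suc d. (\<theta> ^ (?q ^ i) - \<theta> ^ (?q ^ Suc d)) * carlitz_coeff (Suc d) i)"
      unfolding carlitz_E_def sum_distrib_left sum_subtractf [symmetric]
      by (intro sum.cong refl) (simp add: algebra_simps)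
    also have "(\<Sum>i\<le>Suc d. (\<theta> ^ (?q ^ i) - \<theta> ^ (?q ^ Suc d)) * carlitz_coeff (Suc d) i) = carlitz_E d 1"
      by (simp add: carlitz_E_def carlitz_coeff_step del: power_Suc)
    also have "(\<Sum>i\<le>Suc d. carlitz_coeff (Suc d) i * \<theta> ^ (?q ^ i)) - \<theta> * (\<Sum>i\<le>Suc d. carlitz_coeff (Suc d) i)
        = carlitz_E d 1 ^ ?q"
      using carlitz_E_mult_\<theta>[of d 1] unfolding carlitz_E_def by simp
    finally show ?thesis .
  qed
  have next_zero: "carlitz_E (Suc d) 1 = 0" if "carlitz_E d 1 ^ ?q = carlitz_E d 1" for d
    using step[of d] that \<theta>_frob_neq[of "Suc d" 0] by simp
  show ?thesis
    by (induction d) (auto intro!: next_zero simp: power_0_left)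
qed

lemma carlitz_E_\<theta>_power: "j \<le> d \<Longrightarrow> carlitz_E d (\<theta> ^ j) = (if j = d then 1 else 0)"
proof (induction j arbitrary: d)
  case 0
  thus ?case by (cases d) (auto simp: carlitz_E_one)
next
  case (Suc j)
  then obtain d' where d: "d = Suc d'"
    by (cases d) auto
  show ?case
    using Suc.prems Suc.IH[of d] Suc.IH[of d'] by (simp add: d carlitz_E_mult_\<theta>)
qed

lemma carlitz_E_A_emb:
  assumes "degree a \<le> d"
  shows "carlitz_E d (A_emb emb a) = const (coeff a d)"
proof -
  have "A_emb emb a = A_emb emb (\<Sum>j\<le>d. monom (coeff a j) j)"
    by (simp only: poly_as_sum_of_monoms'[OF assms])
  also have "\<dots> = (\<Sum>j\<le>d. A_emb emb (monom (coeff a j) j))"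
    by (rule A_emb.hom_sum)
  also have "carlitz_E d \<dots> = (\<Sum>j\<le>d. const (coeff a j) * (if j = d then 1 else 0))"
    by (simp add: carlitz_E_sum carlitz_E_const carlitz_E_\<theta>_power)
  also have "\<dots> = const (coeff a d)"
    by (simp add: if_distrib cong: if_cong)
  finally show ?thesis .
qed

definition monics :: "nat \<Rightarrow> 'f poly set" where
  "monics d = {a. lead_coeff a = 1 \<and> degree a = d}"

definition carlitz_poly :: "nat \<Rightarrow> 'c poly" where
  "carlitz_poly d = 1 - (\<Sum>i\<le>d. monom (carlitz_coeff d i) (CARD('f) ^ i))"

lemma poly_carlitz_poly: "poly (carlitz_poly d) x = 1 - carlitz_E d x"
  by (simp add: carlitz_poly_def carlitz_E_def poly_sum poly_monom)

lemma card_monics_ge: "finite (monics d) \<Longrightarrow> CARD('f) ^ d \<le> card (monics d)"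
proof -
  assume fin: "finite (monics d)"
  let ?L = "{xs. set xs \<subseteq> (UNIV :: 'f set) \<and> length xs = d}"
  let ?f = "\<lambda>xs. monom 1 d + Poly xs :: 'f poly"
  have coeff: "coeff (?f xs) i = (if i < d then xs ! i else if i = d then 1 else 0)" if "xs \<in> ?L" for xs i
    using that by (auto simp: coeff_Poly_eq nth_default_def)
  have "inj_on ?f ?L"
  proof (rule inj_onI)
    fix xs ys assume *: "xs \<in> ?L" "ys \<in> ?L" "?f xs = ?f ys"
    show "xs = ys"
    proof (rule nth_equalityI)
      show "length xs = length ys"
        using * by simp
      fix i assume "i < length xs"
      thus "xs ! i = ys ! i"
        using coeff[OF *(1), of i] coeff[OF *(2), of i] * by simp
    qed
  qed
  moreover have "?f ` ?L \<subseteq> monics d"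
  proof (rule image_subsetI)
    fix xs assume xs: "xs \<in> ?L"
    have "degree (?f xs) \<le> d"
      by (rule degree_le) (simp only: coeff[OF xs], simp)
    moreover have "d \<le> degree (?f xs)"
      by (rule le_degree) (simp only: coeff[OF xs], simp)
    ultimately have "degree (?f xs) = d"
      by (rule order_antisym)
    thus "?f xs \<in> monics d"
      using coeff[OF xs, of d] by (simp add: monics_def)
  qed
  ultimately have "card ?L \<le> card (monics d)"
    using fin by (meson card_inj_on_le)
  thus ?thesis
    using card_lists_length_eq[of "UNIV :: 'f set" d] by simp
qed

lemma degree_carlitz_poly: "degree (carlitz_poly d) \<le> CARD('f) ^ d"
  unfolding carlitz_poly_def
  by (intro degree_diff_le degree_sum_le) (auto intro!: order_trans[OF degree_monom_le] power_increasing)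

lemma poly_carlitz_poly_monic: "a \<in> monics d \<Longrightarrow> poly (carlitz_poly d) (A_emb emb a) = 0"
  by (auto simp: poly_carlitz_poly carlitz_E_A_emb monics_def)

lemma carlitz_poly_neq_0: "carlitz_poly d \<noteq> 0"
  using poly_carlitz_poly[of d 0] by auto

lemma finite_monics: "finite (monics d)"
proof -
  have "finite (A_emb emb ` monics d)"
    by (rule finite_subset[OF _ poly_roots_finite[OF carlitz_poly_neq_0[of d]]])
       (auto simp: poly_carlitz_poly_monic)
  thus ?thesis
    by (rule finite_imageD) (rule inj_on_subset[OF inj_A_emb subset_UNIV])
qed

text \<open>
  The polynomial \<open>1 - carlitz_E d x\<close> has degree \<open>q^d\<close> and vanishes at all monic elements of degree
  \<open>d\<close>; as there are \<open>q^d\<close> of these, they are all its roots.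
\<close>

lemma carlitz_poly_prod:
  obtains c where "carlitz_poly d = Polynomial.smult c (\<Prod>a\<in>monics d. [:- A_emb emb a, 1:])"
proof
  define c where "c = coeff (carlitz_poly d) (CARD('f) ^ d)"
  define R where "R = (\<Prod>a\<in>monics d. [:- A_emb emb a, 1:])"
  have card: "card (A_emb emb ` monics d) = card (monics d)"
    by (rule card_image) (rule inj_on_subset[OF inj_A_emb subset_UNIV])
  have "card (A_emb emb ` monics d) \<le> card {x. poly (carlitz_poly d) x = 0}"
    by (rule card_mono) (auto simp: poly_carlitz_poly_monic poly_roots_finite carlitz_poly_neq_0)
  also have "\<dots> \<le> CARD('f) ^ d"
    using card_poly_roots_bound[OF carlitz_poly_neq_0] degree_carlitz_poly order_trans by blast
  finally have card': "card (monics d) = CARD('f) ^ d"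
    using card_monics_ge[OF finite_monics, of d] card by simp
  have R: "degree R = CARD('f) ^ d" "coeff R (CARD('f) ^ d) = 1"
  proof -
    show deg: "degree R = CARD('f) ^ d"
      unfolding R_def by (subst degree_prod_eq_sum_degree) (auto simp: card')
    have "lead_coeff R = 1"
      unfolding R_def lead_coeff_prod by simp
    thus "coeff R (CARD('f) ^ d) = 1"
      by (simp add: deg)
  qed
  show "carlitz_poly d = Polynomial.smult c R"
  proof (rule poly_eqI_degree_lead_coeff)
    show "poly (carlitz_poly d) x = poly (Polynomial.smult c R) x" if "x \<in> A_emb emb ` monics d" for x
      using that finite_monics by (auto simp: R_def poly_carlitz_poly_monic poly_prod)
    show "card (A_emb emb ` monics d) \<ge> CARD('f) ^ d"
      by (simp add: card card')
    show "degree (Polynomial.smult c R) \<le> CARD('f) ^ d"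
      using degree_smult_le[of c R] R by simp
    show "coeff (carlitz_poly d) (CARD('f) ^ d) = coeff (Polynomial.smult c R) (CARD('f) ^ d)"
      by (simp add: R c_def)
  qed (rule degree_carlitz_poly)
qed

lemma of_nat_CARD_power [simp]: "n > 0 \<Longrightarrow> of_nat (CARD('f) ^ n) = (0 :: 'c)"
proof -
  have "of_nat CARD('f) = (0 :: 'c)"
    using const.hom_of_nat[of "CARD('f) choose 1"] choose_CARD_eq_0[of 1, where 'f = 'f]
      CARD_ge_2[where 'a = 'f] by simp
  thus "n > 0 \<Longrightarrow> of_nat (CARD('f) ^ n) = (0 :: 'c)"
    by (simp add: of_nat_power power_0_left)
qed

lemma pderiv_carlitz_poly: "pderiv (carlitz_poly d) = [:- inverse (ell d):]"
proof -
  have "pderiv (monom (carlitz_coeff d i) (CARD('f) ^ i)) = (if i = 0 then [:inverse (ell d):] else 0)" for i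
  proof (cases "i = 0")
    case False
    thus ?thesis
      by (simp add: pderiv_monom del: of_nat_power)
  qed (simp add: pderiv_monom carlitz_coeff_def monom_0)
  thus ?thesis
    by (simp add: carlitz_poly_def pderiv_diff pderiv_sum higher_pderiv_sum)
qed

text \<open>
  The logarithmic derivative of \<open>\<Prod>(x - a)\<close>, with \<open>a\<close> running over the monic elements of degree
  \<open>d\<close>, is the generating function of the power sums; the derivative of \<open>carlitz_poly d\<close> is constant
  because the other exponents are powers of \<open>q\<close>.
\<close>

lemma power_sum_gen_fun:
  "fps_of_poly (carlitz_poly d) * Abs_fps (\<lambda>n. power_sum emb d (Suc n)) = fps_const (inverse (ell d))"
proof -
  obtain c where c: "carlitz_poly d = Polynomial.smult c (\<Prod>a\<in>monics d. [:- A_emb emb a, 1:])"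
    using carlitz_poly_prod .
  define g where "g = (\<lambda>a. Abs_fps (\<lambda>n. inverse (A_emb emb a) ^ Suc n))"
  have nz: "a \<noteq> 0" if "a \<in> monics d" for a
    using that by (auto simp: monics_def)
  have g: "fps_of_poly [:- A_emb emb a, 1:] * g a = - 1" if "a \<in> monics d" for a
  proof (rule fps_ext)
    fix n
    have eq: "fps_of_poly [:- A_emb emb a, 1:] = fps_X - fps_const (A_emb emb a)"
      by (rule fps_ext) (simp add: coeff_pCons fps_X_def split: nat.splits)
    show "fps_nth (fps_of_poly [:- A_emb emb a, 1:] * g a) n = fps_nth (- 1) n"
      unfolding eq using nz[OF that] by (cases n) (auto simp: g_def left_diff_distrib)
  qed
  have "Abs_fps (\<lambda>n. power_sum emb d (Suc n)) = (\<Sum>a\<in>monics d. g a)"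
    by (rule fps_ext) (simp add: power_sum_def monics_def g_def fps_sum_nth power_inverse)
  hence "fps_of_poly (carlitz_poly d) * Abs_fps (\<lambda>n. power_sum emb d (Suc n))
      = (\<Sum>a\<in>monics d. fps_const c * ((\<Prod>a\<in>monics d. fps_of_poly [:- A_emb emb a, 1:]) * g a))"
    by (simp add: c fps_of_poly_smult fps_of_poly_prod sum_distrib_left mult.assoc)
  also have "\<dots> = (\<Sum>a\<in>monics d. fps_const c * - (\<Prod>a\<in>monics d - {a}. fps_of_poly [:- A_emb emb a, 1:]))"
  proof (intro sum.cong refl, goal_cases)
    case (1 a)
    show ?case
      using g[OF 1] by (subst prod.remove[OF finite_monics 1])
        (metis (no_types, lifting) mult.commute mult.left_commute mult_minus1)
  qed
  also have "\<dots> = - fps_of_poly (pderiv (carlitz_poly d))"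
    by (simp add: c pderiv_smult pderiv_prod fps_of_poly_smult fps_of_poly_sum fps_of_poly_prod
        sum_distrib_left sum_negf pderiv_pCons flip: one_pCons)
  finally show ?thesis
    by (simp add: pderiv_carlitz_poly fps_of_poly_const fps_const_neg flip: fps_of_poly_uminus)
qed

lemma power_sum_recursion:
  "power_sum emb d (Suc n) = (if n = 0 then inverse (ell d) else 0) +
     (\<Sum>i | i \<le> d \<and> CARD('f) ^ i \<le> n. carlitz_coeff d i * power_sum emb d (Suc (n - CARD('f) ^ i)))"
proof -
  let ?S = "Abs_fps (\<lambda>n. power_sum emb d (Suc n))"
  define T where "T = (\<Sum>i\<le>d. fps_const (carlitz_coeff d i) * fps_X ^ (CARD('f) ^ i))"
  have "?S = (1 - T) * ?S + T * ?S"
    by (simp add: left_diff_distrib)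
  moreover have "1 - T = fps_of_poly (carlitz_poly d)"
    by (simp add: T_def carlitz_poly_def fps_of_poly_diff fps_of_poly_sum fps_of_poly_monom)
  ultimately have "?S = fps_const (inverse (ell d)) + (\<Sum>i\<le>d. fps_const (carlitz_coeff d i) * (fps_X ^ (CARD('f) ^ i) * ?S))"
    by (simp only: power_sum_gen_fun T_def sum_distrib_right mult.assoc)
  hence "fps_nth ?S n = fps_nth (fps_const (inverse (ell d)) +
      (\<Sum>i\<le>d. fps_const (carlitz_coeff d i) * (fps_X ^ (CARD('f) ^ i) * ?S))) n"
    by (rule arg_cong)
  also have "\<dots> = (if n = 0 then inverse (ell d) else 0) + (\<Sum>i\<le>d. if CARD('f) ^ i \<le> n
      then carlitz_coeff d i * power_sum emb d (Suc (n - CARD('f) ^ i)) else 0)"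
    by (auto simp: fps_sum_nth fps_X_power_mult_nth intro!: sum.cong)
  also have "(\<Sum>i\<le>d. if CARD('f) ^ i \<le> n
        then carlitz_coeff d i * power_sum emb d (Suc (n - CARD('f) ^ i)) else 0)
      = (\<Sum>i | i \<le> d \<and> CARD('f) ^ i \<le> n. carlitz_coeff d i * power_sum emb d (Suc (n - CARD('f) ^ i)))"
    by (subst sum.inter_filter [symmetric]) auto
  finally show ?thesis
    by simp
qed

end


section \<open>Divisibility of Carlitz factorials\<close>

lemma poly_frob_diff: "(x - y) ^ CARD('f) = x ^ CARD('f) - y ^ CARD('f)"
  for x y :: "'f::{field,finite} poly"
proof -
  have "of_nat (CARD('f) choose k) = (0 :: 'f poly)" if "0 < k" "k < CARD('f)" for k
    using choose_CARD_eq_0[OF that] by (simp add: of_nat_poly)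
  hence "((x - y) + y) ^ CARD('f) = (x - y) ^ CARD('f) + y ^ CARD('f)"
    by (rule frobenius_add_if_choose_eq_0) simp_all
  thus ?thesis by simp
qed

lemma carlitz_D_power_dvd: "(carlitz_D n :: 'f::{field,finite} poly) ^ CARD('f) dvd carlitz_D (Suc n)"
proof -
  have "(monom 1 (CARD('f) ^ Suc n) - monom 1 (CARD('f) ^ Suc i) :: 'f poly)
      = (monom 1 (CARD('f) ^ n) - monom 1 (CARD('f) ^ i)) ^ CARD('f)" for i
    by (simp add: poly_frob_diff monom_power mult.commute)
  hence "(carlitz_D (Suc n) :: 'f poly) =
      (monom 1 (CARD('f) ^ Suc n) - monom 1 (CARD('f) ^ 0)) * carlitz_D n ^ CARD('f)"
    unfolding carlitz_D_def prod.lessThan_Suc_shift prod_power_distrib by simp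
  thus ?thesis by simp
qed

lemma carlitz_D_neq_0 [simp]: "carlitz_D n \<noteq> (0 :: 'f::{field,finite} poly)"
proof -
  have "monom 1 (CARD('f) ^ n) \<noteq> (monom 1 (CARD('f) ^ i) :: 'f poly)" if "i < n" for i
    using that CARD_ge_2[where 'a = 'f] by (auto simp: monom_eq_iff')
  thus ?thesis
    by (auto simp: carlitz_D_def)
qed

text \<open>The product of the \<open>D\<^bsub>j+k\<^esub>\<close> to the \<open>k\<close>-th base \<open>q\<close> digit of \<open>n\<close>.\<close>

function digit_prod :: "nat \<Rightarrow> nat \<Rightarrow> 'f::{field,finite} poly" where
  "digit_prod j n = (if n = 0 then 1 else
     carlitz_D j ^ (n mod CARD('f)) * digit_prod (Suc j) (n div CARD('f)))"
  by auto
termination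
proof (relation "measure snd")
  fix j n :: nat assume "n \<noteq> 0"
  thus "((Suc j, n div CARD('f::{field,finite})), j, n) \<in> measure snd"
    using CARD_ge_2[where 'a = 'f] by simp
qed simp

declare digit_prod.simps [simp del]

lemma digit_prod_0 [simp]: "digit_prod j 0 = 1"
  by (simp add: digit_prod.simps)

lemma digit_prod_step:
  "(digit_prod j n :: 'f::{field,finite} poly) =
     carlitz_D j ^ (n mod CARD('f)) * digit_prod (Suc j) (n div CARD('f))"
  by (cases "n = 0") (simp_all add: digit_prod.simps[of j n])

lemma digit_prod_altdef:
  "n < CARD('f) ^ M \<Longrightarrow> digit_prod j n =
     (\<Prod>k<M. carlitz_D (j + k) ^ ((n div CARD('f) ^ k) mod CARD('f)) :: 'f::{field,finite} poly)"
proof (induction M arbitrary: j n)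
  case (Suc M)
  have "n div CARD('f) < CARD('f) ^ M"
    using Suc.prems by (simp add: div_less_iff_less_mult mult.commute)
  from Suc.IH[OF this, of "Suc j"] show ?case
    by (subst digit_prod_step, unfold prod.lessThan_Suc_shift) (simp add: div_mult2_eq)
qed simp

lemma carlitz_gamma_eq_digit_prod:
  "(carlitz_gamma (Suc n) :: 'f::{field,finite} poly) = digit_prod 0 n"
proof -
  have "n < CARD('f) ^ n"
    using CARD_ge_2[where 'a = 'f] by (intro power_gt_expt) simp
  also have "CARD('f) ^ n \<le> CARD('f) ^ Suc n"
    by simp
  finally have "n < CARD('f) ^ Suc n" .
  from digit_prod_altdef[OF this, of 0] show ?thesis
    by (simp add: carlitz_gamma_def Let_def lessThan_Suc_atMost)
qed

text \<open>
  Adding \<open>1\<close> either raises the lowest digit, or it replaces \<open>q\<close> copies of \<open>D\<^sub>j\<close> by one factor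
  \<open>D\<^bsub>j+1\<^esub>\<close> and carries; \<open>D\<^sub>j^q\<close> divides \<open>D\<^bsub>j+1\<^esub>\<close>.
\<close>

lemma digit_prod_Suc_dvd:
  "carlitz_D j * digit_prod j n dvd (digit_prod j (Suc n) :: 'f::{field,finite} poly)"
proof (induction n arbitrary: j rule: less_induct)
  case (less n)
  let ?q = "CARD('f)"
  have q: "?q \<ge> 2" by (rule CARD_ge_2)
  show ?case
  proof (cases "Suc (n mod ?q) = ?q")
    case False
    hence "Suc n mod ?q = Suc (n mod ?q)" "Suc n div ?q = n div ?q"
      by (simp_all add: mod_Suc div_Suc)
    thus ?thesis
      by (subst (1 2) digit_prod_step) (simp add: mult.assoc)
  next
    case True
    hence carry: "Suc n mod ?q = 0" "Suc n div ?q = Suc (n div ?q)"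
      by (simp_all add: mod_Suc div_Suc)
    have "n \<noteq> 0"
    proof
      assume "n = 0"
      with True q show False by simp
    qed
    hence "n div ?q < n"
      using q by simp
    have "carlitz_D j * digit_prod j n
        = (carlitz_D j :: 'f poly) ^ Suc (n mod ?q) * digit_prod (Suc j) (n div ?q)"
      by (subst digit_prod_step) (simp add: mult.assoc)
    also have "\<dots> dvd carlitz_D (Suc j) * digit_prod (Suc j) (n div ?q)"
      unfolding True by (intro mult_dvd_mono carlitz_D_power_dvd dvd_refl)
    also have "\<dots> dvd digit_prod (Suc j) (Suc (n div ?q))"
      by (rule less.IH[OF \<open>n div ?q < n\<close>])
    also have "\<dots> = digit_prod j (Suc n)"
      by (subst (2) digit_prod_step) (simp add: carry)
    finally show ?thesis .
  qed
qed

lemma digit_prod_add_power_dvd: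
  "carlitz_D (j + i) * digit_prod j n dvd (digit_prod j (n + CARD('f) ^ i) :: 'f::{field,finite} poly)"
proof (induction i arbitrary: j n)
  case 0
  thus ?case using digit_prod_Suc_dvd[of j n] by simp
next
  case (Suc i)
  let ?q = "CARD('f)"
  have step: "(n + ?q ^ Suc i) mod ?q = n mod ?q" "(n + ?q ^ Suc i) div ?q = n div ?q + ?q ^ i"
    by simp_all
  have "carlitz_D (j + Suc i) * digit_prod j n = (carlitz_D j :: 'f poly) ^ (n mod ?q) *
      (carlitz_D (Suc j + i) * digit_prod (Suc j) (n div ?q))"
    by (subst digit_prod_step) (simp add: mult_ac)
  also have "\<dots> dvd carlitz_D j ^ (n mod ?q) * digit_prod (Suc j) (n div ?q + ?q ^ i)"
    by (intro mult_dvd_mono dvd_refl Suc.IH)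
  also have "\<dots> = digit_prod j (n + ?q ^ Suc i)"
    by (subst (2) digit_prod_step) (simp only: step)
  finally show ?case .
qed

lemma carlitz_gamma_dvd:
  assumes "CARD('f) ^ i \<le> n"
  shows "carlitz_D i * carlitz_gamma (Suc (n - CARD('f) ^ i)) dvd
    (carlitz_gamma (Suc n) :: 'f::{field,finite} poly)"
  using digit_prod_add_power_dvd[of 0 i "n - CARD('f) ^ i", where 'f = 'f] assms
  by (simp add: carlitz_gamma_eq_digit_prod)

lemma carlitz_gamma_neq_0 [simp]: "carlitz_gamma n \<noteq> (0 :: 'f::{field,finite} poly)"
  by (simp add: carlitz_gamma_def Let_def)

lemma carlitz_gamma_1 [simp]: "carlitz_gamma (Suc 0) = (1 :: 'f::{field,finite} poly)"
  by (simp add: carlitz_gamma_eq_digit_prod)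


section \<open>A recursion for the polynomials \<open>H\<^sub>n\<close>\<close>

text \<open>
  Multiplying the generating identity by the series to be inverted gives a recursion for
  \<open>H\<^sub>n / \<Gamma>\<^bsub>n+1\<^esub>(T)\<close>. Its coefficients have denominators \<open>D\<^sub>i(T)\<close>, which \<open>carlitz_gamma_dvd\<close> clears; so
  the recursion can be run inside \<open>A[T]\<close>, and it defines the \<open>H\<^sub>n\<close>.
\<close>

definition H_numerator :: "nat \<Rightarrow> 'f::{field,finite} poly poly" where
  "H_numerator i = (\<Prod>j=1..i. outer_T ^ (CARD('f) ^ i) - inner_t ^ (CARD('f) ^ j))"

definition gamma_quot :: "nat \<Rightarrow> nat \<Rightarrow> 'f::{field,finite} poly" where
  "gamma_quot n i = carlitz_gamma (Suc n) div (carlitz_D i * carlitz_gamma (Suc (n - CARD('f) ^ i)))"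

lemma gamma_quot:
  assumes "CARD('f) ^ i \<le> n"
  shows "carlitz_gamma (Suc n) = (gamma_quot n i * (carlitz_D i * carlitz_gamma (Suc (n - CARD('f) ^ i)))
    :: 'f::{field,finite} poly)"
  unfolding gamma_quot_def using carlitz_gamma_dvd[OF assms] by simp

lemma finite_power_le: "finite {i. CARD('f::{field,finite}) ^ i \<le> n}"
proof (rule finite_subset)
  have "i < CARD('f) ^ i" for i
    using CARD_ge_2[where 'a = 'f] by (intro power_gt_expt) simp
  thus "{i. CARD('f) ^ i \<le> n} \<subseteq> {..n}"
    by (auto intro: order_trans[OF less_imp_le])
qed simp

function H_rec :: "nat \<Rightarrow> 'f::{field,finite} poly poly" where
  "H_rec n = (if n = 0 then 1 else
     (\<Sum>i | CARD('f) ^ i \<le> n. H_numerator i * subst_T (gamma_quot n i) * H_rec (n - CARD('f) ^ i)))"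
  by auto
termination
  by (relation "measure id") auto

declare H_rec.simps [simp del]

lemma H_rec_0 [simp]: "H_rec 0 = 1"
  by (simp add: H_rec.simps)

lemma H_rec_pos: "n > 0 \<Longrightarrow> (H_rec n :: 'f::{field,finite} poly poly) =
   (\<Sum>i | CARD('f) ^ i \<le> n. H_numerator i * subst_T (gamma_quot n i) * H_rec (n - CARD('f) ^ i))"
  by (subst H_rec.simps) simp

lemma comm_ring_hom_poly_const: "comm_ring_hom (\<lambda>c. [:c:] :: 'a::comm_ring_1 poly)"
  by standard (simp_all add: one_pCons)

lemma inj_comm_ring_hom_subst_T: "inj_comm_ring_hom (subst_T :: 'f::field poly \<Rightarrow> _)"
proof -
  interpret const: comm_ring_hom "\<lambda>c. [:c:] :: 'f poly"
    by (rule comm_ring_hom_poly_const)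
  interpret map_poly_comm_ring_hom "\<lambda>c. [:c:] :: 'f poly" ..
  show ?thesis
    unfolding subst_T_def
  proof
    fix x :: "'f poly"
    assume "map_poly (\<lambda>c. [:c:] :: 'f poly) x = 0"
    hence "coeff (coeff (map_poly (\<lambda>c. [:c:] :: 'f poly) x) n) 0 = 0" for n
      by simp
    thus "x = 0"
      by (intro poly_eqI) (simp add: coeff_map_poly)
  qed
qed

interpretation subst_T: inj_comm_ring_hom subst_T
  by (rule inj_comm_ring_hom_subst_T)

lemma subst_T_monom: "subst_T (monom 1 n) = outer_T ^ n"
proof -
  have "subst_T (monom 1 n) = monom [:1:] n"
    by (simp add: subst_T_def map_poly_monom)
  also have "\<dots> = monom 1 n"
    by (simp add: one_pCons)
  also have "\<dots> = outer_T ^ n"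
    by (simp add: outer_T_def monom_altdef)
  finally show ?thesis .
qed

lemma subst_T_carlitz_D:
  "subst_T (carlitz_D i :: 'f::{field,finite} poly) =
     (\<Prod>j=1..i. outer_T ^ (CARD('f) ^ i) - outer_T ^ (CARD('f) ^ (j - 1)))"
proof -
  have "{..<i} = (\<lambda>j. j - 1) ` {1..i}"
    by (force simp: image_iff intro: bexI[of _ "Suc _"])
  moreover have "inj_on (\<lambda>j. j - 1) {1..i}"
    by (auto simp: inj_on_def)
  ultimately show ?thesis
    by (simp add: carlitz_D_def subst_T.hom_prod subst_T.hom_minus subst_T_monom prod.reindex)
qed

lemma lacunary_mult_nth:
  fixes c :: "nat \<Rightarrow> 'a::comm_ring_1"
  shows "fps_nth (Abs_fps (\<lambda>n. \<Sum>i | CARD('f::{field,finite}) ^ i = n. c i) * g) n =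
    (\<Sum>i | CARD('f) ^ i \<le> n. c i * fps_nth g (n - CARD('f) ^ i))"
proof -
  let ?h = "\<lambda>i. c i * fps_nth g (n - CARD('f) ^ i)"
  have "fps_nth (Abs_fps (\<lambda>n. \<Sum>i | CARD('f) ^ i = n. c i) * g) n =
      (\<Sum>k=0..n. \<Sum>i | i \<in> {i. CARD('f) ^ i \<le> n} \<and> CARD('f) ^ i = k. ?h i)"
    unfolding fps_mult_nth
  proof (intro sum.cong refl)
    fix k assume "k \<in> {0..n}"
    hence "{i. i \<in> {i. CARD('f) ^ i \<le> n} \<and> CARD('f) ^ i = k} = {i. CARD('f) ^ i = k}"
      by auto
    thus "fps_nth (Abs_fps (\<lambda>n. \<Sum>i | CARD('f) ^ i = n. c i)) k * fps_nth g (n - k) =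
        (\<Sum>i | i \<in> {i. CARD('f) ^ i \<le> n} \<and> CARD('f) ^ i = k. ?h i)"
      by (simp add: sum_distrib_right)
  qed
  also have "\<dots> = (\<Sum>i | CARD('f) ^ i \<le> n. ?h i)"
    by (rule sum.group) (auto intro: finite_power_le)
  finally show ?thesis .
qed

lemma H_rec_series:
  "Abs_fps (\<lambda>n. Fract (H_rec n) (subst_T (carlitz_gamma (n + 1)))) =
     (AT_series :: 'f::{field,finite} poly poly fract fps)"
proof -
  interpret tf: comm_ring_hom "to_fract :: 'f poly poly \<Rightarrow> _"
    by standard simp_all
  define c :: "nat \<Rightarrow> 'f poly poly fract" where
    "c = (\<lambda>i. to_fract (H_numerator i) / to_fract (subst_T (carlitz_D i)))"
  define S where "S = Abs_fps (\<lambda>n. \<Sum>i | CARD('f) ^ i = n. c i)"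
  define W where "W = Abs_fps (\<lambda>n. Fract (H_rec n :: 'f poly poly) (subst_T (carlitz_gamma (n + 1))))"
  have W_nth: "fps_nth W n = to_fract (H_rec n) / to_fract (subst_T (carlitz_gamma (Suc n)))" for n
    by (simp add: W_def Fract_conv_to_fract)
  have fract_prod: "(\<Prod>j=1..i. Fract (outer_T ^ (CARD('f) ^ i) - inner_t ^ (CARD('f) ^ j))
           (outer_T ^ (CARD('f) ^ i) - outer_T ^ (CARD('f) ^ (j - 1)))) = c i" for i
    by (simp add: Fract_conv_to_fract prod_dividef c_def H_numerator_def subst_T_carlitz_D tf.hom_prod)
  have AT: "AT_series = inverse (1 - S)"
    unfolding AT_series_def S_def by (simp only: fract_prod)
  have "W = 1 + S * W"
  proof (rule fps_ext)
    fix n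
    show "fps_nth W n = fps_nth (1 + S * W) n"
    proof (cases "n = 0")
      case False
      have "fps_nth W n = (\<Sum>i | CARD('f) ^ i \<le> n. to_fract (H_numerator i) *
          to_fract (subst_T (gamma_quot n i)) * to_fract (H_rec (n - CARD('f) ^ i)) /
          to_fract (subst_T (carlitz_gamma (Suc n))))"
        using False by (simp add: W_nth H_rec_pos tf.hom_sum sum_divide_distrib)
      also have "\<dots> = (\<Sum>i | CARD('f) ^ i \<le> n. c i * fps_nth W (n - CARD('f) ^ i))"
      proof (intro sum.cong refl)
        fix i assume i: "i \<in> {i. CARD('f) ^ i \<le> n}"
        hence g: "carlitz_gamma (Suc n) = (gamma_quot n i *
            (carlitz_D i * carlitz_gamma (Suc (n - CARD('f) ^ i))) :: 'f poly)"
          by (intro gamma_quot) simp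
        hence "gamma_quot n i \<noteq> (0 :: 'f poly)"
          by (metis carlitz_gamma_neq_0 mult_zero_left)
        thus "to_fract (H_numerator i) * to_fract (subst_T (gamma_quot n i)) *
            to_fract (H_rec (n - CARD('f) ^ i)) / to_fract (subst_T (carlitz_gamma (Suc n)))
            = c i * fps_nth W (n - CARD('f) ^ i)"
          by (simp add: c_def W_nth g subst_T.hom_mult)
      qed
      finally show ?thesis
        using False by (simp add: S_def lacunary_mult_nth)
    qed (simp add: W_nth S_def lacunary_mult_nth to_fract_def One_fract_def)
  qed
  hence "(1 - S) * W = 1"
    unfolding left_diff_distrib mult_1_left diff_eq_eq .
  hence "inverse (1 - S) = W"
    by (rule fps_inverse_unique)
  thus ?thesis
    by (simp add: AT W_def)
qed

lemma AT_H_eq_H_rec: "(AT_H :: nat \<Rightarrow> 'f::{field,finite} poly poly) = H_rec"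
  unfolding AT_H_def
proof (rule the_equality)
  fix H :: "nat \<Rightarrow> 'f poly poly"
  assume "Abs_fps (\<lambda>n. Fract (H n) (subst_T (carlitz_gamma (n + 1)))) = AT_series"
  from trans[OF this H_rec_series[symmetric]]
  have "Fract (H n) (subst_T (carlitz_gamma (n + 1))) =
      Fract (H_rec n) (subst_T (carlitz_gamma (n + 1)))" for n
    by (simp only: fps_eq_iff fps_nth_Abs_fps)
  hence "H n = H_rec n" for n
    by (simp add: eq_fract)
  thus "H = H_rec"
    by (rule ext)
qed (rule H_rec_series)

text \<open>
  In the generating identity \<open>t\<close> only occurs as \<open>t^q, t^(q^2), \<dots>\<close>; the coefficients of
  \<open>H\<^sub>n\<close> are therefore \<open>q\<close>-th powers, which makes the untwist of \<open>H\<^sub>n\<close> a polynomial over \<open>A\<close>.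
\<close>

lemma coeff_H_rec_power: "coeff (H_rec n) i \<in> range (\<lambda>b :: 'f::{field,finite} poly. b ^ CARD('f))"
proof -
  define R where "R = range (\<lambda>b :: 'f poly. b ^ CARD('f))"
  have diff: "x - y \<in> R" if "x \<in> R" "y \<in> R" for x y
    using that unfolding R_def by (auto simp flip: poly_frob_diff)
  have zero: "0 \<in> R" and one: "1 \<in> R"
    unfolding R_def by (force intro: image_eqI[of _ _ 0] image_eqI[of _ _ 1] simp: power_0_left)+
  have add: "x + y \<in> R" if "x \<in> R" "y \<in> R" for x y
    using diff[OF that(1) diff[OF zero that(2)]] by simp
  have mult: "x * y \<in> R" if "x \<in> R" "y \<in> R" for x y
    using that unfolding R_def by (auto simp flip: power_mult_distrib)
  define P where "P = {h :: 'f poly poly. \<forall>i. coeff h i \<in> R}"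
  have P_mult: "g * h \<in> P" if "g \<in> P" "h \<in> P" for g h
    using that unfolding P_def by (auto intro!: coeff_mult_semiring_closed[of R] zero add mult)
  have P_diff: "g - h \<in> P" if "g \<in> P" "h \<in> P" for g h
    using that unfolding P_def by (auto intro: diff)
  have P_sum: "sum g I \<in> P" if "\<And>i. i \<in> I \<Longrightarrow> g i \<in> P" for g :: "nat \<Rightarrow> _" and I
    using that unfolding P_def
    by (induction I rule: infinite_finite_induct) (auto intro: add zero)
  have P_one: "1 \<in> P"
    unfolding P_def by (auto simp: coeff_1 zero one)
  have P_prod: "prod g I \<in> P" if "\<And>i. i \<in> I \<Longrightarrow> g i \<in> P" for g :: "nat \<Rightarrow> _" and I
    using that by (induction I rule: infinite_finite_induct) (auto intro: P_mult P_one)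
  have P_power: "g ^ k \<in> P" if "g \<in> P" for g k
    using that by (induction k) (auto intro: P_mult P_one)
  have T: "outer_T \<in> P"
    unfolding P_def outer_T_def by (auto simp: coeff_pCons zero one split: nat.splits)
  have t: "inner_t ^ CARD('f) \<in> P"
  proof -
    have "inner_t ^ CARD('f) = [:[:0, 1:] ^ CARD('f) :: 'f poly:]"
      by (simp add: inner_t_def poly_const_pow)
    moreover have "[:0, 1:] ^ CARD('f) \<in> R"
      unfolding R_def by blast
    ultimately show ?thesis
      unfolding P_def by (auto simp: coeff_pCons zero split: nat.splits)
  qed
  have t': "inner_t ^ (CARD('f) ^ j) \<in> P" if "j \<ge> 1" for j
  proof -
    obtain k where "j = Suc k"
      using \<open>j \<ge> 1\<close> by (cases j) auto
    thus ?thesis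
      using P_power[OF t, of "CARD('f) ^ k"] by (simp add: power_mult)
  qed
  have const: "subst_T a \<in> P" for a
  proof -
    have "[:c:] \<in> R" for c :: 'f
      unfolding R_def by (rule image_eqI[of _ _ "[:c:]"]) (simp_all add: poly_const_pow finite_field_power_CARD)
    thus ?thesis
      unfolding P_def subst_T_def by (auto simp: coeff_map_poly)
  qed
  have "H_numerator i \<in> P" for i
    unfolding H_numerator_def by (intro P_prod P_diff P_power T t') simp
  hence "H_rec n \<in> P" for n
  proof (induction n rule: less_induct)
    case (less n)
    thus ?case
      by (cases "n = 0") (auto simp: P_one H_rec_pos intro!: P_sum P_mult const)
  qed
  thus ?thesis
    by (simp add: P_def R_def)
qed


section \<open>The values of the twists of \<open>H\<^sub>n\<close> at \<open>T = t\<close>\<close>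

context C_infinity
begin

text \<open>
  The substitution \<open>T = t\<close> in the \<open>d\<close>-th twist of \<open>h\<close>.
\<close>

definition twisted_value :: "nat \<Rightarrow> 'f poly poly \<Rightarrow> 'c" where
  "twisted_value d h = poly (map_poly (\<lambda>a. A_emb emb a ^ (CARD('f) ^ d)) h) \<theta>"

lemma comm_ring_hom_twisted_value: "comm_ring_hom (twisted_value d)"
proof -
  interpret F: comm_ring_hom "\<lambda>a. A_emb emb a ^ (CARD('f) ^ d)"
    by standard (simp_all add: A_emb.hom_add A_emb.hom_mult frob_add power_mult_distrib)
  interpret map_poly_comm_ring_hom "\<lambda>a. A_emb emb a ^ (CARD('f) ^ d)" ..
  show ?thesis
    by standard (simp_all add: twisted_value_def hom_add hom_mult)
qed

lemma twisted_value_T: "twisted_value d outer_T = \<theta>"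
  by (simp add: twisted_value_def outer_T_def map_poly_pCons)

lemma twisted_value_t: "twisted_value d inner_t = \<theta> ^ (CARD('f) ^ d)"
  by (simp add: twisted_value_def inner_t_def map_poly_pCons)

lemma twisted_value_subst_T: "twisted_value d (subst_T a) = A_emb emb a"
proof -
  have "map_poly (\<lambda>a. A_emb emb a ^ (CARD('f) ^ d)) (subst_T a) = map_poly const a"
    by (rule poly_eqI) (simp add: subst_T_def coeff_map_poly)
  thus ?thesis
    by (simp add: twisted_value_def A_emb_altdef)
qed

lemma twisted_value_H_numerator:
  "twisted_value d (H_numerator i) =
     (if i \<le> d then ell d ^ (CARD('f) ^ i) / ell (d - i) ^ (CARD('f) ^ i) else 0)"
proof -
  interpret tv: comm_ring_hom "twisted_value d"
    by (rule comm_ring_hom_twisted_value)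
  let ?g = "\<lambda>k. \<theta> ^ (CARD('f) ^ i) - \<theta> ^ (CARD('f) ^ (i + k))"
  have eq: "twisted_value d (H_numerator i) =
      (\<Prod>j=1..i. \<theta> ^ (CARD('f) ^ i) - \<theta> ^ (CARD('f) ^ (d + j)))"
    by (simp add: H_numerator_def tv.hom_prod tv.hom_minus tv.hom_power twisted_value_T
        twisted_value_t power_add flip: power_mult)
  show ?thesis
  proof (cases "i \<le> d")
    case True
    have "ell d ^ (CARD('f) ^ i) = prod ?g {1..(d - i) + i}"
      using True by (simp add: ell_frob)
    also have "\<dots> = ell (d - i) ^ (CARD('f) ^ i) * prod ?g {(d - i) + 1..(d - i) + i}"
      by (subst prod.ub_add_nat) (simp_all add: ell_frob)
    also have "prod ?g {(d - i) + 1..(d - i) + i} =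
        (\<Prod>j=1..i. \<theta> ^ (CARD('f) ^ i) - \<theta> ^ (CARD('f) ^ (d + j)))"
      by (rule prod.reindex_bij_witness[of _ "\<lambda>j. j + (d - i)" "\<lambda>k. k - (d - i)"])
         (use True in \<open>auto simp: add_ac\<close>)
    finally show ?thesis
      using True by (simp add: eq)
  next
    case False
    hence "(\<Prod>j=1..i. \<theta> ^ (CARD('f) ^ i) - \<theta> ^ (CARD('f) ^ (d + j))) = 0"
      by (intro prod_zero bexI[of _ "i - d"]) auto
    thus ?thesis
      using False by (simp add: eq)
  qed
qed

text \<open>
  Both sides satisfy the same recursion, because twisting \<open>d\<close> times and putting \<open>T = t\<close> turns the
  series inverted in the definition of the \<open>H\<^sub>n\<close> into \<open>1 - carlitz_E d (ell d * x)\<close>: the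
  coefficients of \<open>x^(q^i)\<close> with \<open>i > d\<close> vanish.
\<close>

theorem twisted_value_H:
  "twisted_value d (H_rec n) = A_emb emb (carlitz_gamma (Suc n)) * ell d ^ Suc n * power_sum emb d (Suc n)"
proof (induction n rule: less_induct)
  case (less n)
  interpret tv: comm_ring_hom "twisted_value d"
    by (rule comm_ring_hom_twisted_value)
  let ?q = "CARD('f)"
  show ?case
  proof (cases "n = 0")
    case True
    thus ?thesis
      using power_sum_recursion[of d 0] by simp
  next
    case False
    have "twisted_value d (H_rec n) = (\<Sum>i | ?q ^ i \<le> n.
        twisted_value d (H_numerator i) * A_emb emb (gamma_quot n i) * twisted_value d (H_rec (n - ?q ^ i)))"
      using False by (simp add: H_rec_pos tv.hom_sum tv.hom_mult twisted_value_subst_T)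
    also have "\<dots> = (\<Sum>i | i \<le> d \<and> ?q ^ i \<le> n.
        twisted_value d (H_numerator i) * A_emb emb (gamma_quot n i) * twisted_value d (H_rec (n - ?q ^ i)))"
      by (intro sum.mono_neutral_right finite_power_le) (auto simp: twisted_value_H_numerator)
    also have "\<dots> = (\<Sum>i | i \<le> d \<and> ?q ^ i \<le> n. A_emb emb (carlitz_gamma (Suc n)) * ell d ^ Suc n *
        (carlitz_coeff d i * power_sum emb d (Suc (n - ?q ^ i))))"
    proof (intro sum.cong refl)
      fix i assume "i \<in> {i. i \<le> d \<and> ?q ^ i \<le> n}"
      hence i: "i \<le> d" "?q ^ i \<le> n"
        by auto
      have "n - ?q ^ i < n"
        using False by simp
      have pow: "ell d ^ Suc n = ell d ^ (?q ^ i) * ell d ^ Suc (n - ?q ^ i)"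
        using i(2) by (simp flip: power_add)
      have cancel: "a / b * g * (c * e * s) = g * (x * c) * (a * e) * (inverse x * inverse b * s)"
        if "x \<noteq> 0" for a b c e g s x :: 'c
        using that by (simp add: divide_inverse mult_ac)
      show "twisted_value d (H_numerator i) * A_emb emb (gamma_quot n i) * twisted_value d (H_rec (n - ?q ^ i))
          = A_emb emb (carlitz_gamma (Suc n)) * ell d ^ Suc n *
            (carlitz_coeff d i * power_sum emb d (Suc (n - ?q ^ i)))"
        unfolding less.IH[OF \<open>n - ?q ^ i < n\<close>] pow gamma_quot[OF i(2)] twisted_value_H_numerator
        unfolding carlitz_coeff_def A_emb.hom_mult inverse_mult_distrib if_P[OF i(1)]
        by (rule cancel) simp
    qed
    also have "\<dots> = A_emb emb (carlitz_gamma (Suc n)) * ell d ^ Suc n * power_sum emb d (Suc n)"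
      using False by (simp add: power_sum_recursion[of d n] sum_distrib_left)
    finally show ?thesis .
  qed
qed

lemma AT_H_emb_altdef: "AT_H_emb emb n = map_poly (A_emb emb) (H_rec n)"
  by (simp add: AT_H_emb_def AT_H_eq_H_rec)

lemma fps_value_tw_AT_H_emb:
  "fps_value (tw d (fps_of_poly (AT_H_emb emb n))) \<theta> =
     A_emb emb (carlitz_gamma (Suc n)) * ell d ^ Suc n * power_sum emb d (Suc n)"
proof -
  have "tw d (fps_of_poly (AT_H_emb emb n)) =
      fps_of_poly (map_poly (\<lambda>a. A_emb emb a ^ (CARD('f) ^ d)) (H_rec n))"
    by (rule fps_ext) (simp add: AT_H_emb_altdef coeff_map_poly)
  thus ?thesis
    by (simp add: twisted_value_H flip: twisted_value_def)
qed

lemma frob_root_coeff_AT_H_emb: "frob_root (coeff (AT_H_emb emb n) i) \<in> range (A_emb emb)"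
proof -
  obtain b :: "'f poly" where "coeff (H_rec n) i = b ^ CARD('f)"
    using coeff_H_rec_power[of n i] by auto
  hence "frob_root (coeff (AT_H_emb emb n) i) = A_emb emb b"
    by (simp add: AT_H_emb_altdef A_emb.hom_power)
  thus ?thesis by simp
qed

text \<open>As \<open>\<bar>t\<bar> = \<bar>t_tilde\<bar>^(q - 1)\<close>, this says that \<open>H\<^sub>n\<close> has degree at most \<open>n q / (q - 1)\<close> in \<open>t\<close>.\<close>

lemma gauss_le_AT_H_emb:
  "gauss_le 1 (absv (t_tilde emb) ^ (CARD('f) * n)) (fps_of_poly (AT_H_emb emb n))"
proof -
  interpret map_poly_comm_ring_hom "A_emb emb" ..
  define E where "E = (\<lambda>h. fps_of_poly (map_poly (A_emb emb) h))"
  interpret E: comm_ring_hom E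
    by standard (simp_all add: E_def hom_add hom_mult fps_of_poly_add fps_of_poly_mult)
  let ?q = "CARD('f)" and ?B = "absv (t_tilde emb)"
  have B: "?B \<ge> 1"
    using absv_t_tilde by simp
  have num: "gauss_le 1 (?B ^ (?q * ?q ^ i)) (E (H_numerator i))" for i
  proof -
    have "gauss_le 1 (absv \<theta> ^ (?q ^ j)) (E (outer_T ^ (?q ^ i) - inner_t ^ (?q ^ j)))" for j
    proof -
      have T: "E outer_T = fps_X"
        by (rule fps_ext) (simp add: E_def outer_T_def map_poly_pCons coeff_pCons fps_X_def split: nat.splits)
      have t: "E inner_t = fps_const \<theta>"
        by (rule fps_ext) (simp add: E_def inner_t_def map_poly_pCons coeff_pCons split: nat.splits)
      have "gauss_le 1 (absv \<theta> ^ (?q ^ j)) (fps_X ^ (?q ^ i))"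
        using gauss_le_power[OF gauss_le_X[of 1], of "?q ^ i"] absv_\<theta>_gt_1
        by (auto elim!: gauss_le_mono simp: one_le_power)
      moreover have "gauss_le 1 (absv \<theta> ^ (?q ^ j)) (fps_const \<theta> ^ (?q ^ j))"
        by (intro gauss_le_power gauss_le_const) auto
      ultimately show ?thesis
        unfolding E.hom_minus E.hom_power T t by (rule gauss_le_diff) simp
    qed
    hence "gauss_le 1 (\<Prod>j=1..i. absv \<theta> ^ (?q ^ j)) (E (H_numerator i))"
      unfolding H_numerator_def E.hom_prod by (intro gauss_le_prod) auto
    moreover have "(\<Prod>j=1..i. absv \<theta> ^ (?q ^ j)) \<le> ?B ^ (?q * ?q ^ i)"
    proof -
      have "p * (\<Sum>j=1..i. Suc p ^ j) + Suc p = Suc p * Suc p ^ i" for p :: nat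
        by (induction i) (simp_all add: algebra_simps)
      from this[of "?q - 1"] have "(?q - 1) * (\<Sum>j=1..i. ?q ^ j) \<le> ?q * ?q ^ i"
        by simp
      thus ?thesis
        using B by (simp add: absv_\<theta> power_increasing sum_distrib_left flip: power_mult power_sum)
    qed
    ultimately show ?thesis
      by (rule gauss_le_mono)
  qed
  have const: "gauss_le 1 1 (E (subst_T a))" for a
    by (auto simp: gauss_le_def E_def subst_T_def coeff_map_poly absv_const_le)
  have "gauss_le 1 (?B ^ (?q * n)) (E (H_rec n))"
  proof (induction n rule: less_induct)
    case (less n)
    show ?case
    proof (cases "n = 0")
      case False
      have "gauss_le 1 (?B ^ (?q * n)) (E (H_numerator i * subst_T (gamma_quot n i) * H_rec (n - ?q ^ i)))"
        if "?q ^ i \<le> n" for i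
      proof -
        have "n - ?q ^ i < n"
          using False by simp
        from gauss_le_mult[OF gauss_le_mult[OF num const] less.IH[OF this]]
        have "gauss_le 1 (?B ^ (?q * ?q ^ i + ?q * (n - ?q ^ i)))
            (E (H_numerator i * subst_T (gamma_quot n i) * H_rec (n - ?q ^ i)))"
          by (simp add: E.hom_mult power_add)
        moreover have "?q * ?q ^ i + ?q * (n - ?q ^ i) = ?q * n"
          using that by (simp flip: add_mult_distrib2)
        ultimately show ?thesis
          by simp
      qed
      thus ?thesis
        using False by (auto simp: H_rec_pos E.hom_sum intro!: gauss_le_sum)
    qed (simp add: gauss_le_1)
  qed
  thus ?thesis
    by (simp add: E_def AT_H_emb_altdef)
qed

end


section \<open>The function \<open>\<Omega>\<close>\<close>

lemma gauss_le_limit: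
  assumes "converges_to F f" "\<And>N. gauss_le R M (F N)" "R > 0"
  shows "gauss_le R M f"
  unfolding gauss_le_def
proof
  fix n
  have pos: "R ^ n > 0"
    using assms(3) by simp
  have "absv (fps_nth (F N) n) \<le> M / R ^ n" for N
    using assms(2)[of N] pos by (simp add: gauss_le_def field_simps)
  hence "absv (fps_nth f n) \<le> M / R ^ n"
    by (intro absv_limit_le[OF converges_to_nth[OF assms(1)]]) simp
  thus "absv (fps_nth f n) * R ^ n \<le> M"
    using pos by (simp add: field_simps)
qed

text \<open>
  The recursion for the coefficients of the inverse series preserves the bound, by the ultrametric
  inequality. In this way \<open>1 / \<Omega>\<close> converges on a disk without reference to the zeros of \<open>\<Omega>\<close>.
\<close>

lemma gauss_le_inverse:
  assumes f: "gauss_le R (absv (fps_nth f 0)) f" and nz: "fps_nth f 0 \<noteq> 0" and R: "R > 0"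
  shows "gauss_le R (inverse (absv (fps_nth f 0))) (inverse f)"
proof -
  define g where "g = inverse f"
  have "absv (fps_nth g n) * R ^ n \<le> inverse (absv (fps_nth f 0))" for n
  proof (induction n rule: less_induct)
    case (less n)
    show ?case
    proof (cases "n = 0")
      case True
      thus ?thesis
        by (simp add: g_def absv_inverse)
    next
      case False
      have "f * g = 1"
        unfolding g_def by (rule inverse_mult_eq_1'[OF nz])
      hence "(\<Sum>i=0..n. fps_nth f i * fps_nth g (n - i)) = 0"
        using False by (metis fps_mult_nth fps_one_nth)
      hence eq: "fps_nth f 0 * fps_nth g n = - (\<Sum>i=1..n. fps_nth f i * fps_nth g (n - i))"
        by (simp add: sum.atLeast_Suc_atMost eq_neg_iff_add_eq_0)
      have "absv (\<Sum>i=1..n. fps_nth f i * fps_nth g (n - i)) \<le> 1 / R ^ n"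
      proof (rule absv_sum_le)
        fix i assume i: "i \<in> {1..n}"
        have "absv (fps_nth f i * fps_nth g (n - i)) * R ^ n =
            (absv (fps_nth f i) * R ^ i) * (absv (fps_nth g (n - i)) * R ^ (n - i))"
          using i by (simp add: absv_mult flip: power_add)
        also have "\<dots> \<le> absv (fps_nth f 0) * inverse (absv (fps_nth f 0))"
          using i f R less.IH[of "n - i"] by (intro mult_mono) (auto simp: gauss_le_def)
        finally show "absv (fps_nth f i * fps_nth g (n - i)) \<le> 1 / R ^ n"
          using nz R by (simp add: field_simps)
      qed (use R in simp)
      hence "absv (fps_nth f 0) * absv (fps_nth g n) \<le> 1 / R ^ n"
        by (simp add: eq flip: absv_mult)
      thus ?thesis
        using nz R by (simp add: field_simps)
    qed
  qed
  thus ?thesis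
    by (simp add: gauss_le_def g_def)
qed

context C_infinity
begin

lemma \<theta>_power_unbounded: "\<forall>\<^sub>F i in sequentially. x \<le> absv \<theta> ^ (CARD('f) ^ i)"
proof -
  obtain n where n: "x < absv \<theta> ^ n"
    using real_arch_pow[OF absv_\<theta>_gt_1] by blast
  have "x \<le> absv \<theta> ^ (CARD('f) ^ i)" if "i \<ge> n" for i
  proof -
    have "n \<le> i"
      by (fact that)
    also have "i < CARD('f) ^ i"
      using CARD_ge_2[where 'a = 'f] by (intro power_gt_expt) simp
    finally have "absv \<theta> ^ n \<le> absv \<theta> ^ (CARD('f) ^ i)"
      using absv_\<theta>_gt_1 by (intro power_increasing) auto
    with n show ?thesis by simp
  qed
  thus ?thesis
    unfolding eventually_sequentially by blast
qed

definition Omega_factor :: "nat \<Rightarrow> 'c fps" where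
  "Omega_factor i = 1 - fps_const (inverse (\<theta> ^ (CARD('f) ^ i))) * fps_X"

definition Omega_part :: "nat \<Rightarrow> 'c fps" where
  "Omega_part N = fps_const (inverse (t_tilde emb ^ CARD('f))) * (\<Prod>i=1..N. Omega_factor i)"

lemma entire_X: "entire fps_X"
  using entire_fps_of_poly[of "[:0, 1:]"]
  by (simp add: fps_of_poly_pCons)

lemma gauss_le_Omega_factor_step:
  assumes "R \<ge> 0"
  shows "gauss_le R (R / absv \<theta> ^ (CARD('f) ^ i)) (fps_const (inverse (\<theta> ^ (CARD('f) ^ i))) * fps_X)"
  using gauss_le_mult[OF gauss_le_const gauss_le_X[OF assms] assms, of "inverse (\<theta> ^ (CARD('f) ^ i))"]
  by (simp add: absv_inverse absv_power divide_inverse mult.commute)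

lemma gauss_le_Omega_factor:
  assumes "R \<ge> 0" "R \<le> absv \<theta> ^ (CARD('f) ^ i)"
  shows "gauss_le R 1 (Omega_factor i)"
proof -
  have "R / absv \<theta> ^ (CARD('f) ^ i) \<le> 1"
    using assms(2) by simp
  from gauss_le_mono[OF gauss_le_Omega_factor_step[OF assms(1)] this] show ?thesis
    unfolding Omega_factor_def by (intro gauss_le_diff gauss_le_1 assms)
qed

lemma entire_Omega_part: "entire (Omega_part N)"
  unfolding Omega_part_def Omega_factor_def
  by (intro entire_mult entire_prod entire_diff entire_const entire_X entire_1)

lemma Omega_part_Suc: "Omega_part (Suc N) = Omega_part N * Omega_factor (Suc N)"
  by (simp add: Omega_part_def mult.assoc)

lemma Omega_part_converges: "converges_to Omega_part (Omega emb)"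
proof -
  have "converges_to Omega_part (Abs_fps (\<lambda>n. lim (\<lambda>N. fps_nth (Omega_part N) n)))"
  proof (rule converges_to_if_steps_null)
    fix R e :: real assume R: "R \<ge> 1" and e: "e > 0"
    obtain N0 where N0: "\<And>i. i \<ge> N0 \<Longrightarrow> R \<le> absv \<theta> ^ (CARD('f) ^ i)"
      using \<theta>_power_unbounded[of R] by (auto simp: eventually_sequentially)
    obtain M where M: "M \<ge> 1" "gauss_le R M (Omega_part N0)"
      using entireE[OF entire_Omega_part R] .
    have bound: "gauss_le R M (Omega_part N)" if "N \<ge> N0" for N
      using that
    proof (induction N rule: dec_induct)
      case (step N)
      have "gauss_le R (M * 1) (Omega_part N * Omega_factor (Suc N))"
        using R step N0[of "Suc N"] by (intro gauss_le_mult gauss_le_Omega_factor) auto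
      thus ?case
        by (simp add: Omega_part_Suc)
    qed (rule M)
    have "\<forall>\<^sub>F N in sequentially. M * R / e \<le> absv \<theta> ^ (CARD('f) ^ Suc N)"
      using \<theta>_power_unbounded[of "M * R / e"] by (rule eventually_sequentially_Suc[THEN iffD2])
    moreover have "\<forall>\<^sub>F N in sequentially. N \<ge> N0"
      by (rule eventually_ge_at_top)
    ultimately show "\<forall>\<^sub>F N in sequentially. gauss_le R e (Omega_part (Suc N) - Omega_part N)"
    proof eventually_elim
      case (elim N)
      let ?c = "absv \<theta> ^ (CARD('f) ^ Suc N)"
      have "gauss_le R (M * (R / ?c))
          (Omega_part N * (fps_const (inverse (\<theta> ^ (CARD('f) ^ Suc N))) * fps_X))"
        using R elim bound by (intro gauss_le_mult gauss_le_Omega_factor_step) auto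
      moreover have "M * (R / ?c) \<le> e"
        using elim(1) e absv_\<theta>_gt_1 by (simp add: field_simps)
      moreover have "Omega_part (Suc N) - Omega_part N =
          - (Omega_part N * (fps_const (inverse (\<theta> ^ (CARD('f) ^ Suc N))) * fps_X))"
        by (simp add: Omega_part_Suc Omega_factor_def right_diff_distrib)
      ultimately show ?case
        by (metis gauss_le_mono gauss_le_uminus)
    qed
  qed
  thus ?thesis
    by (simp add: Omega_def Omega_part_def Omega_factor_def)
qed

lemma entire_Omega: "entire (Omega emb)"
  by (rule entire_limit[OF entire_Omega_part Omega_part_converges])

text \<open>
  On the disk of radius \<open>\<bar>t\<bar>^q\<close> the constant term dominates each factor \<open>1 - T / t^(q^i)\<close>.
\<close>

lemma gauss_le_Omega:
  "gauss_le (absv \<theta> ^ CARD('f)) (inverse (absv (t_tilde emb) ^ CARD('f))) (Omega emb)"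
proof (rule gauss_le_limit[OF Omega_part_converges])
  fix N
  have "gauss_le (absv \<theta> ^ CARD('f)) (absv (inverse (t_tilde emb ^ CARD('f))) * (\<Prod>i=1..N. 1)) (Omega_part N)"
    unfolding Omega_part_def
  proof (intro gauss_le_mult gauss_le_const gauss_le_prod gauss_le_Omega_factor)
    fix i assume "i \<in> {1..N}"
    hence "CARD('f) ^ 1 \<le> CARD('f) ^ i"
      by (intro power_increasing) auto
    thus "absv \<theta> ^ CARD('f) \<le> absv \<theta> ^ (CARD('f) ^ i)"
      using absv_\<theta>_gt_1 by (intro power_increasing) auto
  qed auto
  thus "gauss_le (absv \<theta> ^ CARD('f)) (inverse (absv (t_tilde emb) ^ CARD('f))) (Omega_part N)"
    by (simp add: absv_inverse absv_power)
qed (use absv_\<theta>_gt_1 in simp)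

lemma Omega_nth_0: "fps_nth (Omega emb) 0 = inverse (t_tilde emb ^ CARD('f))"
proof -
  have "fps_nth (Omega_part N) 0 = inverse (t_tilde emb ^ CARD('f))" for N
    by (induction N) (simp_all add: Omega_part_Suc Omega_factor_def, simp add: Omega_part_def)
  with converges_to_nth[OF Omega_part_converges, of 0] show ?thesis
    by (simp add: LIMSEQ_const_iff)
qed

lemma Omega_nth_0_neq_0: "fps_nth (Omega emb) 0 \<noteq> 0"
  by (simp add: Omega_nth_0)

lemma gauss_le_Omega': "gauss_le (absv \<theta> ^ CARD('f)) (absv (fps_nth (Omega emb) 0)) (Omega emb)"
  using gauss_le_Omega by (simp add: Omega_nth_0 absv_inverse absv_power)

lemma inverse_Omega_converges:
  assumes f: "entire f" and z: "dist z 0 \<le> 1"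
  shows "fps_converges_at (inverse (Omega emb) ^ n * f) z"
proof -
  have pos: "absv \<theta> ^ CARD('f) > 1"
    using absv_\<theta>_gt_1 by (intro one_less_power) auto
  obtain M where "gauss_le (absv \<theta> ^ CARD('f)) M f"
    using entireE[OF f less_imp_le[OF pos]] .
  moreover have "gauss_le (absv \<theta> ^ CARD('f)) (inverse (absv (fps_nth (Omega emb) 0)) ^ n)
      (inverse (Omega emb) ^ n)"
    using pos by (intro gauss_le_power gauss_le_inverse[OF gauss_le_Omega' Omega_nth_0_neq_0]) auto
  ultimately have "gauss_le (absv \<theta> ^ CARD('f)) (inverse (absv (fps_nth (Omega emb) 0)) ^ n * M)
      (inverse (Omega emb) ^ n * f)"
    using pos by (intro gauss_le_mult) auto
  moreover have "absv z < absv \<theta> ^ CARD('f)"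
    using z pos by (simp add: absv_def)
  ultimately show ?thesis
    by (rule fps_converges_at_if_gauss_le)
qed

text \<open>The sign and the exponent in \<open>t = - t_tilde ^ (q - 1)\<close> make the factor exactly \<open>T - t^q\<close>.\<close>

lemma Omega_part_tw:
  "Omega_part (Suc N) = (fps_X - fps_const (\<theta> ^ CARD('f))) * tw 1 (Omega_part N)"
proof -
  let ?q = "CARD('f)" and ?\<tau> = "t_tilde emb"
  have factor: "tw (Suc 0) (Omega_factor i) = Omega_factor (Suc i)" for i
    by (simp add: Omega_factor_def tw.hom_minus tw.hom_mult tw_const tw_X power_inverse
        mult.commute[of "CARD('f)"] flip: power_mult)
  have "\<theta> ^ ?q = - ((?\<tau> ^ (?q - 1)) ^ ?q)"
    using frob_uminus[of "?\<tau> ^ (?q - 1)" 1] by (simp add: t_elt_def)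
  also have "\<dots> = - (?\<tau> ^ ((?q - 1) * ?q))"
    by (simp add: power_mult)
  finally have "\<theta> ^ ?q * ?\<tau> ^ ?q = - (?\<tau> ^ ((?q - 1) * ?q + ?q))"
    by (simp add: power_add)
  also have "(?q - 1) * ?q + ?q = ?q * ?q"
    by (simp add: diff_mult_distrib)
  finally have "\<theta> ^ ?q * ?\<tau> ^ ?q = - (?\<tau> ^ (?q * ?q))" .
  hence c: "inverse (?\<tau> ^ (?q * ?q)) = - inverse (?\<tau> ^ ?q) * inverse (\<theta> ^ ?q)"
    by (metis inverse_minus_eq inverse_mult_distrib minus_equation_iff mult.commute mult_minus_left)
  have "(fps_X - fps_const (\<theta> ^ ?q)) * fps_const (inverse (?\<tau> ^ (?q * ?q)))
      = fps_const (inverse (?\<tau> ^ ?q)) * Omega_factor 1"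
    unfolding c Omega_factor_def by (rule fps_ext) (auto simp: algebra_simps fps_X_def)
  moreover have "(\<Prod>i=1..Suc N. Omega_factor i) = Omega_factor 1 * (\<Prod>i=1..N. Omega_factor (Suc i))"
    by (subst prod.atLeast_Suc_atMost, simp, simp only: prod.shift_bounds_cl_Suc_ivl)
  moreover have "tw 1 (Omega_part N) = fps_const (inverse (?\<tau> ^ (?q * ?q))) * (\<Prod>i=1..N. Omega_factor (Suc i))"
    by (simp add: Omega_part_def tw.hom_mult tw.hom_prod tw_const factor power_inverse flip: power_mult)
  ultimately show ?thesis
    by (simp add: Omega_part_def flip: mult.assoc)
qed

lemma Omega_tw: "Omega emb = (fps_X - fps_const (\<theta> ^ CARD('f))) * tw 1 (Omega emb)"
proof (rule converges_to_unique)
  show "converges_to (\<lambda>N. Omega_part (Suc N)) (Omega emb)"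
    by (rule converges_to_Suc[OF Omega_part_converges])
  show "converges_to (\<lambda>N. Omega_part (Suc N)) ((fps_X - fps_const (\<theta> ^ CARD('f))) * tw 1 (Omega emb))"
    unfolding Omega_part_tw
    by (intro converges_to_mult converges_to_const converges_to_tw Omega_part_converges entire_tw
        entire_Omega entire_diff entire_X entire_const)
qed

lemma untw_Omega: "untw (Omega emb) = (fps_X - fps_const \<theta>) * Omega emb"
proof -
  have "tw 1 ((fps_X - fps_const \<theta>) * Omega emb) = Omega emb"
    using Omega_tw[symmetric] by (simp add: tw.hom_mult tw.hom_minus tw_const tw_X)
  thus ?thesis
    by (metis untw_tw)
qed

lemma Omega_tw_iterate: "Omega emb = (\<Prod>k=1..d. fps_X - fps_const (\<theta> ^ (CARD('f) ^ k))) * tw d (Omega emb)"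
proof (induction d)
  case (Suc d)
  have "tw d (Omega emb) = tw d ((fps_X - fps_const (\<theta> ^ CARD('f))) * tw 1 (Omega emb))"
    using Omega_tw by (rule arg_cong)
  also have "\<dots> = (fps_X - fps_const (\<theta> ^ (CARD('f) ^ Suc d))) * tw (Suc d) (Omega emb)"
    by (simp only: tw.hom_mult tw.hom_minus tw_const tw_X tw_tw Suc_eq_plus1 power_Suc power_mult [symmetric]
        power_add power_one_right mult.commute[of "CARD('f)"])
  finally have "tw d (Omega emb) =
      (fps_X - fps_const (\<theta> ^ (CARD('f) ^ Suc d))) * tw (Suc d) (Omega emb)" .
  hence "(\<Prod>k=1..Suc d. fps_X - fps_const (\<theta> ^ (CARD('f) ^ k))) * tw (Suc d) (Omega emb) =
      (\<Prod>k=1..d. fps_X - fps_const (\<theta> ^ (CARD('f) ^ k))) * tw d (Omega emb)"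
    by (simp add: mult.assoc)
  also have "\<dots> = Omega emb"
    by (rule Suc.IH [symmetric])
  finally show ?case
    by (rule sym)
qed simp

lemma fps_value_tw_Omega: "fps_value (Omega emb) \<theta> = ell d * fps_value (tw d (Omega emb)) \<theta>"
proof -
  have X: "fps_value fps_X \<theta> = \<theta>"
    using fps_value_fps_of_poly[of "[:0, 1:]" \<theta>] by (simp add: fps_of_poly_pCons)
  have "fps_value (Omega emb) \<theta> = fps_value (\<Prod>k=1..d. fps_X - fps_const (\<theta> ^ (CARD('f) ^ k))) \<theta>
      * fps_value (tw d (Omega emb)) \<theta>"
    by (rule trans[OF arg_cong[OF Omega_tw_iterate[of d], of "\<lambda>f. fps_value f \<theta>"] fps_value_mult])
       (intro entire_prod entire_diff entire_X entire_const entire_tw entire_Omega)+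
  also have "fps_value (\<Prod>k=1..d. fps_X - fps_const (\<theta> ^ (CARD('f) ^ k))) \<theta> = ell d"
    by (subst fps_value_prod) (simp_all add: ell_def fps_value_diff X entire_X entire_diff)
  finally show ?thesis .
qed

text \<open>
  As \<open>\<bar>t\<bar> < \<bar>t\<bar>^q\<close>, the constant coefficient of \<open>\<Omega>\<close> strictly dominates the other terms at \<open>T = t\<close>.
\<close>

lemma fps_value_Omega_neq_0: "fps_value (Omega emb) \<theta> \<noteq> 0"
proof
  assume zero: "fps_value (Omega emb) \<theta> = 0"
  let ?c = "fps_nth (Omega emb) 0"
  define g where "g = Omega emb - fps_const ?c"
  have "gauss_le (absv \<theta>) (absv ?c / absv \<theta>) g"
    unfolding gauss_le_def
  proof
    fix n
    show "absv (fps_nth g n) * absv \<theta> ^ n \<le> absv ?c / absv \<theta>"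
    proof (cases "n = 0")
      case False
      have "absv (fps_nth g n) * absv \<theta> ^ n * absv \<theta> = absv (fps_nth (Omega emb) n) * absv \<theta> ^ (n + 1)"
        using False by (simp add: g_def mult_ac)
      also have "\<dots> \<le> absv (fps_nth (Omega emb) n) * absv \<theta> ^ (CARD('f) * n)"
      proof (intro mult_left_mono power_increasing)
        have "n + 1 \<le> 2 * n"
          using False by simp
        also have "\<dots> \<le> CARD('f) * n"
          using CARD_ge_2[where 'a = 'f] by (intro mult_right_mono) auto
        finally show "n + 1 \<le> CARD('f) * n" .
      qed (use absv_\<theta>_gt_1 in auto)
      also have "\<dots> \<le> absv ?c"
        using gauss_le_Omega' by (simp add: gauss_le_def power_mult)
      finally show ?thesis
        using absv_\<theta>_gt_1 by (simp add: field_simps)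
    qed (simp add: g_def)
  qed
  hence "absv (fps_value g \<theta>) \<le> absv ?c / absv \<theta>"
    by (intro absv_fps_value_le[of g "absv \<theta>"]) (auto simp: g_def intro: entire_diff entire_Omega)
  hence "absv ?c \<le> absv ?c / absv \<theta>"
    using zero by (simp add: g_def fps_value_diff entire_Omega)
  moreover have "absv ?c / absv \<theta> < absv ?c"
    using absv_\<theta>_gt_1 Omega_nth_0_neq_0 by (simp add: field_simps)
  ultimately show False
    by linarith
qed

lemma fps_value_Omega: "fps_value (Omega emb) \<theta> = inverse (pi_tilde emb)"
  by (simp add: pi_tilde_def)

lemma pi_tilde_neq_0: "pi_tilde emb \<noteq> 0"
  using fps_value_Omega_neq_0 by (simp add: pi_tilde_def)

end


section \<open>Sums over decreasing tuples\<close>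

definition bounded_tuples :: "nat \<Rightarrow> nat \<Rightarrow> nat list set" where
  "bounded_tuples m N = {ds \<in> decreasing_tuples m. \<forall>d\<in>set ds. d < N}"

lemma bounded_tuples_subset: "bounded_tuples m N \<subseteq> decreasing_tuples m"
  by (auto simp: bounded_tuples_def)

lemma finite_bounded_tuples: "finite (bounded_tuples m N)"
proof (rule finite_subset)
  show "bounded_tuples m N \<subseteq> {ds. set ds \<subseteq> {..<N} \<and> length ds = m}"
    by (auto simp: bounded_tuples_def decreasing_tuples_def)
qed (simp add: finite_lists_length_eq)

lemma bounded_tuples_mono: "M \<le> N \<Longrightarrow> bounded_tuples m M \<subseteq> bounded_tuples m N"
  by (auto simp: bounded_tuples_def)

lemma bounded_tuples_0 [simp]: "bounded_tuples 0 N = {[]}"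
  by (auto simp: bounded_tuples_def decreasing_tuples_def)

lemma not_bounded_tuple:
  assumes "ds \<in> decreasing_tuples m - bounded_tuples m N"
  obtains l where "l < m" "ds ! l \<ge> N"
proof -
  obtain d where "d \<in> set ds" "d \<ge> N"
    using assms by (auto simp: bounded_tuples_def not_less)
  thus thesis
    using assms that by (auto simp: decreasing_tuples_def in_set_conv_nth)
qed

text \<open>A decreasing tuple either consists of positive entries or ends in its only zero.\<close>

lemma bounded_tuples_Suc_Suc:
  "bounded_tuples (Suc m) (Suc N) =
     map Suc ` bounded_tuples (Suc m) N \<union> (\<lambda>ds. map Suc ds @ [0]) ` bounded_tuples m N"
    (is "?L = ?A \<union> ?B")
proof
  show "?A \<union> ?B \<subseteq> ?L"
    by (auto simp: bounded_tuples_def decreasing_tuples_def sorted_wrt_map sorted_wrt_append)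
  have pred: "map Suc (map (\<lambda>x. x - 1) xs) = xs" if "\<forall>x\<in>set xs. x > 0" for xs :: "nat list"
    using that by (induction xs) auto
  have mem: "map (\<lambda>x. x - 1) xs \<in> bounded_tuples k N"
    if "\<forall>x\<in>set xs. 0 < x \<and> x < Suc N" "sorted_wrt (>) xs" "length xs = k" for xs :: "nat list" and k
  proof -
    have "sorted_wrt (>) (map Suc (map (\<lambda>x. x - 1) xs))"
      using that pred[of xs] by simp
    thus ?thesis
      using that by (auto simp: bounded_tuples_def decreasing_tuples_def sorted_wrt_map)
  qed
  show "?L \<subseteq> ?A \<union> ?B"
  proof
    fix ds assume ds: "ds \<in> ?L"
    then obtain es e where e: "ds = es @ [e]"
      by (cases ds rule: rev_cases) (auto simp: bounded_tuples_def decreasing_tuples_def)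
    hence es: "sorted_wrt (>) ds" "\<forall>x\<in>set es. e < x \<and> x < Suc N" "e < Suc N" "length es = m"
      using ds by (auto simp: bounded_tuples_def decreasing_tuples_def sorted_wrt_append)
    have es': "sorted_wrt (>) es" "\<forall>x\<in>set es. 0 < x \<and> x < Suc N"
      using es(1,2) e by (auto simp: sorted_wrt_append)
    show "ds \<in> ?A \<union> ?B"
    proof (cases "e = 0")
      case True
      have "ds = map Suc (map (\<lambda>x. x - 1) es) @ [0]"
        using es'(2) True e pred[of es] by simp
      thus ?thesis
        using mem[OF es'(2,1) es(4)] by blast
    next
      case False
      have pos: "\<forall>x\<in>set ds. 0 < x \<and> x < Suc N"
        using es es' e False by auto
      have "ds = map Suc (map (\<lambda>x. x - 1) ds)"
        using pos pred[of ds] by auto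
      moreover have "length ds = Suc m"
        using e es(4) by simp
      ultimately show ?thesis
        using mem[OF pos es(1), of "Suc m"] by blast
    qed
  qed
qed

definition tuple_term :: "(nat \<Rightarrow> nat \<Rightarrow> 'c::complete_ultrametric_field fps) \<Rightarrow> nat \<Rightarrow> nat list \<Rightarrow> 'c fps" where
  "tuple_term g m ds = (\<Prod>l<m. g l (ds ! l))"

definition tuple_sum :: "(nat \<Rightarrow> nat \<Rightarrow> 'c::complete_ultrametric_field fps) \<Rightarrow> nat \<Rightarrow> nat \<Rightarrow> 'c fps" where
  "tuple_sum g m N = (\<Sum>ds\<in>bounded_tuples m N. tuple_term g m ds)"

definition tuple_series :: "(nat \<Rightarrow> nat \<Rightarrow> 'c::complete_ultrametric_field fps) \<Rightarrow> nat \<Rightarrow> 'c fps" where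
  "tuple_series g m = Abs_fps (\<lambda>n. \<Sum>\<^sub>\<infinity>ds\<in>decreasing_tuples m. fps_nth (tuple_term g m ds) n)"

definition null_sequence :: "(nat \<Rightarrow> 'c::complete_ultrametric_field fps) \<Rightarrow> bool" where
  "null_sequence h \<longleftrightarrow> (\<forall>d. entire (h d)) \<and> converges_to h 0"

lemma null_sequence_bounded:
  assumes "null_sequence h" "R \<ge> 1"
  obtains C where "C \<ge> 1" "\<And>d. gauss_le R C (h d)"
proof -
  obtain D where D: "\<And>d. d \<ge> D \<Longrightarrow> gauss_le R 1 (h d)"
    using converges_toD[of h 0 R 1] assms by (auto simp: null_sequence_def eventually_sequentially)
  have "\<exists>C\<ge>1. \<forall>d<n. gauss_le R C (h d)" for n
  proof (induction n)
    case (Suc n)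
    then obtain C where C: "C \<ge> 1" "\<And>d. d < n \<Longrightarrow> gauss_le R C (h d)"
      by blast
    obtain M where M: "M \<ge> 1" "gauss_le R M (h n)"
      using entireE assms unfolding null_sequence_def by blast
    have "gauss_le R (max C M) (h d)" if "d < Suc n" for d
      using that C M gauss_le_mono[of R C "h d" "max C M"] gauss_le_mono[of R M "h n" "max C M"]
      by (cases "d = n") auto
    thus ?case
      using C(1) by (intro exI[of _ "max C M"]) auto
  qed auto
  then obtain C where C: "C \<ge> 1" "\<And>d. d < D \<Longrightarrow> gauss_le R C (h d)"
    by blast
  have "gauss_le R C (h d)" for d
    using C D[of d] gauss_le_mono[of R 1 "h d" C] by (cases "d < D") auto
  with C(1) show thesis
    by (rule that)
qed

lemma null_sequences_bounded:
  fixes g :: "nat \<Rightarrow> nat \<Rightarrow> 'c::complete_ultrametric_field fps"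
  assumes "\<forall>l<m. null_sequence (g l)" "R \<ge> 1"
  shows "\<exists>C\<ge>1. \<forall>l<m. \<forall>d. gauss_le R C (g l d)"
  using assms(1)
proof (induction m)
  case (Suc m)
  then obtain C where C: "C \<ge> 1" "\<And>l d. l < m \<Longrightarrow> gauss_le R C (g l d)"
    by auto
  have "null_sequence (g m)"
    using Suc.prems by simp
  then obtain M where M: "M \<ge> 1" "\<And>d. gauss_le R M (g m d)"
    using null_sequence_bounded[OF _ assms(2)] by blast
  have "gauss_le R (max C M) (g l d)" if "l < Suc m" for l d
    using that C(2)[of l d] M(2)[of d] gauss_le_mono[of R C "g l d" "max C M"]
      gauss_le_mono[of R M "g m d" "max C M"] by (cases "l = m") auto
  thus ?case
    using C(1) by (intro exI[of _ "max C M"]) auto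
qed auto

context
  fixes g :: "nat \<Rightarrow> nat \<Rightarrow> 'c::complete_ultrametric_field fps" and m :: nat
  assumes null: "\<And>l. l < m \<Longrightarrow> null_sequence (g l)"
begin

lemma entire_tuple_term: "entire (tuple_term g m ds)"
  unfolding tuple_term_def using null by (intro entire_prod) (auto simp: null_sequence_def)

lemma entire_tuple_sum: "entire (tuple_sum g m N)"
  unfolding tuple_sum_def by (intro entire_sum entire_tuple_term)

text \<open>
  Outside \<open>bounded_tuples m N\<close> some entry is at least \<open>N\<close>, so one factor of the product is small
  and the others are bounded.
\<close>

lemma tuple_term_small:
  assumes R: "R \<ge> 1" and e: "e > 0"
  shows "\<forall>\<^sub>F N in sequentially. \<forall>ds\<in>decreasing_tuples m - bounded_tuples m N.
    gauss_le R e (tuple_term g m ds)"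
proof -
  obtain C where C: "C \<ge> 1" "\<And>l d. l < m \<Longrightarrow> gauss_le R C (g l d)"
    using null_sequences_bounded[OF _ R, of m g] null by blast
  define e' where "e' = e / C ^ m"
  have e': "e' > 0"
    using e C(1) by (simp add: e'_def)
  have "\<forall>l\<in>{..<m}. \<forall>\<^sub>F d in sequentially. gauss_le R e' (g l d)"
    using null converges_toD[OF _ R e'] by (force simp: null_sequence_def)
  hence "\<forall>\<^sub>F d in sequentially. \<forall>l\<in>{..<m}. gauss_le R e' (g l d)"
    by (intro eventually_ball_finite) auto
  then obtain D where D: "\<And>d l. d \<ge> D \<Longrightarrow> l < m \<Longrightarrow> gauss_le R e' (g l d)"
    by (auto simp: eventually_sequentially)
  have "gauss_le R e (tuple_term g m ds)"
    if N: "N \<ge> D" and ds: "ds \<in> decreasing_tuples m - bounded_tuples m N" for N ds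
  proof -
    obtain l where l: "l < m" "ds ! l \<ge> N"
      using not_bounded_tuple[OF ds] .
    have "gauss_le R (\<Prod>k<m. if k = l then e' else C) (tuple_term g m ds)"
      unfolding tuple_term_def using l N R C(2) D by (intro gauss_le_prod) auto
    moreover have "(\<Prod>k<m. if k = l then e' else C) = e' * C ^ (m - 1)"
      using l by (simp add: prod.delta_remove)
    moreover have "e' * C ^ (m - 1) \<le> e' * C ^ m"
      using C(1) e' by (intro mult_left_mono power_increasing) auto
    moreover have "e' * C ^ m = e"
      using C(1) by (simp add: e'_def)
    ultimately show ?thesis
      by (metis gauss_le_mono)
  qed
  thus ?thesis
    unfolding eventually_sequentially by blast
qed

lemma tuple_sum_steps:
  assumes "R \<ge> 1" "e > 0"
  shows "\<forall>\<^sub>F N in sequentially. gauss_le R e (tuple_sum g m (Suc N) - tuple_sum g m N)"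
  using tuple_term_small[OF assms]
proof eventually_elim
  case (elim N)
  have "tuple_sum g m (Suc N) - tuple_sum g m N =
      (\<Sum>ds\<in>bounded_tuples m (Suc N) - bounded_tuples m N. tuple_term g m ds)"
    unfolding tuple_sum_def
    by (rule sum_diff [symmetric]) (simp_all add: finite_bounded_tuples bounded_tuples_mono)
  also have "gauss_le R e \<dots>"
    using elim assms bounded_tuples_subset[of m "Suc N"] by (intro gauss_le_sum) auto
  finally show ?case .
qed

lemma tuple_sum_converges: "converges_to (tuple_sum g m) (tuple_series g m)"
proof -
  define S where "S = Abs_fps (\<lambda>n. lim (\<lambda>N. fps_nth (tuple_sum g m N) n))"
  have S: "converges_to (tuple_sum g m) S"
    unfolding S_def by (rule converges_to_if_steps_null) (rule tuple_sum_steps)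
  have "((\<lambda>ds. fps_nth (tuple_term g m ds) n) has_sum fps_nth S n) (decreasing_tuples m)" for n
  proof (rule has_sum_exhaustion[where A = "bounded_tuples m"])
    show "\<forall>\<^sub>F N in sequentially. \<forall>ds\<in>decreasing_tuples m - bounded_tuples m N.
        absv (fps_nth (tuple_term g m ds) n) \<le> e" if "e > 0" for e
      using tuple_term_small[OF order_refl that] by (rule eventually_mono) (auto simp: gauss_le_def)
    show "(\<lambda>N. \<Sum>ds\<in>bounded_tuples m N. fps_nth (tuple_term g m ds) n) \<longlonglongrightarrow> fps_nth S n"
      using converges_to_nth[OF S, of n] by (simp add: tuple_sum_def fps_sum_nth)
  qed (simp_all add: finite_bounded_tuples bounded_tuples_subset)
  hence "tuple_series g m = S"
    by (intro fps_ext) (simp add: tuple_series_def infsumI)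
  with S show ?thesis
    by simp
qed

lemma entire_tuple_series: "entire (tuple_series g m)"
  by (rule entire_limit[OF entire_tuple_sum tuple_sum_converges])

lemma fps_value_tuple_series:
  "((\<lambda>ds. \<Prod>l<m. fps_value (g l (ds ! l)) z) has_sum fps_value (tuple_series g m) z) (decreasing_tuples m)"
proof (rule has_sum_exhaustion[where A = "bounded_tuples m"])
  have val: "fps_value (tuple_term g m ds) z = (\<Prod>l<m. fps_value (g l (ds ! l)) z)" for ds
    unfolding tuple_term_def using null by (intro fps_value_prod) (auto simp: null_sequence_def)
  fix e :: real assume e: "e > 0"
  have "\<forall>\<^sub>F N in sequentially. \<forall>ds\<in>decreasing_tuples m - bounded_tuples m N.
      gauss_le (max 1 (absv z)) e (tuple_term g m ds)"
    by (rule tuple_term_small) (use e in auto)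
  thus "\<forall>\<^sub>F N in sequentially. \<forall>ds\<in>decreasing_tuples m - bounded_tuples m N.
      absv (\<Prod>l<m. fps_value (g l (ds ! l)) z) \<le> e"
    by eventually_elim (metis absv_fps_value_le entire_tuple_term max.cobounded2 val)
next
  have val: "fps_value (tuple_term g m ds) z = (\<Prod>l<m. fps_value (g l (ds ! l)) z)" for ds
    unfolding tuple_term_def using null by (intro fps_value_prod) (auto simp: null_sequence_def)
  have "fps_value (tuple_sum g m N) z = (\<Sum>ds\<in>bounded_tuples m N. \<Prod>l<m. fps_value (g l (ds ! l)) z)" for N
    unfolding tuple_sum_def by (simp add: fps_value_sum entire_tuple_term val)
  with converges_to_value[OF entire_tuple_sum tuple_sum_converges, of z]
  show "(\<lambda>N. \<Sum>ds\<in>bounded_tuples m N. \<Prod>l<m. fps_value (g l (ds ! l)) z)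
      \<longlonglongrightarrow> fps_value (tuple_series g m) z"
    by simp
qed (simp_all add: finite_bounded_tuples bounded_tuples_subset)

end

lemma tuple_series_cong: "(\<And>l. l < m \<Longrightarrow> g l = h l) \<Longrightarrow> tuple_series g m = tuple_series h m"
  by (simp add: tuple_series_def tuple_term_def)

lemma tuple_series_0: "tuple_series g 0 = 1"
proof -
  have "converges_to (tuple_sum g 0) (tuple_series g 0)"
    by (rule tuple_sum_converges) simp
  moreover have "tuple_sum g 0 = (\<lambda>N. 1)"
    by (rule ext) (simp add: tuple_sum_def tuple_term_def)
  ultimately show ?thesis
    using converges_to_const converges_to_unique by metis
qed

context C_infinity
begin

text \<open>The second term on the right comes from the tuples whose last entry is zero.\<close>

lemma tuple_series_Suc:
  assumes null: "\<And>l. l < Suc m \<Longrightarrow> null_sequence (g l)"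
    and shift: "\<And>l d. l < Suc m \<Longrightarrow> g l (Suc d) = tw 1 (g l d)"
  shows "tuple_series g (Suc m) = tw 1 (tuple_series g (Suc m)) + tw 1 (tuple_series g m) * g m 0"
proof (rule converges_to_unique)
  show "converges_to (\<lambda>N. tuple_sum g (Suc m) (Suc N)) (tuple_series g (Suc m))"
    by (rule converges_to_Suc[OF tuple_sum_converges[OF null]])
  have "tuple_sum g (Suc m) (Suc N) = tw 1 (tuple_sum g (Suc m) N) + tw 1 (tuple_sum g m N) * g m 0" for N
  proof -
    have len: "length ds = k" if "ds \<in> bounded_tuples k N" for ds k
      using that by (auto simp: bounded_tuples_def decreasing_tuples_def)
    have 1: "tuple_term g (Suc m) (map Suc ds) = tw 1 (tuple_term g (Suc m) ds)"
      if "ds \<in> bounded_tuples (Suc m) N" for ds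
      using len[OF that] shift by (simp add: tuple_term_def tw.hom_prod tw.hom_mult)
    have 2: "tuple_term g (Suc m) (map Suc ds @ [0]) = tw 1 (tuple_term g m ds) * g m 0"
      if "ds \<in> bounded_tuples m N" for ds
      using len[OF that] shift by (simp add: tuple_term_def tw.hom_prod nth_append)
    have inj: "inj_on (map Suc) Y" "inj_on (\<lambda>ds. map Suc ds @ [0]) Y" for Y
      by (auto simp: inj_on_def)
    have disj: "map Suc ` Y \<inter> (\<lambda>ds. map Suc ds @ [0]) ` Z = {}" for Y Z
    proof -
      have "0 \<notin> set (map Suc ds)" for ds
        by auto
      moreover have "0 \<in> set (map Suc ds @ [0])" for ds
        by simp
      ultimately show ?thesis
        by (metis (no_types, lifting) disjoint_iff imageE)
    qed
    have "tuple_sum g (Suc m) (Suc N) =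
        (\<Sum>ds\<in>bounded_tuples (Suc m) N. tuple_term g (Suc m) (map Suc ds)) +
        (\<Sum>ds\<in>bounded_tuples m N. tuple_term g (Suc m) (map Suc ds @ [0]))"
      unfolding tuple_sum_def bounded_tuples_Suc_Suc
      by (simp add: sum.union_disjoint finite_bounded_tuples disj sum.reindex inj)
    thus ?thesis
      by (simp add: 1 2 tuple_sum_def tw.hom_sum sum_distrib_right)
  qed
  moreover have "converges_to (\<lambda>N. tw 1 (tuple_sum g (Suc m) N) + tw 1 (tuple_sum g m N) * g m 0)
      (tw 1 (tuple_series g (Suc m)) + tw 1 (tuple_series g m) * g m 0)"
    using null
    by (intro converges_to_add converges_to_mult converges_to_tw tuple_sum_converges converges_to_const
        entire_tw entire_tuple_series) (auto simp: null_sequence_def)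
  ultimately show "converges_to (\<lambda>N. tuple_sum g (Suc m) (Suc N))
      (tw 1 (tuple_series g (Suc m)) + tw 1 (tuple_series g m) * g m 0)"
    by simp
qed


section \<open>The series \<open>L\<close>\<close>

definition L_factor :: "nat \<Rightarrow> 'c fps" where
  "L_factor k = Omega emb ^ k * fps_of_poly (AT_H_emb emb (k - 1))"

lemma entire_L_factor: "entire (L_factor k)"
  unfolding L_factor_def by (intro entire_mult entire_power entire_Omega entire_fps_of_poly)

lemma gauss_le_poly_radius:
  assumes "gauss_le 1 M (fps_of_poly p)" "\<rho> \<ge> 1"
  shows "gauss_le \<rho> (M * \<rho> ^ degree p) (fps_of_poly p)"
  unfolding gauss_le_def
proof
  fix n
  show "absv (fps_nth (fps_of_poly p) n) * \<rho> ^ n \<le> M * \<rho> ^ degree p"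
  proof (cases "n \<le> degree p")
    case True
    thus ?thesis
      using assms gauss_le_nonneg[OF assms(1)]
      by (intro mult_mono power_increasing) (auto simp: gauss_le_def)
  next
    case False
    thus ?thesis
      using assms(2) gauss_le_nonneg[OF assms(1)] by (simp add: coeff_eq_0)
  qed
qed

text \<open>
  The degree bound for \<open>H\<^bsub>k-1\<^esub>\<close> makes the Gauss norm of \<open>L_factor k\<close> on the unit disk less than
  \<open>1\<close>, with some room left to enlarge the radius.
\<close>

lemma L_factor_small:
  assumes "k > 0"
  obtains \<rho> c where "\<rho> > 1" "0 \<le> c" "c < 1" "gauss_le \<rho> c (L_factor k)"
proof -
  let ?B = "absv (t_tilde emb)" and ?q = "CARD('f)" and ?H = "AT_H_emb emb (k - 1)"
  define \<rho> where "\<rho> = min (absv \<theta> ^ ?q) (root (Suc (degree ?H)) ?B)"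
  have B: "?B > 1"
    by (rule absv_t_tilde)
  \<comment> \<open>The root ensures \<open>\<rho> ^ degree ?H \<le> ?B\<close>, which costs one of the \<open>q\<close> powers of \<open>?B\<close> to spare.\<close>
  have \<rho>: "\<rho> > 1"
    unfolding \<rho>_def using absv_\<theta>_gt_1 B one_less_power[OF absv_\<theta>_gt_1, of ?q] by simp
  have "\<rho> ^ degree ?H \<le> \<rho> ^ Suc (degree ?H)"
    using \<rho> by (intro power_increasing) auto
  also have "\<dots> \<le> root (Suc (degree ?H)) ?B ^ Suc (degree ?H)"
    using \<rho> by (intro power_mono) (auto simp: \<rho>_def)
  also have "\<dots> = ?B"
    using B by (intro real_root_pow_pos2) auto
  finally have \<rho>_pow: "\<rho> ^ degree ?H \<le> ?B" .
  have "gauss_le \<rho> (inverse (?B ^ ?q) ^ k) (Omega emb ^ k)"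
    using \<rho> by (intro gauss_le_power gauss_le_radius_mono[OF gauss_le_Omega]) (auto simp: \<rho>_def)
  moreover have "gauss_le \<rho> (?B ^ (?q * (k - 1)) * ?B) (fps_of_poly ?H)"
    using gauss_le_poly_radius[OF gauss_le_AT_H_emb[of "k - 1"], of \<rho>] \<rho> \<rho>_pow B
    by (auto elim!: gauss_le_mono)
  ultimately have "gauss_le \<rho> (inverse (?B ^ ?q) ^ k * (?B ^ (?q * (k - 1)) * ?B)) (L_factor k)"
    unfolding L_factor_def using \<rho> by (intro gauss_le_mult) auto
  moreover have "inverse (?B ^ ?q) ^ k * (?B ^ (?q * (k - 1)) * ?B) < 1"
  proof -
    have "?B ^ (?q * (k - 1)) * ?B = ?B ^ (?q * (k - 1) + 1)"
      by simp
    also have "\<dots> < ?B ^ (?q * k)"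
    proof (rule power_strict_increasing[OF _ B])
      have "?q * k = ?q * (k - 1) + ?q"
        using assms by (cases k) auto
      thus "?q * (k - 1) + 1 < ?q * k"
        using CARD_ge_2[where 'a = 'f] by simp
    qed
    finally show ?thesis
      using B by (simp add: power_inverse field_simps flip: power_mult)
  qed
  moreover have "0 \<le> inverse (?B ^ ?q) ^ k * (?B ^ (?q * (k - 1)) * ?B)"
    by simp
  ultimately show thesis
    using \<rho> that by blast
qed

lemma null_sequence_tw_L_factor:
  assumes "k > 0"
  shows "null_sequence (\<lambda>d. tw d (L_factor k))"
  unfolding null_sequence_def converges_to_def
proof (intro conjI allI impI)
  show "entire (tw d (L_factor k))" for d
    by (intro entire_tw entire_L_factor)
  fix R e :: real assume R: "R \<ge> 1" and e: "e > 0"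
  obtain \<rho> c where \<rho>: "\<rho> > 1" and c: "0 \<le> c" "c < 1" and G: "gauss_le \<rho> c (L_factor k)"
    using L_factor_small[OF assms] .
  have mono: "n \<le> CARD('f) ^ n" for n
    using CARD_ge_2[where 'a = 'f] power_gt_expt[of "CARD('f)" n] by simp
  have "(\<lambda>n. c ^ n) \<longlonglongrightarrow> 0"
    using c by (intro LIMSEQ_power_zero) simp
  hence "\<forall>\<^sub>F n in sequentially. c ^ n < e"
    using e by (rule order_tendstoD(2))
  moreover obtain N where "R < \<rho> ^ N"
    using real_arch_pow[OF \<rho>] by blast
  hence "\<forall>\<^sub>F n in sequentially. R \<le> \<rho> ^ n"
    unfolding eventually_sequentially using \<rho>
    by (intro exI[of _ N]) (meson less_imp_le order_trans power_increasing)
  ultimately show "\<forall>\<^sub>F d in sequentially. gauss_le R e (tw d (L_factor k) - 0)"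
  proof eventually_elim
    case (elim d)
    let ?k = "CARD('f) ^ d"
    have "\<rho> ^ d \<le> \<rho> ^ ?k"
      using \<rho> mono by (intro power_increasing) auto
    with elim(2) have "R \<le> \<rho> ^ ?k"
      by (rule order_trans)
    have "absv (fps_nth (tw d (L_factor k)) n) * R ^ n \<le> e" for n
    proof -
      have "absv (fps_nth (tw d (L_factor k)) n) * R ^ n \<le>
          absv (fps_nth (L_factor k) n) ^ ?k * (\<rho> ^ ?k) ^ n"
        using \<open>R \<le> \<rho> ^ ?k\<close> R by (simp add: absv_power mult_left_mono power_mono)
      also have "\<dots> = (absv (fps_nth (L_factor k) n) * \<rho> ^ n) ^ ?k"
        by (simp add: power_mult_distrib mult.commute flip: power_mult)
      also have "\<dots> \<le> c ^ ?k"
        using G \<rho> by (intro power_mono) (auto simp: gauss_le_def)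
      also have "\<dots> \<le> c ^ d"
        using c mono by (intro power_decreasing) auto
      finally show ?thesis
        using elim(1) by simp
    qed
    thus ?case
      by (simp add: gauss_le_def)
  qed
qed

definition L_terms :: "nat list \<Rightarrow> nat \<Rightarrow> nat \<Rightarrow> 'c fps" where
  "L_terms ks l d = tw d (L_factor (ks ! l))"

lemma L_series_altdef: "L_series emb ks = tuple_series (L_terms ks) (length ks)"
  by (simp add: L_series_def tuple_series_def tuple_term_def L_terms_def L_factor_def tw_def)

lemma null_sequence_L_terms:
  "\<forall>k\<in>set ks. k > 0 \<Longrightarrow> l < length ks \<Longrightarrow> null_sequence (L_terms ks l)"
  unfolding L_terms_def by (intro null_sequence_tw_L_factor) simp

lemma entire_L_series: "\<forall>k\<in>set ks. k > 0 \<Longrightarrow> entire (L_series emb ks)"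
  unfolding L_series_altdef by (intro entire_tuple_series null_sequence_L_terms)

lemma L_series_Nil [simp]: "L_series emb [] = 1"
  by (simp add: L_series_altdef tuple_series_0)

lemma untw_L_series:
  assumes "\<forall>k\<in>set (ks @ [k]). k > 0"
  shows "untw (L_series emb (ks @ [k])) = L_series emb (ks @ [k]) + L_series emb ks * untw (L_factor k)"
proof -
  have "tuple_series (L_terms (ks @ [k])) (Suc (length ks)) =
      tw 1 (tuple_series (L_terms (ks @ [k])) (Suc (length ks))) +
      tw 1 (tuple_series (L_terms (ks @ [k])) (length ks)) * L_terms (ks @ [k]) (length ks) 0"
  proof (rule tuple_series_Suc)
    show "null_sequence (L_terms (ks @ [k]) l)" if "l < Suc (length ks)" for l
      by (rule null_sequence_L_terms[OF assms]) (use that in simp)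
    show "L_terms (ks @ [k]) l (Suc d) = tw 1 (L_terms (ks @ [k]) l d)" for l d
      by (simp add: L_terms_def)
  qed
  moreover have "tuple_series (L_terms (ks @ [k])) (length ks) = L_series emb ks"
    unfolding L_series_altdef by (rule tuple_series_cong) (simp add: fun_eq_iff L_terms_def nth_append)
  moreover have "L_terms (ks @ [k]) (length ks) 0 = L_factor k"
    by (simp add: L_terms_def)
  moreover have "tuple_series (L_terms (ks @ [k])) (Suc (length ks)) = L_series emb (ks @ [k])"
    by (simp add: L_series_altdef)
  ultimately have "L_series emb (ks @ [k]) =
      tw 1 (L_series emb (ks @ [k])) + tw 1 (L_series emb ks) * L_factor k"
    by simp
  also have "\<dots> = tw 1 (L_series emb (ks @ [k]) + L_series emb ks * untw (L_factor k))"
    by (simp only: tw.hom_add tw.hom_mult tw_untw)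
  finally show ?thesis
    by (metis untw_tw)
qed

lemma fps_value_tw_L_factor:
  assumes "k > 0"
  shows "fps_value (tw d (L_factor k)) \<theta> =
    A_emb emb (carlitz_gamma k) / pi_tilde emb ^ k * power_sum emb d k"
proof -
  have "fps_value (tw d (L_factor k)) \<theta> =
      fps_value (tw d (Omega emb)) \<theta> ^ k * fps_value (tw d (fps_of_poly (AT_H_emb emb (k - 1)))) \<theta>"
    unfolding L_factor_def tw.hom_mult tw.hom_power
    by (simp add: fps_value_mult fps_value_power entire_power entire_tw entire_Omega)
  also have "fps_value (tw d (fps_of_poly (AT_H_emb emb (k - 1)))) \<theta> =
      A_emb emb (carlitz_gamma k) * ell d ^ k * power_sum emb d k"
    using assms fps_value_tw_AT_H_emb[of d "k - 1"] by simp
  also have "fps_value (tw d (Omega emb)) \<theta> = inverse (pi_tilde emb) / ell d"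
    using fps_value_tw_Omega[of d] by (simp add: fps_value_Omega)
  finally show ?thesis
    by (simp add: field_simps power_divide power_inverse)
qed

lemma fps_value_L_series:
  assumes "\<forall>k\<in>set ks. k > 0"
  shows "fps_value (L_series emb ks) \<theta> =
    (\<Prod>l<length ks. A_emb emb (carlitz_gamma (ks ! l)) / pi_tilde emb ^ (ks ! l)) * multizeta emb ks"
proof -
  define c where "c = (\<Prod>l<length ks. A_emb emb (carlitz_gamma (ks ! l)) / pi_tilde emb ^ (ks ! l))"
  have c: "c \<noteq> 0"
    by (simp add: c_def pi_tilde_neq_0)
  have "((\<lambda>ds. \<Prod>l<length ks. fps_value (L_terms ks l (ds ! l)) \<theta>) has_sum
      fps_value (L_series emb ks) \<theta>) (decreasing_tuples (length ks))"
    unfolding L_series_altdef by (intro fps_value_tuple_series null_sequence_L_terms assms)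
  moreover have "(\<Prod>l<length ks. fps_value (L_terms ks l (ds ! l)) \<theta>) =
      c * (\<Prod>l<length ks. power_sum emb (ds ! l) (ks ! l))" for ds
    unfolding c_def prod.distrib [symmetric]
    by (intro prod.cong refl) (simp add: assms L_terms_def fps_value_tw_L_factor)
  ultimately have "((\<lambda>ds. c * (\<Prod>l<length ks. power_sum emb (ds ! l) (ks ! l))) has_sum
      fps_value (L_series emb ks) \<theta>) (decreasing_tuples (length ks))"
    by simp
  from has_sum_cmult_right[OF this, of "inverse c"]
  have "((\<lambda>ds. \<Prod>l<length ks. power_sum emb (ds ! l) (ks ! l)) has_sum
      inverse c * fps_value (L_series emb ks) \<theta>) (decreasing_tuples (length ks))"
    using c by (simp flip: mult.assoc)
  hence "multizeta emb ks = inverse c * fps_value (L_series emb ks) \<theta>"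
    unfolding multizeta_def by (rule infsumI)
  thus ?thesis
    using c by (simp add: c_def)
qed

end


section \<open>Matrices\<close>

text \<open>
  This serves twice: over the power series, to invert \<open>\<Psi>\<close> with control of the convergence, and over
  \<open>\<complex>\<^sub>\<infinity>\<close>, to invert its value at \<open>T = t\<close>.
\<close>

lemma smult_adj_mat_inverts:
  assumes A: "A \<in> carrier_mat n n" and c: "c * det A = 1"
  shows "inverts_mat A (c \<cdot>\<^sub>m adj_mat A)" "inverts_mat (c \<cdot>\<^sub>m adj_mat A) A"
proof -
  note adj = adj_mat[OF A]
  have "c \<cdot>\<^sub>m (det A \<cdot>\<^sub>m 1\<^sub>m n) = 1\<^sub>m n"
    using c by (intro eq_matI) (auto simp flip: mult.assoc)
  thus "inverts_mat A (c \<cdot>\<^sub>m adj_mat A)" "inverts_mat (c \<cdot>\<^sub>m adj_mat A) A"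
    using A carrier_matD[OF adj(1)]
    by (simp_all add: inverts_mat_def adj mult_smult_distrib[OF A adj(1)]
        mult_smult_assoc_mat[OF adj(1) A])
qed

lemma entire_det:
  assumes "\<And>i j. i < dim_row A \<Longrightarrow> j < dim_col A \<Longrightarrow> entire (A $$ (i, j))"
  shows "entire (det A)"
proof (cases "dim_row A = dim_col A")
  case True
  have sign: "entire (signof p)" for p
    by (cases rule: sign_cases[of p]) simp_all
  show ?thesis
    unfolding det_def using True
    by (auto intro!: entire_sum entire_mult entire_prod sign assms simp: permutes_in_image)
qed (simp add: det_def)

lemma entire_adj_mat:
  assumes "\<And>i j. i < dim_row A \<Longrightarrow> j < dim_col A \<Longrightarrow> entire (A $$ (i, j))"
    and "i < dim_row A" "j < dim_col A"
  shows "entire (adj_mat A $$ (i, j))"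
proof -
  have "entire (det (mat_delete A j i))"
    by (rule entire_det) (auto simp: mat_delete_def intro!: assms(1))
  moreover have "entire ((- 1) ^ (j + i))"
    by (intro entire_power) simp
  ultimately show ?thesis
    using assms(2,3) by (auto simp: adj_mat_def cofactor_def intro: entire_mult)
qed

lemma tail_sum_Suc: "i < length s \<Longrightarrow> tail_sum s i = s ! i + tail_sum s (Suc i)"
  by (simp add: tail_sum_def sum.atLeast_Suc_lessThan)

lemma tail_sum_0: "tail_sum s 0 = sum_list s"
  by (simp add: tail_sum_def sum_list_sum_nth)

lemma tail_sum_split: "j \<le> i \<Longrightarrow> i \<le> length s \<Longrightarrow> tail_sum s j = (\<Sum>k=j..<i. s ! k) + tail_sum s i"
  by (simp add: tail_sum_def sum.atLeastLessThan_concat)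

lemma segment_Nil [simp]: "segment s i i = []"
  by (simp add: segment_def)

lemma segment_Suc: "j \<le> i \<Longrightarrow> segment s j (Suc i) = segment s j i @ [s ! i]"
  by (simp add: segment_def)

lemma segment_full: "segment s 0 (length s) = s"
  by (simp add: segment_def map_nth)

lemma length_segment [simp]: "length (segment s j i) = i - j"
  by (simp add: segment_def)

lemma segment_nth [simp]: "l < i - j \<Longrightarrow> segment s j i ! l = s ! (j + l)"
  by (simp add: segment_def)

lemma segment_pos: "\<forall>k\<in>set s. k > 0 \<Longrightarrow> i \<le> length s \<Longrightarrow> \<forall>k\<in>set (segment s j i). (k::nat) > 0"
  by (auto simp: segment_def)

lemma prod_segment:
  assumes "j \<le> i"
  shows "(\<Prod>l<i - j. f (segment s j i ! l)) = (\<Prod>k=j..<i. f (s ! k))"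
  by (rule prod.reindex_bij_witness[of _ "\<lambda>k. k - j" "\<lambda>l. j + l"]) (use assms in auto)

context C_infinity
begin

lemma untw_eqI: "tw 1 g = f \<Longrightarrow> untw f = g"
  by (metis untw_tw)

end

sublocale C_infinity \<subseteq> untw: comm_ring_hom untw
  by standard (rule untw_eqI; simp only: tw.hom_add tw.hom_mult tw.hom_zero tw.hom_one tw_untw)+

context C_infinity
begin

definition T_minus_t :: "'c poly" where "T_minus_t = [:- \<theta>, 1:]"

lemma fps_of_poly_T_minus_t: "fps_of_poly T_minus_t = fps_X - fps_const \<theta>"
  by (rule fps_ext) (simp add: T_minus_t_def coeff_pCons fps_X_def split: nat.splits)

lemma untw_Omega_power: "untw (Omega emb ^ m) = fps_of_poly (T_minus_t ^ m) * Omega emb ^ m"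
  by (simp add: untw.hom_power untw_Omega fps_of_poly_power fps_of_poly_T_minus_t power_mult_distrib)

lemma untw_L_factor:
  "untw (L_factor k) = untw (Omega emb ^ k) * fps_of_poly (map_poly frob_root (AT_H_emb emb (k - 1)))"
  unfolding L_factor_def untw.hom_mult
  by (simp add: untw_def poly_twist_root flip: fps_of_poly_twist[unfolded untw_def])

end

locale multizeta_tuple = C_infinity emb for emb :: "'f::{field,finite} fls \<Rightarrow> 'c::complete_ultrametric_field" +
  fixes s :: "nat list"
  assumes pos: "\<forall>k\<in>set s. k > 0"
begin

abbreviation n :: nat where "n \<equiv> length s + 1"

text \<open>
  Since \<open>L\<close> of the empty tuple is \<open>1\<close>, this covers the diagonal as well.
\<close>

definition L_entry :: "nat \<Rightarrow> nat \<Rightarrow> 'c fps" where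
  "L_entry i j = (if j \<le> i then L_series emb (segment s j i) else 0)"

lemma Phi_mat_altdef:
  "Phi_mat emb s = mat n n (\<lambda>(i, j). if i = j then T_minus_t ^ tail_sum s j
     else if i = Suc j then map_poly frob_root (AT_H_emb emb (s ! j - 1)) * T_minus_t ^ tail_sum s j else 0)"
  unfolding Phi_mat_def D_mat_def Q_mat_def poly_twist_root T_minus_t_def
  by (subst mat_diag_mult_right[of _ n]) (auto intro!: eq_matI)

lemma Phi_carrier: "Phi_mat emb s \<in> carrier_mat n n"
  by (simp add: Phi_mat_altdef)

lemma Psi_mat_altdef: "Psi_mat emb s = mat n n (\<lambda>(i, j). Omega emb ^ tail_sum s i * L_entry i j)"
  unfolding Psi_mat_def Lambda_mat_def L_mat_def L_entry_def
  by (subst mat_diag_mult_left[of _ n]) (auto intro!: eq_matI)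

lemma Psi_carrier: "Psi_mat emb s \<in> carrier_mat n n"
  by (simp add: Psi_mat_altdef)

lemma entire_L_entry: "i < n \<Longrightarrow> entire (L_entry i j)"
  using entire_L_series[OF segment_pos[OF pos, of i j]] by (simp add: L_entry_def)

lemma entire_Psi: "i < n \<Longrightarrow> j < n \<Longrightarrow> entire (Psi_mat emb s $$ (i, j))"
  by (simp add: Psi_mat_altdef entire_mult entire_power entire_Omega entire_L_entry)

lemma untw_L_entry:
  assumes "Suc i < n"
  shows "untw (L_entry (Suc i) j) = L_entry (Suc i) j + L_entry i j * untw (L_factor (s ! i))"
proof -
  consider "j \<le> i" | "j = Suc i" | "j > Suc i"
    by linarith
  thus ?thesis
  proof cases
    case 1
    have "\<forall>k\<in>set (segment s j i @ [s ! i]). k > 0"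
      using segment_pos[OF pos, of "Suc i" j] assms 1 by (simp add: segment_Suc)
    from untw_L_series[OF this] show ?thesis
      using 1 by (simp add: L_entry_def segment_Suc)
  qed (simp_all add: L_entry_def)
qed

text \<open>
  Row \<open>i\<close> of \<open>\<Phi>\<close> has entries only in the columns \<open>i\<close> and \<open>i - 1\<close>; the two terms match those of
  \<open>untw_L_entry\<close> because \<open>tail_sum s (i - 1) = s ! (i - 1) + tail_sum s i\<close>.
\<close>

theorem Phi_Psi: "map_mat fps_of_poly (Phi_mat emb s) * Psi_mat emb s = map_mat untw (Psi_mat emb s)"
proof (rule eq_matI)
  fix i j assume "i < dim_row (map_mat untw (Psi_mat emb s))" "j < dim_col (map_mat untw (Psi_mat emb s))"
  hence ij: "i < n" "j < n"
    by (simp_all add: Psi_mat_altdef)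
  define P where "P = (\<lambda>k. fps_of_poly (Phi_mat emb s $$ (i, k)) * (Omega emb ^ tail_sum s k * L_entry k j))"
  have "(map_mat fps_of_poly (Phi_mat emb s) * Psi_mat emb s) $$ (i, j) = (\<Sum>k=0..<n. P k)"
    using ij Phi_carrier Psi_carrier by (simp add: scalar_prod_def P_def Psi_mat_altdef)
  also have "\<dots> = untw (Omega emb ^ tail_sum s i * L_entry i j)"
  proof (cases i)
    case 0
    have "(\<Sum>k=0..<n. P k) = (\<Sum>k\<in>{0}. P k)"
      by (rule sum.mono_neutral_right) (use ij 0 in \<open>auto simp: P_def Phi_mat_altdef\<close>)
    moreover have "untw (L_entry 0 j) = L_entry 0 j"
      by (cases j) (simp_all add: L_entry_def)
    ultimately show ?thesis
      using 0 by (simp add: P_def Phi_mat_altdef untw.hom_mult untw_Omega_power mult.assoc)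
  next
    case (Suc i')
    have "(\<Sum>k=0..<n. P k) = (\<Sum>k\<in>{i', Suc i'}. P k)"
      by (rule sum.mono_neutral_right) (use ij Suc in \<open>auto simp: P_def Phi_mat_altdef\<close>)
    also have "\<dots> = P i' + P (Suc i')"
      by simp
    also have "P (Suc i') = untw (Omega emb ^ tail_sum s (Suc i')) * L_entry (Suc i') j"
      using ij Suc by (simp add: P_def Phi_mat_altdef untw_Omega_power mult.assoc)
    also have "P i' = untw (Omega emb ^ tail_sum s i') *
        fps_of_poly (map_poly frob_root (AT_H_emb emb (s ! i' - 1))) * L_entry i' j"
      using ij Suc by (simp add: P_def Phi_mat_altdef untw_Omega_power fps_of_poly_mult mult_ac)
    also have "tail_sum s i' = s ! i' + tail_sum s (Suc i')"
      using ij Suc by (intro tail_sum_Suc) simp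
    finally have "(\<Sum>k=0..<n. P k) = untw (Omega emb ^ tail_sum s (Suc i')) *
        (L_entry (Suc i') j + L_entry i' j * untw (L_factor (s ! i')))"
      by (simp add: power_add untw.hom_mult untw_L_factor algebra_simps)
    thus ?thesis
      using ij Suc by (simp add: untw.hom_mult untw_L_entry)
  qed
  also have "\<dots> = map_mat untw (Psi_mat emb s) $$ (i, j)"
    using ij by (simp add: Psi_mat_altdef)
  finally show "(map_mat fps_of_poly (Phi_mat emb s) * Psi_mat emb s) $$ (i, j) =
      map_mat untw (Psi_mat emb s) $$ (i, j)" .
qed (use Phi_carrier Psi_carrier in auto)


section \<open>The dual \<open>t\<close>-motive\<close>

lemma A_emb_range_closed:
  "0 \<in> range (A_emb emb)" "1 \<in> range (A_emb emb)"
  "x \<in> range (A_emb emb) \<Longrightarrow> y \<in> range (A_emb emb) \<Longrightarrow> x + y \<in> range (A_emb emb)"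
  "x \<in> range (A_emb emb) \<Longrightarrow> y \<in> range (A_emb emb) \<Longrightarrow> x * y \<in> range (A_emb emb)"
  by (auto simp flip: A_emb.hom_add A_emb.hom_mult intro: image_eqI[of _ _ 0] image_eqI[of _ _ 1])

lemma A_polys_mult:
  "f \<in> polys_over (range (A_emb emb)) \<Longrightarrow> g \<in> polys_over (range (A_emb emb)) \<Longrightarrow>
     f * g \<in> polys_over (range (A_emb emb))"
  unfolding polys_over_def
  by (auto intro!: coeff_mult_semiring_closed[of "range (A_emb emb)"] A_emb_range_closed)

lemma A_polys_0: "0 \<in> polys_over (range (A_emb emb))"
  by (simp add: polys_over_def A_emb_range_closed)

lemma T_minus_t_power_A: "T_minus_t ^ m \<in> polys_over (range (A_emb emb))"
proof (induction m)
  case 0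
  show ?case
    by (auto simp: polys_over_def coeff_1 A_emb_range_closed)
next
  case (Suc m)
  have "- \<theta> = A_emb emb [:0, - 1:]"
    by (simp add: const.hom_uminus)
  hence "- \<theta> \<in> range (A_emb emb)"
    by (rule range_eqI)
  hence "T_minus_t \<in> polys_over (range (A_emb emb))"
    unfolding polys_over_def T_minus_t_def
    by (auto simp: coeff_pCons A_emb_range_closed split: nat.splits)
  with Suc show ?case
    by (simp add: A_polys_mult)
qed

lemma Phi_entry_A: "i < n \<Longrightarrow> j < n \<Longrightarrow> Phi_mat emb s $$ (i, j) \<in> polys_over (range (A_emb emb))"
proof -
  have "map_poly frob_root (AT_H_emb emb m) \<in> polys_over (range (A_emb emb))" for m
    by (auto simp: polys_over_def coeff_map_poly frob_root_coeff_AT_H_emb)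
  thus "i < n \<Longrightarrow> j < n \<Longrightarrow> Phi_mat emb s $$ (i, j) \<in> polys_over (range (A_emb emb))"
    by (simp add: Phi_mat_altdef T_minus_t_power_A A_polys_mult A_polys_0)
qed

lemma is_subfield_K: "is_subfield {A_emb emb a / A_emb emb b | a b. b \<noteq> 0}" (is "is_subfield ?K")
proof -
  have I: "A_emb emb a / A_emb emb b \<in> ?K" if "b \<noteq> 0" for a b
    using that by blast
  have add: "A_emb emb a / A_emb emb b + A_emb emb c / A_emb emb d \<in> ?K" if "b \<noteq> 0" "d \<noteq> 0" for a b c d
    using I[of "b * d" "a * d + c * b"] that
    by (simp add: A_emb.hom_add A_emb.hom_mult add_frac_eq)
  have mult: "(A_emb emb a / A_emb emb b) * (A_emb emb c / A_emb emb d) \<in> ?K" if "b \<noteq> 0" "d \<noteq> 0" for a b c d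
    using I[of "b * d" "a * c"] that by (simp add: A_emb.hom_mult)
  have uminus: "- (A_emb emb a / A_emb emb b) \<in> ?K" if "b \<noteq> 0" for a b
    using I[of b "- a"] that by (simp add: A_emb.hom_uminus)
  have zero: "0 \<in> ?K" and one: "1 \<in> ?K"
    using I[of 1 0] I[of 1 1] by simp_all
  have inverse: "inverse (A_emb emb a / A_emb emb b) \<in> ?K" if "b \<noteq> 0" for a b
    using I[of a b] zero by (cases "a = 0") simp_all
  show ?thesis
    unfolding is_subfield_def
  proof (intro conjI ballI zero one)
    fix x assume "x \<in> ?K"
    then obtain a b where x: "x = A_emb emb a / A_emb emb b" "b \<noteq> 0"
      by blast
    show "- x \<in> ?K" "inverse x \<in> ?K"
      unfolding x(1) by (rule uminus[OF x(2)], rule inverse[OF x(2)])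
    fix y assume "y \<in> ?K"
    then obtain c d where y: "y = A_emb emb c / A_emb emb d" "d \<noteq> 0"
      by blast
    show "x + y \<in> ?K" "x * y \<in> ?K"
      unfolding x(1) y(1) by (rule add[OF x(2) y(2)], rule mult[OF x(2) y(2)])
  qed
qed

lemma is_subfield_K_bar: "is_subfield (K_bar emb)"
  unfolding K_bar_def by (rule is_subfield_rel_alg_closure[OF is_subfield_K])

lemma A_subset_K_bar: "range (A_emb emb) \<subseteq> K_bar emb"
proof -
  have "A_emb emb a \<in> {A_emb emb a / A_emb emb b | a b. b \<noteq> 0}" for a
    by (intro CollectI exI[of _ a] exI[of _ 1]) simp
  hence "range (A_emb emb) \<subseteq> {A_emb emb a / A_emb emb b | a b. b \<noteq> 0}"
    by blast
  thus ?thesis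
    unfolding K_bar_def using subset_rel_alg_closure[OF is_subfield_K] by blast
qed

lemma frob_root_K_bar: "x \<in> K_bar emb \<Longrightarrow> frob_root x \<in> K_bar emb"
  unfolding K_bar_def by (rule rel_alg_closure_root[OF is_subfield_K, of _ "CARD('f)"]) simp_all

lemma K_bar_polys_mult:
  "f \<in> polys_over (K_bar emb) \<Longrightarrow> g \<in> polys_over (K_bar emb) \<Longrightarrow> f * g \<in> polys_over (K_bar emb)"
  using is_subfield_K_bar unfolding polys_over_def is_subfield_def
  by (auto intro!: coeff_mult_semiring_closed[of "K_bar emb"])

lemma K_bar_polys_sum:
  "(\<And>i. i \<in> I \<Longrightarrow> f i \<in> polys_over (K_bar emb)) \<Longrightarrow> sum f I \<in> polys_over (K_bar emb)"
  using is_subfield_K_bar unfolding polys_over_def is_subfield_def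
  by (induction I rule: infinite_finite_induct) auto

definition Phi_sigma :: "'c poly vec \<Rightarrow> 'c poly vec" where
  "Phi_sigma v = vec n (\<lambda>j. \<Sum>i<n. map_poly frob_root (v $ i) * Phi_mat emb s $$ (i, j))"

lemma is_sigma_Phi: "is_sigma emb n (Phi_mat emb s) Phi_sigma"
proof -
  interpret R: map_poly_comm_ring_hom frob_root ..
  have Phi: "Phi_mat emb s $$ (i, j) \<in> polys_over (K_bar emb)" if "i < n" "j < n" for i j
    using Phi_entry_A[OF that] A_subset_K_bar by (auto simp: polys_over_def)
  have root: "map_poly frob_root f \<in> polys_over (K_bar emb)" if "f \<in> polys_over (K_bar emb)" for f
    using that frob_root_K_bar by (auto simp: polys_over_def coeff_map_poly)
  show ?thesis
    unfolding is_sigma_def poly_twist_root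
  proof (intro conjI ballI allI impI)
    fix v assume v: "v \<in> motive_module emb n"
    show "Phi_sigma v \<in> motive_module emb n"
      using v unfolding motive_module_def Phi_sigma_def
      by (auto simp del: sum.lessThan_Suc intro!: K_bar_polys_sum K_bar_polys_mult root Phi)
    fix w assume w: "w \<in> motive_module emb n"
    show "Phi_sigma (v + w) = Phi_sigma v + Phi_sigma w"
      using v w unfolding motive_module_def Phi_sigma_def
      by (intro eq_vecI) (auto simp: R.hom_add distrib_right sum.distrib)
  next
    fix f v assume f: "f \<in> polys_over (K_bar emb)" and v: "v \<in> motive_module emb n"
    show "Phi_sigma (f \<cdot>\<^sub>v v) = map_poly frob_root f \<cdot>\<^sub>v Phi_sigma v"
      using v unfolding motive_module_def Phi_sigma_def
      by (intro eq_vecI) (auto simp: R.hom_mult sum_distrib_left mult.assoc simp del: sum.lessThan_Suc)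
  next
    fix i assume i: "i < n"
    show "Phi_sigma (unit_vec n i) = row (Phi_mat emb s) i"
    proof (rule eq_vecI)
      fix j assume "j < dim_vec (row (Phi_mat emb s) i)"
      hence j: "j < n"
        using Phi_carrier by simp
      have "(\<Sum>k<n. map_poly frob_root (unit_vec n i $ k) * Phi_mat emb s $$ (k, j)) =
          (\<Sum>k<n. if k = i then Phi_mat emb s $$ (k, j) else 0)"
        using i by (intro sum.cong refl) auto
      also have "\<dots> = Phi_mat emb s $$ (i, j)"
        using i by simp
      finally show "Phi_sigma (unit_vec n i) $ j = row (Phi_mat emb s) i $ j"
        using i j Phi_carrier by (simp add: Phi_sigma_def)
    qed (use Phi_carrier in \<open>simp add: Phi_sigma_def\<close>)
  qed
qed

lemma det_Phi: "det (Phi_mat emb s) = T_minus_t ^ (\<Sum>i<n. tail_sum s i)"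
proof -
  have "det (Phi_mat emb s) = (\<Prod>i=0..<n. Phi_mat emb s $$ (i, i))"
    using det_lower_triangular[OF _ Phi_carrier] Phi_carrier
    by (simp add: prod_list_diag_prod Phi_mat_altdef)
  also have "\<dots> = (\<Prod>i=0..<n. T_minus_t ^ tail_sum s i)"
    by (intro prod.cong refl) (simp add: Phi_mat_altdef)
  finally show ?thesis
    by (simp add: power_sum power_add atLeast0LessThan)
qed

theorem Phi_dual_t_motive: "defines_dual_t_motive emb n (Phi_mat emb s)"
  unfolding defines_dual_t_motive_def
proof (intro conjI)
  show "elements_mat (Phi_mat emb s) \<subseteq> polys_over (range (A_emb emb))"
    using Phi_carrier Phi_entry_A by auto
  show "\<exists>c m. c \<noteq> 0 \<and> det (Phi_mat emb s) = Polynomial.smult (emb (fls_const c)) ([:- \<theta>, 1:] ^ m)"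
    by (intro exI[of _ 1] exI[of _ "\<Sum>i<n. tail_sum s i"]) (simp add: det_Phi T_minus_t_def emb_1)
  show "\<exists>\<sigma>. is_sigma emb n (Phi_mat emb s) \<sigma>"
    using is_sigma_Phi by blast
qed (rule Phi_carrier)


section \<open>The period matrix\<close>

lemma fps_value_L_entry:
  assumes "i < n" "j \<le> i"
  shows "fps_value (L_entry i j) \<theta> =
    (\<Prod>k=j..<i. A_emb emb (carlitz_gamma (s ! k)) / pi_tilde emb ^ (s ! k)) * multizeta emb (segment s j i)"
  using assms fps_value_L_series[OF segment_pos[OF pos, of i j]]
    prod_segment[of j i "\<lambda>k. A_emb emb (carlitz_gamma k) / pi_tilde emb ^ k" s]
  by (simp add: L_entry_def)

theorem fps_value_Psi:
  assumes "i < n" "j < n"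
  shows "fps_value (Psi_mat emb s $$ (i, j)) \<theta> =
    (if i < j then 0 else inverse (pi_tilde emb ^ tail_sum s j) *
      (\<Prod>k=j..<i. A_emb emb (carlitz_gamma (s ! k))) * multizeta emb (segment s j i))"
proof (cases "i < j")
  case False
  have "fps_value (Psi_mat emb s $$ (i, j)) \<theta> =
      fps_value (Omega emb) \<theta> ^ tail_sum s i * fps_value (L_entry i j) \<theta>"
    using assms
    by (simp add: Psi_mat_altdef fps_value_mult fps_value_power entire_power entire_Omega entire_L_entry)
  also have "fps_value (L_entry i j) \<theta> = (\<Prod>k=j..<i. A_emb emb (carlitz_gamma (s ! k))) *
      inverse (pi_tilde emb ^ (\<Sum>k=j..<i. s ! k)) * multizeta emb (segment s j i)"
    using assms(1) False
    by (subst fps_value_L_entry) (simp_all add: prod_dividef power_sum, simp add: divide_inverse)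
  also have "fps_value (Omega emb) \<theta> ^ tail_sum s i * \<dots> =
      inverse (pi_tilde emb ^ tail_sum s i) * inverse (pi_tilde emb ^ (\<Sum>k=j..<i. s ! k)) *
      (\<Prod>k=j..<i. A_emb emb (carlitz_gamma (s ! k))) * multizeta emb (segment s j i)"
    unfolding fps_value_Omega power_inverse by (simp only: mult_ac)
  also have "inverse (pi_tilde emb ^ tail_sum s i) * inverse (pi_tilde emb ^ (\<Sum>k=j..<i. s ! k)) =
      inverse (pi_tilde emb ^ tail_sum s j)"
    using assms False tail_sum_split[of j i s] by (simp add: power_add mult.commute)
  finally show ?thesis
    using False by simp
qed (use assms in \<open>simp add: Psi_mat_altdef L_entry_def\<close>)

lemma multizeta_Nil: "multizeta emb [] = 1"
  using fps_value_L_series[of "[]"] by simp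

lemma Psi_triangular: "i < j \<Longrightarrow> j < n \<Longrightarrow> Psi_mat emb s $$ (i, j) = 0"
  by (simp add: Psi_mat_altdef L_entry_def)

lemma Psi_diagonal: "i < n \<Longrightarrow> Psi_mat emb s $$ (i, i) = Omega emb ^ tail_sum s i"
  by (simp add: Psi_mat_altdef L_entry_def)

lemma det_Psi: "det (Psi_mat emb s) = Omega emb ^ (\<Sum>i<n. tail_sum s i)"
proof -
  have "det (Psi_mat emb s) = (\<Prod>i=0..<n. Psi_mat emb s $$ (i, i))"
    using det_lower_triangular[OF Psi_triangular Psi_carrier] Psi_carrier
    by (simp add: prod_list_diag_prod)
  also have "\<dots> = (\<Prod>i=0..<n. Omega emb ^ tail_sum s i)"
    by (intro prod.cong refl Psi_diagonal) simp
  finally show ?thesis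
    by (simp add: power_sum power_add atLeast0LessThan)
qed

lemma det_Psi_value_neq_0: "det (mat_value (Psi_mat emb s) \<theta>) \<noteq> 0"
proof -
  have carrier: "mat_value (Psi_mat emb s) \<theta> \<in> carrier_mat n n"
    using Psi_carrier by (simp add: mat_value_def)
  have entry: "mat_value (Psi_mat emb s) \<theta> $$ (i, j) = fps_value (Psi_mat emb s $$ (i, j)) \<theta>"
    if "i < n" "j < n" for i j
    using that Psi_carrier by (simp add: mat_value_def)
  have "det (mat_value (Psi_mat emb s) \<theta>) = (\<Prod>i=0..<n. mat_value (Psi_mat emb s) \<theta> $$ (i, i))"
    using det_lower_triangular[OF _ carrier] carrier
    by (simp add: prod_list_diag_prod entry Psi_triangular)
  also have "\<dots> \<noteq> 0"
    by (simp add: entry Psi_diagonal fps_value_power entire_Omega fps_value_Omega_neq_0)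
  finally show ?thesis .
qed

lemma Psi_value_inverse:
  obtains P where "inverts_mat P (mat_value (Psi_mat emb s) \<theta>)" "inverts_mat (mat_value (Psi_mat emb s) \<theta>) P"
proof -
  have carrier: "mat_value (Psi_mat emb s) \<theta> \<in> carrier_mat n n"
    using Psi_carrier by (simp add: mat_value_def)
  have "inverse (det (mat_value (Psi_mat emb s) \<theta>)) * det (mat_value (Psi_mat emb s) \<theta>) = 1"
    using det_Psi_value_neq_0 by simp
  from smult_adj_mat_inverts[OF carrier this] show thesis
    by (rule that[rotated])
qed

text \<open>
  The adjugate of \<open>\<Psi>\<close> is entire, and the determinant is a power of \<open>\<Omega>\<close>, whose inverse converges for
  \<open>\<bar>T\<bar> < \<bar>t\<bar>^q\<close>.
\<close>

lemma Psi_unit_disk_inverse: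
  obtains \<Theta> :: "'c fps mat" where "\<Theta> \<in> carrier_mat n n"
    "\<And>f z :: 'c. f \<in> elements_mat \<Theta> \<Longrightarrow> dist z 0 \<le> 1 \<Longrightarrow> fps_converges_at f z"
    "inverts_mat (Psi_mat emb s) \<Theta>" "inverts_mat \<Theta> (Psi_mat emb s)"
proof -
  define c where "c = inverse (Omega emb) ^ (\<Sum>i<n. tail_sum s i)"
  define \<Theta> where "\<Theta> = c \<cdot>\<^sub>m adj_mat (Psi_mat emb s)"
  have adj: "adj_mat (Psi_mat emb s) \<in> carrier_mat n n"
    by (rule adj_mat(1)[OF Psi_carrier])
  show thesis
  proof (rule that)
    show "\<Theta> \<in> carrier_mat n n"
      using adj by (simp add: \<Theta>_def)
    have "inverse (Omega emb) * Omega emb = 1"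
      by (rule inverse_mult_eq_1[OF Omega_nth_0_neq_0])
    hence "c * det (Psi_mat emb s) = 1"
      by (simp add: c_def det_Psi flip: power_mult_distrib)
    from smult_adj_mat_inverts[OF Psi_carrier this]
    show "inverts_mat (Psi_mat emb s) \<Theta>" "inverts_mat \<Theta> (Psi_mat emb s)"
      by (simp_all add: \<Theta>_def)
    fix f and z :: 'c assume f: "f \<in> elements_mat \<Theta>" and z: "dist z 0 \<le> 1"
    then obtain i j where ij: "i < n" "j < n" and "f = \<Theta> $$ (i, j)"
      using adj by (auto simp: \<Theta>_def)
    hence f_eq: "f = c * adj_mat (Psi_mat emb s) $$ (i, j)"
      using adj by (simp add: \<Theta>_def)
    have "entire (adj_mat (Psi_mat emb s) $$ (i, j))"
      using ij Psi_carrier by (intro entire_adj_mat) (auto simp: entire_Psi)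
    thus "fps_converges_at f z"
      unfolding f_eq c_def by (rule inverse_Omega_converges[OF _ z])
  qed
qed

theorem Psi_uniformizes: "uniformizes emb n (Phi_mat emb s) (Psi_mat emb s)"
  unfolding uniformizes_def
proof (intro conjI)
  show "\<forall>f\<in>elements_mat (Psi_mat emb s). \<forall>z. fps_converges_at f z"
  proof (intro ballI allI)
    fix f z assume "f \<in> elements_mat (Psi_mat emb s)"
    then obtain i j where "i < n" "j < n" "f = Psi_mat emb s $$ (i, j)"
      using Psi_carrier by auto
    thus "fps_converges_at f z"
      using entire_Psi by (intro entire_converges) simp
  qed
  show "\<exists>\<Theta>\<in>carrier_mat n n. (\<forall>f\<in>elements_mat \<Theta>. \<forall>z. dist z 0 \<le> 1 \<longrightarrow> fps_converges_at f z) \<and>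
      inverts_mat (Psi_mat emb s) \<Theta> \<and> inverts_mat \<Theta> (Psi_mat emb s)"
    using Psi_unit_disk_inverse by metis
  show "map_mat fps_of_poly (Phi_mat emb s) * Psi_mat emb s =
      map_mat (fps_twist CARD('f) (- 1)) (Psi_mat emb s)"
    using Phi_Psi by (simp add: untw_def)
  show "invertible_mat (mat_value (Psi_mat emb s) \<theta>)"
    unfolding invertible_mat_def using Psi_value_inverse Psi_carrier
    by (metis carrier_matD mat_value_def index_map_mat(2,3) square_mat.simps)
qed (rule Psi_carrier)

end

theorem theorem1:
  fixes emb :: "'f::{field,finite} fls \<Rightarrow> 'c::complete_ultrametric_field"
    and s :: "nat list" and r :: nat
  assumes "C_infinity emb"
    and "r \<ge> 1" and "length s = r" and "\<forall>k \<in> set s. k > 0"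
  shows
    "(elements_mat (Phi_mat emb s) \<subseteq> polys_over (range (A_emb emb)) \<and>
      defines_dual_t_motive emb (r + 1) (Phi_mat emb s)) \<and>
     (map_mat fps_of_poly (Phi_mat emb s) * Psi_mat emb s =
        map_mat (fps_twist CARD('f) (- 1)) (Psi_mat emb s) \<and>
      (\<exists>P. is_period_matrix emb (r + 1) (Phi_mat emb s) (Psi_mat emb s) P)) \<and>
     (\<forall>i\<le>r. \<forall>j\<le>r. mat_value (Psi_mat emb s) (t_elt emb) $$ (i, j) =
        (if i < j then 0
         else if i = j then inverse (pi_tilde emb ^ tail_sum s j)
         else inverse (pi_tilde emb ^ tail_sum s j) *
           (\<Prod>k=j..<i. A_emb emb (carlitz_gamma (s ! k))) * multizeta emb (segment s j i))) \<and>
     mat_value (Psi_mat emb s) (t_elt emb) $$ (r, 0) =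
       (\<Prod>k<r. A_emb emb (carlitz_gamma (s ! k))) * multizeta emb s /
         pi_tilde emb ^ sum_list s"
proof -
  interpret C_infinity emb by fact
  interpret multizeta_tuple emb s
    by unfold_locales (rule assms(4))
  have n: "n = r + 1"
    using assms(3) by simp
  note motive = Phi_dual_t_motive[unfolded n] and unif = Psi_uniformizes[unfolded n]
  have entry: "mat_value (Psi_mat emb s) (t_elt emb) $$ (i, j) =
      (if i < j then 0 else inverse (pi_tilde emb ^ tail_sum s j) *
        (\<Prod>k=j..<i. A_emb emb (carlitz_gamma (s ! k))) * multizeta emb (segment s j i))"
    if "i \<le> r" "j \<le> r" for i j
    using that fps_value_Psi[of i j] Psi_carrier n by (simp add: mat_value_def)
  show ?thesis
  proof (intro conjI)
    show "elements_mat (Phi_mat emb s) \<subseteq> polys_over (range (A_emb emb))"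
      using motive by (simp add: defines_dual_t_motive_def)
    show "defines_dual_t_motive emb (r + 1) (Phi_mat emb s)"
      by (rule motive)
    show "map_mat fps_of_poly (Phi_mat emb s) * Psi_mat emb s =
        map_mat (fps_twist CARD('f) (- 1)) (Psi_mat emb s)"
      using unif by (simp add: uniformizes_def)
    show "\<exists>P. is_period_matrix emb (r + 1) (Phi_mat emb s) (Psi_mat emb s) P"
      unfolding is_period_matrix_def using motive unif Psi_value_inverse by metis
    show "\<forall>i\<le>r. \<forall>j\<le>r. mat_value (Psi_mat emb s) (t_elt emb) $$ (i, j) =
        (if i < j then 0
         else if i = j then inverse (pi_tilde emb ^ tail_sum s j)
         else inverse (pi_tilde emb ^ tail_sum s j) *
           (\<Prod>k=j..<i. A_emb emb (carlitz_gamma (s ! k))) * multizeta emb (segment s j i))"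
      by (auto simp: entry multizeta_Nil)
    show "mat_value (Psi_mat emb s) (t_elt emb) $$ (r, 0) =
       (\<Prod>k<r. A_emb emb (carlitz_gamma (s ! k))) * multizeta emb s / pi_tilde emb ^ sum_list s"
      using entry[of r 0] segment_full[of s] assms(3)
      by (simp add: tail_sum_0 divide_inverse mult_ac atLeast0LessThan)
  qed
qed

end
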